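(* Let $M,N\in\mathbb{N}$, let $[a,b]\subset\mathbb{R}$ be a compact interval, and let $W$ and $Z=(Z_{j,k})_{j,k=1}^{2N}$ satisfy the Standing Hypothesis stated in the context. Suppose that $Z_{N,N+1}$ is positive definite a.e. on $[a,b]$ and that the minimal operator $H_{Z,\min}$ is strictly positive, i.e. there is $\varepsilon\in(0,\infty)$ such that $\langle u,H_{Z,\min}u\rangle_W\ge \varepsilon\langle u,u\rangle_W$ for all $u\in\operatorname{dom}(H_{Z,\min})$. Let $\{\varphi_{j,k}\}_{j=1,k=1}^{2N,M}$ be the unique basis of $\ker(H_{Z,\max})$ satisfying $\Gamma\varphi_{j,k}=(\delta_{j,\ell}e_k)_{\ell=1}^{2N}$ for $1\le j\le 2N$, $1\le k\le M$, where $\{e_k\}_{k=1}^M$ is the standard basis of $\mathbb{C}^M$, and let $A_{\rm K},B_{\rm K}$ be the matrices built from this basis as in the context. Then the domain of the Krein--von Neumann extension $H_{Z,{\rm K}}$ of $H_{Z,\min}$ is $$\operatorname{dom}(H_{Z,{\rm K}})=\{y\in\operatorname{dom}(H_{Z,\max})\,|\,A_{\rm K}Y(a)=B_{\rm K}Y(b)\}.$$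
   Context: Notation. $X^{m\times n}$ is the set of $m\times n$ matrices with entries in $X$, and $X^m=X^{m\times1}$. $0_M,I_M$ are the zero and identity matrices in $\mathbb{C}^{M\times M}$; ${}^*$ on matrices is the Hermitian transpose. $\mathrm{L}([a,b])$ is the set of (a.e.-equivalence classes of) Lebesgue measurable functions $[a,b]\to\mathbb{C}$, $\mathrm{L}^1([a,b])$ its subset of integrable functions, $\mathrm{AC}([a,b])$ the complex-valued absolutely continuous functions on $[a,b]$. Standing Hypothesis. $M,N\in\mathbb{N}$; $[a,b]$ is a compact interval in $\mathbb{R}$; $W\in \mathrm{L}^1([a,b])^{M\times M}$ is positive definite a.e. on $[a,b]$; and $Z=(Z_{j,k})_{j,k=1}^{2N}\in[\mathrm{L}^1([a,b])^{M\times M}]^{2N\times2N}$ satisfies: (A1) $Z_{j,j+1}$ is invertible a.e. on $[a,b]$ for $1\le j\le 2N-1$; (A2) $Z_{j,k}=0_M$ a.e. on $[a,b]$ for $2\le j+1<k\le 2N$; (A3) $Z=J_{M,2N}Z^*J_{M,2N}$, where $J_{M,2N}=((-1)^j\delta_{j,2N+1-k}I_M)_{j,k=1}^{2N}$. Quasi-derivatives. Set $y^{[0]}=y$ for $y\in\mathfrak{D}_Z^{[0]}([a,b])=\mathrm{L}([a,b])^M$, and, with $Z_{2N,2N+1}:=I_M$, inductively for $1\le j\le 2N$, $$y^{[j]}=Z_{j,j+1}^{-1}\Big[(y^{[j-1]})'-\sum_{k=1}^jZ_{j,k}y^{[k-1]}\Big],\quad y\in\mathfrak{D}_Z^{[j]}([a,b])=\{g\in\mathfrak{D}_Z^{[j-1]}([a,b])\,|\,g^{[j-1]}\in\mathrm{AC}([a,b])^M\}.$$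 The quasi-differential expression is $\tau_Zy=(-1)^NW^{-1}y^{[2N]}$, $y\in\mathfrak{D}_Z^{[2N]}([a,b])$. Operators. $\mathrm{L}^2_W([a,b])$ is the Hilbert space of all $f\in\mathrm{L}([a,b])^M$ with $f^*Wf\in\mathrm{L}^1([a,b])$, with inner product $\langle f,g\rangle_W=\int_{[a,b]}g^*Wf$. The maximal operator is $H_{Z,\max}f=\tau_Zf$ on $\operatorname{dom}(H_{Z,\max})=\{y\in\mathrm{L}^2_W([a,b])\,|\,y\in\mathfrak{D}_Z^{[2N]}([a,b]),\ \tau_Zy\in\mathrm{L}^2_W([a,b])\}$. The minimal operator is $H_{Z,\min}f=\tau_Zf$ on $\operatorname{dom}(H_{Z,\min})=\{y\in\operatorname{dom}(H_{Z,\max})\,|\,y^{[j-1]}(a)=y^{[j-1]}(b)=0,\ 1\le j\le2N\}$. For $y\in\operatorname{dom}(H_{Z,\max})$ and $x\in\{a,b\}$, $Y(x)=(y^{[0]}(x),y^{[1]}(x),\dots,y^{[2N-1]}(x))^\top\in(\mathbb{C}^M)^{2N}$ (column of vectors). The map $\Gamma:\operatorname{dom}(H_{Z,\max})\to(\mathbb{C}^M)^{2N}$ is $\Gamma u=(u^{[0]}(a),\dots,u^{[N-1]}(a),u^{[0]}(b),\dots,u^{[N-1]}(b))^\top$. Under the hypotheses of the claim, the basis $\{\varphi_{j,k}\}$ described there exists and is unique. The matrices. For $1\le j,\ell\le2N$ let $\varphi_j^{[\ell-1]}=(\varphi_{j,1}^{[\ell-1]}\,|\,\cdots\,|\,\varphi_{j,M}^{[\ell-1]})$,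 an $M\times M$ matrix-valued function. For $X\in\{0,N\}$ let $\Phi_X=(\varphi_{k+X}^{[j+N-1]})_{j,k=1}^N$ ($N\times N$ block matrix with $M\times M$ blocks). With $I_{M,N}=(\delta_{j,k}I_M)_{j,k=1}^N$ and $0_{M,N}$ the $N\times N$ block matrix with all blocks $0_M$, $$A_{\rm K}=\begin{pmatrix}-\Phi_0(a)&I_{M,N}\\ \Phi_0(b)&0_{M,N}\end{pmatrix},\qquad B_{\rm K}=\begin{pmatrix}\Phi_N(a)&0_{M,N}\\-\Phi_N(b)&I_{M,N}\end{pmatrix}.$$ Krein--von Neumann extension. For nonnegative self-adjoint operators $A,B$ in a Hilbert space, $A\le B$ means $\langle u,(B+aI)^{-1}u\rangle\le\langle u,(A+aI)^{-1}u\rangle$ for all vectors $u$ and all $a\in(0,\infty)$. The Krein--von Neumann extension of a densely defined closed nonnegative operator $S$ is its smallest nonnegative self-adjoint extension in this order (it exists by a theorem of Krein). $H_{Z,{\rm K}}$ denotes that of $H_{Z,\min}$; $H_{Z,\min}$ is densely defined and closed with $(H_{Z,\min})^*=H_{Z,\max}$. *)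

theory Defs
  imports "HOL-Analysis.Analysis" "HOL-Library.Complex_Order"
begin

text \<open>
  The block size \<open>M\<close> is \<open>CARD('m)\<close>. The number \<open>2N\<close> of blocks is a natural number, so block
  matrices and block vectors are functions on \<open>nat\<close> of which only the indices \<open>1, \<dots>, n\<close> are
  relevant. The order on complex numbers is the one from \<open>Complex_Order\<close>: \<open>z \<le> w\<close> includes
  \<open>Im z = Im w\<close>.

  Elements of \<open>L([a,b])\<^sup>M\<close> are a.e.-equivalence classes. They are represented here by functions
  on the real line; equality of classes is \<open>ae_eq a b\<close>, and values outside \<open>[a,b]\<close> are irrelevant.
  Every set of functions or operator graph below is closed under \<open>ae_eq a b\<close>.
\<close>

section \<open>Matrices\<close>

type_synonym 'm cmat = "complex ^ 'm ^ 'm"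
type_synonym 'm vfun = "real \<Rightarrow> complex ^ 'm"
type_synonym 'm mfun = "real \<Rightarrow> complex ^ 'm ^ 'm"
type_synonym 'm bmat = "nat \<Rightarrow> nat \<Rightarrow> complex ^ 'm ^ 'm"
type_synonym 'm bvec = "nat \<Rightarrow> complex ^ 'm"

definition hermitian_transpose :: "'m::finite cmat \<Rightarrow> 'm cmat" where
  "hermitian_transpose A = (\<chi> i j. cnj (A $ j $ i))"

text \<open>\<open>sesq v A u\<close> is \<open>v\<^sup>* A u\<close>.\<close>

definition sesq :: "complex ^ 'm \<Rightarrow> 'm::finite cmat \<Rightarrow> complex ^ 'm \<Rightarrow> complex" where
  "sesq v A u = (\<Sum>i\<in>UNIV. cnj (v $ i) * (A *v u) $ i)"

definition positive_definite :: "'m::finite cmat \<Rightarrow> bool" where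
  "positive_definite A \<longleftrightarrow> (\<forall>v. v \<noteq> 0 \<longrightarrow> 0 < sesq v A v)"

definition bmat_mult :: "nat \<Rightarrow> 'm::finite bmat \<Rightarrow> 'm bmat \<Rightarrow> 'm bmat" where
  "bmat_mult n A B = (\<lambda>j k. \<Sum>l=1..n. A j l ** B l k)"

definition bmat_vec_mult :: "nat \<Rightarrow> 'm::finite bmat \<Rightarrow> 'm bvec \<Rightarrow> 'm bvec" where
  "bmat_vec_mult n A v = (\<lambda>j. \<Sum>k=1..n. A j k *v v k)"

definition bmat_hermitian_transpose :: "'m::finite bmat \<Rightarrow> 'm bmat" where
  "bmat_hermitian_transpose A = (\<lambda>j k. hermitian_transpose (A k j))"

definition bmat_one :: "'m::finite bmat" where
  "bmat_one = (\<lambda>j k. if j = k then mat 1 else 0)"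

definition bmat_zero :: "'m::finite bmat" where
  "bmat_zero = (\<lambda>j k. 0)"

definition bmat_uminus :: "'m::finite bmat \<Rightarrow> 'm bmat" where
  "bmat_uminus A = (\<lambda>j k. - A j k)"

text \<open>The matrix \<open>(A, B; C, D)\<close> assembled from four \<open>n \<times> n\<close> block matrices.\<close>

definition bmat_four :: "nat \<Rightarrow> 'm::finite bmat \<Rightarrow> 'm bmat \<Rightarrow> 'm bmat \<Rightarrow> 'm bmat \<Rightarrow> 'm bmat" where
  "bmat_four n A B C D = (\<lambda>j k.
     if j \<le> n then (if k \<le> n then A j k else B j (k - n))
     else (if k \<le> n then C (j - n) k else D (j - n) (k - n)))"

definition J_mat :: "nat \<Rightarrow> 'm::finite bmat" where
  "J_mat n = (\<lambda>j k. if j + k = n + 1 then mat ((-1) ^ j) else 0)"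


section \<open>Functions on an interval\<close>

definition ae_eq :: "real \<Rightarrow> real \<Rightarrow> (real \<Rightarrow> 'v) \<Rightarrow> (real \<Rightarrow> 'v) \<Rightarrow> bool" where
  "ae_eq a b f g \<longleftrightarrow> (AE x in lebesgue_on {a..b}. f x = g x)"

definition abs_cont_on :: "real \<Rightarrow> real \<Rightarrow> (real \<Rightarrow> 'v::real_normed_vector) \<Rightarrow> bool" where
  "abs_cont_on a b f \<longleftrightarrow>
     (\<forall>\<epsilon>>0. \<exists>\<delta>>0. \<forall>(n::nat) s t.
        (\<forall>i<n. a \<le> s i \<and> s i \<le> t i \<and> t i \<le> b) \<and>
        (\<forall>i<n. \<forall>j<n. i \<noteq> j \<longrightarrow> {s i<..<t i} \<inter> {s j<..<t j} = {}) \<and>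
        (\<Sum>i<n. t i - s i) < \<delta>
        \<longrightarrow> (\<Sum>i<n. norm (f (t i) - f (s i))) < \<epsilon>)"

text \<open>
  A class belongs to \<open>AC([a,b])\<^sup>M\<close> if it contains an absolutely continuous function. For \<open>a < b\<close>
  that function is unique on \<open>[a,b]\<close>; it provides the point values and the derivative of the class.
\<close>

definition in_AC :: "real \<Rightarrow> real \<Rightarrow> (real \<Rightarrow> 'v::real_normed_vector) \<Rightarrow> bool" where
  "in_AC a b f \<longleftrightarrow> (\<exists>g. abs_cont_on a b g \<and> ae_eq a b f g)"

definition AC_rep :: "real \<Rightarrow> real \<Rightarrow> (real \<Rightarrow> 'v::real_normed_vector) \<Rightarrow> real \<Rightarrow> 'v" where
  "AC_rep a b f = (SOME g. abs_cont_on a b g \<and> ae_eq a b f g)"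

definition AC_deriv :: "real \<Rightarrow> real \<Rightarrow> (real \<Rightarrow> 'v::real_normed_vector) \<Rightarrow> real \<Rightarrow> 'v" where
  "AC_deriv a b f = (\<lambda>x. vector_derivative (AC_rep a b f) (at x within {a..b}))"


section \<open>Coefficients and quasi-derivatives\<close>

definition standing_hypothesis ::
  "real \<Rightarrow> real \<Rightarrow> nat \<Rightarrow> 'm::finite mfun \<Rightarrow> (nat \<Rightarrow> nat \<Rightarrow> 'm mfun) \<Rightarrow> bool" where
  "standing_hypothesis a b N W Z \<longleftrightarrow>
     a < b \<and> 1 \<le> N \<and>
     integrable (lebesgue_on {a..b}) W \<and>
     (AE x in lebesgue_on {a..b}. positive_definite (W x)) \<and>
     (\<forall>j\<in>{1..2*N}. \<forall>k\<in>{1..2*N}. integrable (lebesgue_on {a..b}) (Z j k)) \<and>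
     (\<forall>j. 1 \<le> j \<and> j \<le> 2*N - 1 \<longrightarrow>
        (AE x in lebesgue_on {a..b}. invertible (Z j (j+1) x))) \<and>
     (\<forall>j k. 2 \<le> j + 1 \<and> j + 1 < k \<and> k \<le> 2*N \<longrightarrow> ae_eq a b (Z j k) (\<lambda>x. 0)) \<and>
     (\<forall>j\<in>{1..2*N}. \<forall>k\<in>{1..2*N}.
        ae_eq a b (Z j k)
          (\<lambda>x. bmat_mult (2*N) (J_mat (2*N))
                 (bmat_mult (2*N) (bmat_hermitian_transpose (\<lambda>j k. Z j k x)) (J_mat (2*N))) j k))"

text \<open>\<open>Z\<^bsub>j,j+1\<^esub>\<close>, with the convention \<open>Z\<^bsub>2N,2N+1\<^esub> = I\<^sub>M\<close>.\<close>

definition Z_super :: "nat \<Rightarrow> (nat \<Rightarrow> nat \<Rightarrow> 'm::finite mfun) \<Rightarrow> nat \<Rightarrow> 'm mfun" where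
  "Z_super N Z j = (if j = 2*N then (\<lambda>x. mat 1) else Z j (j+1))"

text \<open>\<open>quasi_deriv a b N Z y j\<close> is \<open>y\<^sup>[\<^sup>j\<^sup>]\<close>.\<close>

fun quasi_deriv ::
  "real \<Rightarrow> real \<Rightarrow> nat \<Rightarrow> (nat \<Rightarrow> nat \<Rightarrow> 'm::finite mfun) \<Rightarrow> 'm vfun \<Rightarrow> nat \<Rightarrow> 'm vfun" where
  "quasi_deriv a b N Z y 0 = y"
| "quasi_deriv a b N Z y (Suc j) =
     (\<lambda>x. matrix_inv (Z_super N Z (Suc j) x) *v
            (AC_deriv a b (quasi_deriv a b N Z y j) x
             - (\<Sum>k=1..Suc j. Z (Suc j) k x *v quasi_deriv a b N Z y (k - 1) x)))"

fun quasi_dom ::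
  "real \<Rightarrow> real \<Rightarrow> nat \<Rightarrow> (nat \<Rightarrow> nat \<Rightarrow> 'm::finite mfun) \<Rightarrow> nat \<Rightarrow> 'm vfun set" where
  "quasi_dom a b N Z 0 = borel_measurable (lebesgue_on {a..b})"
| "quasi_dom a b N Z (Suc j) = {g \<in> quasi_dom a b N Z j. in_AC a b (quasi_deriv a b N Z g j)}"

text \<open>The point value \<open>y\<^sup>[\<^sup>j\<^sup>](x)\<close>, meaningful if the class of \<open>y\<^sup>[\<^sup>j\<^sup>]\<close> lies in \<open>AC([a,b])\<^sup>M\<close>.\<close>

definition quasi_deriv_at ::
  "real \<Rightarrow> real \<Rightarrow> nat \<Rightarrow> (nat \<Rightarrow> nat \<Rightarrow> 'm::finite mfun) \<Rightarrow> 'm vfun \<Rightarrow> nat \<Rightarrow> 'm vfun" where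
  "quasi_deriv_at a b N Z y j = AC_rep a b (quasi_deriv a b N Z y j)"

definition quasi_diff_expr ::
  "real \<Rightarrow> real \<Rightarrow> nat \<Rightarrow> 'm::finite mfun \<Rightarrow> (nat \<Rightarrow> nat \<Rightarrow> 'm mfun) \<Rightarrow> 'm vfun \<Rightarrow> 'm vfun" where
  "quasi_diff_expr a b N W Z y =
     (\<lambda>x. (-1) ^ N *s (matrix_inv (W x) *v quasi_deriv a b N Z y (2*N) x))"


section \<open>The space \<open>L\<^sup>2\<^sub>W([a,b])\<close> and operators in it\<close>

definition L2W :: "real \<Rightarrow> real \<Rightarrow> 'm::finite mfun \<Rightarrow> 'm vfun set" where
  "L2W a b W = {f \<in> borel_measurable (lebesgue_on {a..b}).
                  integrable (lebesgue_on {a..b}) (\<lambda>x. sesq (f x) (W x) (f x))}"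

text \<open>Linear in the first and antilinear in the second argument.\<close>

definition inner_W :: "real \<Rightarrow> real \<Rightarrow> 'm::finite mfun \<Rightarrow> 'm vfun \<Rightarrow> 'm vfun \<Rightarrow> complex" where
  "inner_W a b W f g = (LINT x|lebesgue_on {a..b}. sesq (g x) (W x) (f x))"

text \<open>Operators are given by their graphs, which are closed under a.e. equality.\<close>

type_synonym 'm graph = "('m vfun \<times> 'm vfun) set"

definition graph_of ::
  "real \<Rightarrow> real \<Rightarrow> 'm::finite vfun set \<Rightarrow> ('m vfun \<Rightarrow> 'm vfun) \<Rightarrow> 'm graph" where
  "graph_of a b D T = {(f, g). f \<in> D \<and> ae_eq a b g (T f)}"

definition linear_operator :: "real \<Rightarrow> real \<Rightarrow> 'm::finite mfun \<Rightarrow> 'm graph \<Rightarrow> bool" where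
  "linear_operator a b W T \<longleftrightarrow>
     T \<subseteq> L2W a b W \<times> L2W a b W \<and>
     ((\<lambda>x. 0), (\<lambda>x. 0)) \<in> T \<and>
     (\<forall>f g f' g'. (f, g) \<in> T \<and> (f', g') \<in> T \<longrightarrow> ((\<lambda>x. f x + f' x), (\<lambda>x. g x + g' x)) \<in> T) \<and>
     (\<forall>c f g. (f, g) \<in> T \<longrightarrow> ((\<lambda>x. c *s f x), (\<lambda>x. c *s g x)) \<in> T) \<and>
     (\<forall>f g f' g'. (f, g) \<in> T \<and> ae_eq a b f f' \<and> ae_eq a b g g' \<longrightarrow> (f', g') \<in> T) \<and>
     (\<forall>f g g'. (f, g) \<in> T \<and> (f, g') \<in> T \<longrightarrow> ae_eq a b g g')"

definition densely_defined :: "real \<Rightarrow> real \<Rightarrow> 'm::finite mfun \<Rightarrow> 'm graph \<Rightarrow> bool" where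
  "densely_defined a b W T \<longleftrightarrow>
     (\<forall>u\<in>L2W a b W. \<forall>\<epsilon>>0. \<exists>f\<in>Domain T.
        sqrt (Re (inner_W a b W (\<lambda>x. u x - f x) (\<lambda>x. u x - f x))) < \<epsilon>)"

definition adjoint_op :: "real \<Rightarrow> real \<Rightarrow> 'm::finite mfun \<Rightarrow> 'm graph \<Rightarrow> 'm graph" where
  "adjoint_op a b W T = {(u, v). u \<in> L2W a b W \<and> v \<in> L2W a b W \<and>
     (\<forall>f g. (f, g) \<in> T \<longrightarrow> inner_W a b W g u = inner_W a b W f v)}"

definition self_adjoint :: "real \<Rightarrow> real \<Rightarrow> 'm::finite mfun \<Rightarrow> 'm graph \<Rightarrow> bool" where
  "self_adjoint a b W T \<longleftrightarrow>
     linear_operator a b W T \<and> densely_defined a b W T \<and> T = adjoint_op a b W T"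

definition nonnegative_op :: "real \<Rightarrow> real \<Rightarrow> 'm::finite mfun \<Rightarrow> 'm graph \<Rightarrow> bool" where
  "nonnegative_op a b W T \<longleftrightarrow> (\<forall>u v. (u, v) \<in> T \<longrightarrow> 0 \<le> inner_W a b W u v)"

definition strictly_positive_op :: "real \<Rightarrow> real \<Rightarrow> 'm::finite mfun \<Rightarrow> 'm graph \<Rightarrow> bool" where
  "strictly_positive_op a b W T \<longleftrightarrow>
     (\<exists>\<epsilon>::real. \<epsilon> > 0 \<and>
        (\<forall>u v. (u, v) \<in> T \<longrightarrow> complex_of_real \<epsilon> * inner_W a b W u u \<le> inner_W a b W u v))"

text \<open>
  \<open>resolvent_at a b T c u\<close> is \<open>(T + cI)\<^sup>-\<^sup>1 u\<close>; for nonnegative self-adjoint \<open>T\<close> and \<open>c > 0\<close> it is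
  determined up to a.e. equality.
\<close>

definition resolvent_at ::
  "real \<Rightarrow> real \<Rightarrow> 'm::finite graph \<Rightarrow> real \<Rightarrow> 'm vfun \<Rightarrow> 'm vfun" where
  "resolvent_at a b T c u =
     (SOME v. \<exists>w. (v, w) \<in> T \<and> ae_eq a b (\<lambda>x. w x + complex_of_real c *s v x) u)"

definition op_le :: "real \<Rightarrow> real \<Rightarrow> 'm::finite mfun \<Rightarrow> 'm graph \<Rightarrow> 'm graph \<Rightarrow> bool" where
  "op_le a b W A B \<longleftrightarrow>
     (\<forall>u\<in>L2W a b W. \<forall>c>0.
        inner_W a b W u (resolvent_at a b B c u) \<le> inner_W a b W u (resolvent_at a b A c u))"

definition nonneg_sa_extension ::
  "real \<Rightarrow> real \<Rightarrow> 'm::finite mfun \<Rightarrow> 'm graph \<Rightarrow> 'm graph \<Rightarrow> bool" where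
  "nonneg_sa_extension a b W S T \<longleftrightarrow> S \<subseteq> T \<and> self_adjoint a b W T \<and> nonnegative_op a b W T"

definition Krein_von_Neumann_extension ::
  "real \<Rightarrow> real \<Rightarrow> 'm::finite mfun \<Rightarrow> 'm graph \<Rightarrow> 'm graph" where
  "Krein_von_Neumann_extension a b W S =
     (THE T. nonneg_sa_extension a b W S T \<and>
             (\<forall>T'. nonneg_sa_extension a b W S T' \<longrightarrow> op_le a b W T T'))"


section \<open>Maximal and minimal operator\<close>

definition dom_max ::
  "real \<Rightarrow> real \<Rightarrow> nat \<Rightarrow> 'm::finite mfun \<Rightarrow> (nat \<Rightarrow> nat \<Rightarrow> 'm mfun) \<Rightarrow> 'm vfun set" where
  "dom_max a b N W Z =
     {y \<in> L2W a b W. y \<in> quasi_dom a b N Z (2*N) \<and> quasi_diff_expr a b N W Z y \<in> L2W a b W}"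

definition dom_min ::
  "real \<Rightarrow> real \<Rightarrow> nat \<Rightarrow> 'm::finite mfun \<Rightarrow> (nat \<Rightarrow> nat \<Rightarrow> 'm mfun) \<Rightarrow> 'm vfun set" where
  "dom_min a b N W Z =
     {y \<in> dom_max a b N W Z.
        \<forall>j\<in>{1..2*N}. quasi_deriv_at a b N Z y (j - 1) a = 0 \<and>
                     quasi_deriv_at a b N Z y (j - 1) b = 0}"

definition H_max ::
  "real \<Rightarrow> real \<Rightarrow> nat \<Rightarrow> 'm::finite mfun \<Rightarrow> (nat \<Rightarrow> nat \<Rightarrow> 'm mfun) \<Rightarrow> 'm graph" where
  "H_max a b N W Z = graph_of a b (dom_max a b N W Z) (quasi_diff_expr a b N W Z)"

definition H_min ::
  "real \<Rightarrow> real \<Rightarrow> nat \<Rightarrow> 'm::finite mfun \<Rightarrow> (nat \<Rightarrow> nat \<Rightarrow> 'm mfun) \<Rightarrow> 'm graph" where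
  "H_min a b N W Z = graph_of a b (dom_min a b N W Z) (quasi_diff_expr a b N W Z)"

definition kernel_op :: "'m::finite graph \<Rightarrow> 'm vfun set" where
  "kernel_op T = {f. (f, (\<lambda>x. 0)) \<in> T}"

text \<open>The classes of \<open>\<phi> i\<close>, for \<open>i\<close> in the finite index set \<open>I\<close>, form a basis of the space of
  classes of members of \<open>V\<close>.\<close>

definition ae_basis ::
  "real \<Rightarrow> real \<Rightarrow> 'i set \<Rightarrow> ('i \<Rightarrow> 'm::finite vfun) \<Rightarrow> 'm vfun set \<Rightarrow> bool" where
  "ae_basis a b I \<phi> V \<longleftrightarrow>
     finite I \<and> \<phi> ` I \<subseteq> V \<and>
     (\<forall>c. ae_eq a b (\<lambda>x. \<Sum>i\<in>I. c i *s \<phi> i x) (\<lambda>x. 0) \<longrightarrow> (\<forall>i\<in>I. c i = 0)) \<and>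
     (\<forall>f\<in>V. \<exists>c. ae_eq a b f (\<lambda>x. \<Sum>i\<in>I. c i *s \<phi> i x))"


section \<open>Boundary data\<close>

definition boundary_vec ::
  "real \<Rightarrow> real \<Rightarrow> nat \<Rightarrow> (nat \<Rightarrow> nat \<Rightarrow> 'm::finite mfun) \<Rightarrow> 'm vfun \<Rightarrow> real \<Rightarrow> 'm bvec" where
  "boundary_vec a b N Z y x = (\<lambda>j. quasi_deriv_at a b N Z y (j - 1) x)"

definition Gamma_map ::
  "real \<Rightarrow> real \<Rightarrow> nat \<Rightarrow> (nat \<Rightarrow> nat \<Rightarrow> 'm::finite mfun) \<Rightarrow> 'm vfun \<Rightarrow> 'm bvec" where
  "Gamma_map a b N Z u =
     (\<lambda>l. if l \<le> N then quasi_deriv_at a b N Z u (l - 1) a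
          else quasi_deriv_at a b N Z u (l - N - 1) b)"

text \<open>The matrix \<open>\<phi>\<^sub>j\<^sup>[\<^sup>l\<^sup>](x)\<close>, whose column with index \<open>k\<close> is \<open>\<phi>\<^bsub>j,k\<^esub>\<^sup>[\<^sup>l\<^sup>](x)\<close>.\<close>

definition phi_mat ::
  "real \<Rightarrow> real \<Rightarrow> nat \<Rightarrow> (nat \<Rightarrow> nat \<Rightarrow> 'm::finite mfun) \<Rightarrow> (nat \<Rightarrow> 'm \<Rightarrow> 'm vfun) \<Rightarrow>
   nat \<Rightarrow> nat \<Rightarrow> 'm mfun" where
  "phi_mat a b N Z \<phi> j l x = (\<chi> i k. quasi_deriv_at a b N Z (\<phi> j k) l x $ i)"

definition Phi_mat ::
  "real \<Rightarrow> real \<Rightarrow> nat \<Rightarrow> (nat \<Rightarrow> nat \<Rightarrow> 'm::finite mfun) \<Rightarrow> (nat \<Rightarrow> 'm \<Rightarrow> 'm vfun) \<Rightarrow>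
   nat \<Rightarrow> real \<Rightarrow> 'm bmat" where
  "Phi_mat a b N Z \<phi> X x = (\<lambda>j k. phi_mat a b N Z \<phi> (k + X) (j + N - 1) x)"

definition A_K ::
  "real \<Rightarrow> real \<Rightarrow> nat \<Rightarrow> (nat \<Rightarrow> nat \<Rightarrow> 'm::finite mfun) \<Rightarrow> (nat \<Rightarrow> 'm \<Rightarrow> 'm vfun) \<Rightarrow> 'm bmat" where
  "A_K a b N Z \<phi> =
     bmat_four N (bmat_uminus (Phi_mat a b N Z \<phi> 0 a)) bmat_one
                 (Phi_mat a b N Z \<phi> 0 b)               bmat_zero"

definition B_K ::
  "real \<Rightarrow> real \<Rightarrow> nat \<Rightarrow> (nat \<Rightarrow> nat \<Rightarrow> 'm::finite mfun) \<Rightarrow> (nat \<Rightarrow> 'm \<Rightarrow> 'm vfun) \<Rightarrow> 'm bmat" where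
  "B_K a b N Z \<phi> =
     bmat_four N (Phi_mat a b N Z \<phi> N a)               bmat_zero
                 (bmat_uminus (Phi_mat a b N Z \<phi> N b)) bmat_one"

end

theory Submission
  imports Defs "HOL-Library.Function_Algebras"
begin

text \<open>
  The Krein--von Neumann extension is identified with the restriction \<open>K\<close> of the maximal operator
  \<open>T\<close> to \<open>dom S + ker T\<close>, where \<open>S\<close> is the minimal operator. Green's formula and the solvability
  of initial value problems at both endpoints give \<open>ran S = (ker T)\<^sup>\<bottom>\<close>, hence \<open>S\<^sup>* = T\<close> and the
  self-adjointness of \<open>K\<close>. For a nonnegative self-adjoint extension \<open>T'\<close> of \<open>S\<close>, a vector
  \<open>v = v\<^sub>0 + n\<close> of \<open>dom K\<close> and \<open>w\<close> in \<open>dom T'\<close>, the Cauchy--Schwarz inequality for the form of \<open>T'\<close>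
  bounds \<open>\<langle>Kv, w\<rangle> = \<langle>T'v\<^sub>0, w\<rangle>\<close>, which yields the comparison of the resolvents; the comparison
  in both directions forces equality. Finally \<open>y\<close> lies in \<open>dom K\<close> iff all its boundary values agree
  with those of the element of \<open>ker T\<close> that has the same \<open>\<Gamma>\<close>-data, which is the stated condition.

  On the analytic side, absolutely continuous functions are indefinite integrals: the positive
  variation reduces this to monotone functions, whose Lebesgue--Stieltjes measures have
  Radon--Nikodym densities.
\<close>

section \<open>Absolute continuity and positive variation\<close>

text \<open>Vectors stay plain functions: classes are never formed, so the inner product on them is
  only semidefinite and equality means \<open>eqv\<close> or \<open>ae_eq\<close>. The choices
  hidden in \<open>AC_rep\<close> and \<open>resolvent_at\<close> are controlled up to that
  relation. The obstacle is that quasi-derivatives are built from chosen representatives and from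
  a.e. derivatives of them. The predicate \<open>sol\<close> removes it: membership in the maximal
  operator is equivalent to an integrated first-order system with integrable coefficients, and after
  that only primitives occur. This is why absolute continuity has to be identified with being an
  indefinite integral. The order between extensions is defined through resolvents, hence the proof
  that \<open>T + c\<close> is onto for every nonnegative self-adjoint \<open>T\<close> and
  \<open>c > 0\<close>.\<close>

definition interval_family :: "real \<Rightarrow> real \<Rightarrow> 'i set \<Rightarrow> ('i \<Rightarrow> real) \<Rightarrow> ('i \<Rightarrow> real) \<Rightarrow> bool" where
  "interval_family a b I s t \<longleftrightarrow> finite I \<and> (\<forall>i\<in>I. a \<le> s i \<and> s i \<le> t i \<and> t i \<le> b) \<and>
     (\<forall>i\<in>I. \<forall>j\<in>I. i \<noteq> j \<longrightarrow> {s i<..<t i} \<inter> {s j<..<t j} = {})"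

text \<open>The witness inside the definition of absolute continuity. Families may have any finite
  index set, so that intervals can be inserted, cut and collected in dependent sums without
  renumbering; here the sets are subsets of \<open>nat\<close> so that no type variable is hidden,
  and \<open>ac_modulusD\<close> transports the bound to other index types.\<close>

definition ac_modulus :: "real \<Rightarrow> real \<Rightarrow> (real \<Rightarrow> 'v::real_normed_vector) \<Rightarrow> real \<Rightarrow> real \<Rightarrow> bool" where
  "ac_modulus a b f \<epsilon> \<delta> \<longleftrightarrow> (\<forall>(I::nat set) s t. interval_family a b I s t \<longrightarrow>
     (\<Sum>i\<in>I. t i - s i) < \<delta> \<longrightarrow> (\<Sum>i\<in>I. norm (f (t i) - f (s i))) < \<epsilon>)"

lemma interval_family_reindex:
  assumes "bij_betw h J I" "interval_family a b I s t"
  shows "interval_family a b J (s \<circ> h) (t \<circ> h)"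
proof -
  have "finite J" using assms bij_betw_finite unfolding interval_family_def by blast
  moreover have "h i \<in> I" if "i \<in> J" for i using assms(1) that bij_betwE by blast
  moreover have "h i \<noteq> h j" if "i \<in> J" "j \<in> J" "i \<noteq> j" for i j
    using assms(1) that by (metis bij_betw_def inj_onD)
  ultimately show ?thesis using assms(2) unfolding interval_family_def by simp
qed

lemma ac_modulusD:
  fixes I :: "'i set"
  assumes m: "ac_modulus a b f \<epsilon> \<delta>" and fam: "interval_family a b I s t"
    and len: "(\<Sum>i\<in>I. t i - s i) < \<delta>"
  shows "(\<Sum>i\<in>I. norm (f (t i) - f (s i))) < \<epsilon>"
proof -
  have "finite I" using fam by (simp add: interval_family_def)
  then obtain h where h: "bij_betw h {0..<card I} I" using ex_bij_betw_nat_finite by blast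
  have "(\<Sum>i\<in>{0..<card I}. (t \<circ> h) i - (s \<circ> h) i) < \<delta>"
    using len sum.reindex_bij_betw[OF h, of "\<lambda>i. t i - s i"] by simp
  then have "(\<Sum>i\<in>{0..<card I}. norm (f ((t \<circ> h) i) - f ((s \<circ> h) i))) < \<epsilon>"
    using m interval_family_reindex[OF h fam] unfolding ac_modulus_def by blast
  then show ?thesis
    using sum.reindex_bij_betw[OF h, of "\<lambda>i. norm (f (t i) - f (s i))"] by simp
qed

lemma abs_cont_on_iff_modulus:
  "abs_cont_on a b f \<longleftrightarrow> (\<forall>\<epsilon>>0. \<exists>\<delta>>0. ac_modulus a b f \<epsilon> \<delta>)"
proof -
  have "(\<forall>(n::nat) s t. (\<forall>i<n. a \<le> s i \<and> s i \<le> t i \<and> t i \<le> b) \<and>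
        (\<forall>i<n. \<forall>j<n. i \<noteq> j \<longrightarrow> {s i<..<t i} \<inter> {s j<..<t j} = {}) \<and>
        (\<Sum>i<n. t i - s i) < \<delta> \<longrightarrow> (\<Sum>i<n. norm (f (t i) - f (s i))) < \<epsilon>)
      \<longleftrightarrow> ac_modulus a b f \<epsilon> \<delta>" (is "?L \<longleftrightarrow> ?R") for \<epsilon> \<delta>
  proof
    assume L: ?L
    show ?R unfolding ac_modulus_def
    proof (intro allI impI)
      fix I :: "nat set" and s t
      assume fam: "interval_family a b I s t" and len: "(\<Sum>i\<in>I. t i - s i) < \<delta>"
      have "finite I" using fam by (simp add: interval_family_def)
      then obtain h where h: "bij_betw h {0..<card I} I" using ex_bij_betw_nat_finite by blast
      have h': "bij_betw h {..<card I} I" using h by (simp add: lessThan_atLeast0)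
      have f': "interval_family a b {..<card I} (s \<circ> h) (t \<circ> h)"
        by (rule interval_family_reindex[OF h' fam])
      have "(\<Sum>i<card I. (t \<circ> h) i - (s \<circ> h) i) < \<delta>"
        using len sum.reindex_bij_betw[OF h', of "\<lambda>i. t i - s i"] by simp
      with f' L have "(\<Sum>i<card I. norm (f ((t \<circ> h) i) - f ((s \<circ> h) i))) < \<epsilon>"
        unfolding interval_family_def by blast
      then show "(\<Sum>i\<in>I. norm (f (t i) - f (s i))) < \<epsilon>"
        using sum.reindex_bij_betw[OF h', of "\<lambda>i. norm (f (t i) - f (s i))"] by simp
    qed
  next
    assume R: ?R
    show ?L
    proof (intro allI impI, elim conjE)
      fix n :: nat and s t :: "nat \<Rightarrow> real"
      assume "\<forall>i<n. a \<le> s i \<and> s i \<le> t i \<and> t i \<le> b"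
        "\<forall>i<n. \<forall>j<n. i \<noteq> j \<longrightarrow> {s i<..<t i} \<inter> {s j<..<t j} = {}"
        and l: "(\<Sum>i<n. t i - s i) < \<delta>"
      then have "interval_family a b {..<n} s t" unfolding interval_family_def by blast
      then show "(\<Sum>i<n. norm (f (t i) - f (s i))) < \<epsilon>"
        using R l unfolding ac_modulus_def by blast
    qed
  qed
  then show ?thesis unfolding abs_cont_on_def by presburger
qed

lemma interval_family_single: "a \<le> s \<Longrightarrow> s \<le> t \<Longrightarrow> t \<le> b \<Longrightarrow> interval_family a b {0::nat} (\<lambda>_. s) (\<lambda>_. t)"
  by (auto simp: interval_family_def)

lemma interval_family_mono:
  "interval_family u v I s t \<Longrightarrow> a \<le> u \<Longrightarrow> v \<le> b \<Longrightarrow> interval_family a b I s t"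
  unfolding interval_family_def by fastforce

text \<open>Disjoint open intervals have additive Lebesgue measure, and their union lies in the
  enclosing interval.\<close>

lemma interval_family_length:
  assumes "interval_family u v I s t" "u \<le> v"
  shows "(\<Sum>i\<in>I. t i - s i) \<le> v - u"
proof -
  have fin: "finite I" and le: "\<And>i. i \<in> I \<Longrightarrow> u \<le> s i \<and> s i \<le> t i \<and> t i \<le> v"
    and dis: "disjoint_family_on (\<lambda>i. {s i<..<t i}) I"
    using assms(1) unfolding interval_family_def disjoint_family_on_def by auto
  have "(\<Sum>i\<in>I. t i - s i) = (\<Sum>i\<in>I. measure lborel {s i<..<t i})"
    by (rule sum.cong) (use le in auto)
  also have "\<dots> = measure lborel (\<Union>i\<in>I. {s i<..<t i})"
    by (rule measure_finite_Union[symmetric]) (use fin dis le in \<open>auto simp: emeasure_lborel_Ioo\<close>)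
  also have "\<dots> \<le> measure lborel {u..v}"
  proof (rule measure_mono_fmeasurable)
    show "(\<Union>i\<in>I. {s i<..<t i}) \<subseteq> {u..v}" using le by force
    show "(\<Union>i\<in>I. {s i<..<t i}) \<in> sets lborel" using fin by (intro sets.finite_UN) auto
    show "{u..v} \<in> fmeasurable lborel" unfolding fmeasurable_def using emeasure_compact_finite[of "{u..v}"] by simp
  qed
  also have "\<dots> = v - u" using assms(2) by simp
  finally show ?thesis .
qed

lemma abs_cont_on_imp_continuous_on:
  assumes "abs_cont_on a b f"
  shows "continuous_on {a..b} f"
  unfolding continuous_on_iff
proof (intro ballI allI impI)
  fix x e :: real assume x: "x \<in> {a..b}" and e: "e > 0"
  obtain d where d: "d > 0" "ac_modulus a b f e d"
    using assms e abs_cont_on_iff_modulus by blast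
  have *: "norm (f t - f s) < e" if "a \<le> s" "s \<le> t" "t \<le> b" "t - s < d" for s t
    using ac_modulusD[OF d(2) interval_family_single[OF that(1-3)]] that(4) by simp
  show "\<exists>d>0. \<forall>x'\<in>{a..b}. dist x' x < d \<longrightarrow> dist (f x') (f x) < e"
  proof (intro exI[of _ d] conjI ballI impI)
    fix y assume y: "y \<in> {a..b}" "dist y x < d"
    show "dist (f y) (f x) < e"
      using *[of x y] *[of y x] x y by (cases "x \<le> y") (auto simp: dist_norm norm_minus_commute)
  qed (use d in auto)
qed

text \<open>The common source of the closure properties: differences, Lipschitz images, bilinear
  products and exponentials all satisfy such an estimate on the interval.\<close>

lemma abs_cont_on_lipschitz2:
  assumes "abs_cont_on a b f" "abs_cont_on a b g"
    and lip: "\<And>x y. x \<in> {a..b} \<Longrightarrow> y \<in> {a..b} \<Longrightarrow> norm (h x - h y) \<le> L * (norm (f x - f y) + norm (g x - g y))"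
  shows "abs_cont_on a b h"
  unfolding abs_cont_on_iff_modulus
proof (intro allI impI)
  fix e :: real assume e: "e > 0"
  \<comment> \<open>Enlarging \<open>L\<close> to a positive number allows division by it.\<close>
  define L' where "L' = max 1 L"
  have L': "L' > 0" "L \<le> L'" by (auto simp: L'_def)
  have e': "e / (2 * L') > 0" using e L' by simp
  obtain d1 where d1: "d1 > 0" "ac_modulus a b f (e / (2 * L')) d1"
    using assms(1) e' abs_cont_on_iff_modulus by blast
  obtain d2 where d2: "d2 > 0" "ac_modulus a b g (e / (2 * L')) d2"
    using assms(2) e' abs_cont_on_iff_modulus by blast
  have "ac_modulus a b h e (min d1 d2)"
    unfolding ac_modulus_def
  proof (intro allI impI)
    fix I :: "nat set" and s t
    assume F: "interval_family a b I s t" and len: "(\<Sum>i\<in>I. t i - s i) < min d1 d2"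
    have "(\<Sum>i\<in>I. norm (h (t i) - h (s i))) \<le> (\<Sum>i\<in>I. L' * (norm (f (t i) - f (s i)) + norm (g (t i) - g (s i))))"
    proof (rule sum_mono)
      fix i assume i: "i \<in> I"
      then have "a \<le> s i \<and> s i \<le> t i \<and> t i \<le> b" using F by (simp add: interval_family_def)
      then have "norm (h (t i) - h (s i)) \<le> L * (norm (f (t i) - f (s i)) + norm (g (t i) - g (s i)))"
        by (intro lip) auto
      also have "\<dots> \<le> L' * (norm (f (t i) - f (s i)) + norm (g (t i) - g (s i)))"
        using L' by (intro mult_right_mono) auto
      finally show "norm (h (t i) - h (s i)) \<le> L' * (norm (f (t i) - f (s i)) + norm (g (t i) - g (s i)))" .
    qed
    also have "\<dots> = L' * ((\<Sum>i\<in>I. norm (f (t i) - f (s i))) + (\<Sum>i\<in>I. norm (g (t i) - g (s i))))"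
      by (simp add: sum_distrib_left sum.distrib distrib_left)
    also have "\<dots> < L' * (e / (2 * L') + e / (2 * L'))"
      using ac_modulusD[OF d1(2) F] ac_modulusD[OF d2(2) F] len L'(1)
      by (intro mult_strict_left_mono) auto
    also have "\<dots> = e" using L'(1) by (simp add: field_simps)
    finally show "(\<Sum>i\<in>I. norm (h (t i) - h (s i))) < e" .
  qed
  then show "\<exists>\<delta>>0. ac_modulus a b h e \<delta>" using d1 d2 by (intro exI[of _ "min d1 d2"]) auto
qed

lemma abs_cont_on_minus:
  assumes "abs_cont_on a b f" "abs_cont_on a b g"
  shows "abs_cont_on a b (\<lambda>x. f x - g x)"
proof (rule abs_cont_on_lipschitz2[OF assms, of _ 1])
  fix x y
  have "f x - g x - (f y - g y) = (f x - f y) - (g x - g y)" by simp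
  then show "norm (f x - g x - (f y - g y)) \<le> 1 * (norm (f x - f y) + norm (g x - g y))"
    unfolding mult_1 by (metis norm_triangle_ineq4)
qed

lemma abs_cont_on_lipschitz_image:
  assumes "abs_cont_on a b f" and lip: "\<And>x y. x \<in> {a..b} \<Longrightarrow> y \<in> {a..b} \<Longrightarrow> norm (g x - g y) \<le> L * norm (f x - f y)"
  shows "abs_cont_on a b g"
proof (rule abs_cont_on_lipschitz2[OF assms(1,1), of _ "L / 2"])
  show "norm (g x - g y) \<le> L / 2 * (norm (f x - f y) + norm (f x - f y))" if "x \<in> {a..b}" "y \<in> {a..b}" for x y
    using lip[OF that] by simp
qed

text \<open>Clamping both endpoints at \<open>x\<close> cuts every interval there. An interval on
  the wrong side collapses to a point; \<open>interval_family\<close> admits such degenerate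
  intervals, so the index set stays the same.\<close>

lemma interval_family_clamp:
  assumes "interval_family u v I s t" "u \<le> x" "x \<le> v"
  shows "interval_family u x I (\<lambda>i. min (s i) x) (\<lambda>i. min (t i) x)"
    and "interval_family x v I (\<lambda>i. max (s i) x) (\<lambda>i. max (t i) x)"
proof -
  have "{min (s i) x<..<min (t i) x} \<subseteq> {s i<..<t i}" "{max (s i) x<..<max (t i) x} \<subseteq> {s i<..<t i}" for i
    by (auto simp: min_def max_def split: if_splits)
  then have d: "{s i<..<t i} \<inter> {s j<..<t j} = {} \<Longrightarrow> {min (s i) x<..<min (t i) x} \<inter> {min (s j) x<..<min (t j) x} = {}"
     "{s i<..<t i} \<inter> {s j<..<t j} = {} \<Longrightarrow> {max (s i) x<..<max (t i) x} \<inter> {max (s j) x<..<max (t j) x} = {}" for i j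
    by blast+
  show "interval_family u x I (\<lambda>i. min (s i) x) (\<lambda>i. min (t i) x)"
    "interval_family x v I (\<lambda>i. max (s i) x) (\<lambda>i. max (t i) x)"
    using assms d unfolding interval_family_def by (auto simp del: Int_greaterThanLessThan greaterThanLessThan_empty_iff simp: min_le_iff_disj le_max_iff_disj)
qed

lemma sum_clamp:
  fixes F :: "real \<Rightarrow> real"
  shows "(\<Sum>i\<in>I. F (t i) - F (s i)) =
    (\<Sum>i\<in>I. F (min (t i) x) - F (min (s i) x)) + (\<Sum>i\<in>I. F (max (t i) x) - F (max (s i) x))"
  unfolding sum.distrib[symmetric] by (rule sum.cong) (auto simp: min_def max_def)

text \<open>Signed increments, without positive parts: intervals on which \<open>F\<close> decreases
  can be left out of the family, so the supremum is still the positive variation.\<close>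

definition pos_sums :: "(real \<Rightarrow> real) \<Rightarrow> real \<Rightarrow> real \<Rightarrow> real set" where
  "pos_sums F u v = {r. \<exists>(I::nat set) s t. interval_family u v I s t \<and> r = (\<Sum>i\<in>I. F (t i) - F (s i))}"

definition pos_variation :: "(real \<Rightarrow> real) \<Rightarrow> real \<Rightarrow> real \<Rightarrow> real" where
  "pos_variation F u v = Sup (pos_sums F u v)"

lemma zero_in_pos_sums: "0 \<in> pos_sums F u v"
  unfolding pos_sums_def by (rule CollectI, rule exI[of _ "{}"]) (auto simp: interval_family_def)

lemma pos_sums_nonempty: "pos_sums F u v \<noteq> {}"
  using zero_in_pos_sums by blast

lemma pos_sums_mono: "a \<le> u \<Longrightarrow> v \<le> b \<Longrightarrow> pos_sums F u v \<subseteq> pos_sums F a b"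
  unfolding pos_sums_def using interval_family_mono by blast

text \<open>Walk through the interval in steps shorter than a modulus for the bound 1. Each step
  raises the possible sums by at most 1, and finitely many steps reach \<open>b\<close>.\<close>

lemma abs_cont_on_pos_sums_bdd:
  fixes F :: "real \<Rightarrow> real"
  assumes F: "abs_cont_on a b F" and ab: "a \<le> b"
  shows "bdd_above (pos_sums F a b)"
proof -
  obtain d where d: "d > 0" "ac_modulus a b F 1 d"
    using F abs_cont_on_iff_modulus by (metis zero_less_one)
  \<comment> \<open>The step \<open>d/2\<close> keeps each new piece strictly shorter than
    \<open>d\<close>, and \<open>min b\<close> stops the walk at \<open>b\<close>.\<close>
  have "\<exists>B. \<forall>r \<in> pos_sums F a (min b (a + real k * (d/2))). r \<le> B" for k
  proof (induction k)
    case 0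
    have min: "min b (a + real 0 * (d/2)) = a" using ab by simp
    have "r \<le> 0" if r0: "r \<in> pos_sums F a (min b (a + real 0 * (d/2)))" for r
    proof -
      obtain I :: "nat set" and s t where "interval_family a a I s t" "r = (\<Sum>i\<in>I. F (t i) - F (s i))"
        using r0 min unfolding pos_sums_def by auto
      moreover have "t i = s i" if "interval_family a a I s t" "i \<in> I" for i
        using that unfolding interval_family_def by force
      ultimately show ?thesis by simp
    qed
    then show ?case by blast
  next
    case (Suc k)
    then obtain B where B: "\<forall>r \<in> pos_sums F a (min b (a + real k * (d/2))). r \<le> B" by blast
    define x where "x = min b (a + real k * (d/2))"
    define v where "v = min b (a + real (Suc k) * (d/2))"
    have xv: "a \<le> x" "x \<le> v" "v \<le> b" "v - x < d"
      using d ab by (auto simp: x_def v_def min_def field_simps)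
    have "r \<le> B + 1" if rv: "r \<in> pos_sums F a v" for r
    proof -
      obtain I :: "nat set" and s t where f: "interval_family a v I s t" and r: "r = (\<Sum>i\<in>I. F (t i) - F (s i))"
        using rv unfolding pos_sums_def by auto
      have "(\<Sum>i\<in>I. F (min (t i) x) - F (min (s i) x)) \<le> B"
        using interval_family_clamp(1)[OF f xv(1,2)] B unfolding x_def[symmetric] pos_sums_def by blast
      moreover have fx: "interval_family x v I (\<lambda>i. max (s i) x) (\<lambda>i. max (t i) x)"
        by (rule interval_family_clamp(2)[OF f xv(1,2)])
      have "(\<Sum>i\<in>I. norm (F (max (t i) x) - F (max (s i) x))) < 1"
        by (rule ac_modulusD[OF d(2) interval_family_mono[OF fx]])
          (use xv interval_family_length[OF fx] in auto)
      then have "(\<Sum>i\<in>I. F (max (t i) x) - F (max (s i) x)) \<le> 1"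
        by (smt (verit, best) sum_mono real_norm_def)
      ultimately show ?thesis unfolding r sum_clamp[where x=x] by simp
    qed
    then show ?case unfolding v_def by blast
  qed
  moreover obtain k :: nat where "b - a < real k * (d/2)"
    using reals_Archimedean3[of "d/2"] d by (metis half_gt_zero)
  then have "min b (a + real k * (d/2)) = b" by simp
  ultimately show ?thesis unfolding bdd_above_def by metis
qed

section \<open>Positive variation of an absolutely continuous function\<close>

context
  fixes F :: "real \<Rightarrow> real" and a b :: real
  assumes F: "abs_cont_on a b F" and ab: "a \<le> b"
begin

lemma pos_sums_bdd: "a \<le> u \<Longrightarrow> v \<le> b \<Longrightarrow> bdd_above (pos_sums F u v)"
  using abs_cont_on_pos_sums_bdd[OF F ab] pos_sums_mono bdd_above_mono by metis

lemma pos_variation_mono: "a \<le> x \<Longrightarrow> x \<le> y \<Longrightarrow> y \<le> b \<Longrightarrow> pos_variation F a x \<le> pos_variation F a y"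
  unfolding pos_variation_def
  using pos_sums_nonempty[of F a x] pos_sums_bdd[of a y] pos_sums_mono[of a a x y F]
  by (intro cSup_subset_mono) auto

text \<open>Adjoin the interval from \<open>x\<close> to \<open>y\<close>, under a fresh index, to
  any family on \<open>[a, x]\<close>. Consequently \<open>pos_variation F a - F\<close> is
  nondecreasing, the other half of the Jordan decomposition.\<close>

lemma pos_variation_increment:
  assumes "a \<le> x" "x \<le> y" "y \<le> b"
  shows "pos_variation F a x + (F y - F x) \<le> pos_variation F a y"
proof -
  have "r \<le> pos_variation F a y - (F y - F x)" if r: "r \<in> pos_sums F a x" for r
  proof -
    obtain I :: "nat set" and s t where f: "interval_family a x I s t" and r: "r = (\<Sum>i\<in>I. F (t i) - F (s i))"
      using r unfolding pos_sums_def by auto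
    have fin: "finite I" using f by (simp add: interval_family_def)
    then obtain k where k: "k \<notin> I" using ex_new_if_finite infinite_UNIV_nat by blast
    have "interval_family a y (insert k I) (s(k := x)) (t(k := y))"
      unfolding interval_family_def
    proof (intro conjI ballI impI)
      show "finite (insert k I)" using fin by simp
    next
      fix i assume "i \<in> insert k I"
      then show "a \<le> (s(k := x)) i" "(s(k := x)) i \<le> (t(k := y)) i" "(t(k := y)) i \<le> y"
        using f assms unfolding interval_family_def by fastforce+
    next
      fix i j assume ij: "i \<in> insert k I" "j \<in> insert k I" "i \<noteq> j"
      have *: "{s i<..<t i} \<inter> {x<..<y} = {}" if "i \<in> I" for i
        using f that unfolding interval_family_def by fastforce
      show "{(s(k := x)) i<..<(t(k := y)) i} \<inter> {(s(k := x)) j<..<(t(k := y)) j} = {}"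
        using f ij * unfolding interval_family_def by (cases "i = k"; cases "j = k") (simp_all add: Int_commute)
    qed
    moreover have "(\<Sum>i\<in>insert k I. F ((t(k := y)) i) - F ((s(k := x)) i)) = F y - F x + r"
    proof -
      have "(\<Sum>i\<in>I. F ((t(k := y)) i) - F ((s(k := x)) i)) = r"
        unfolding r using k by (intro sum.cong) auto
      then show ?thesis using fin k by simp
    qed
    ultimately have "F y - F x + r \<in> pos_sums F a y"
      unfolding pos_sums_def mem_Collect_eq by metis
    then have "F y - F x + r \<le> pos_variation F a y"
      unfolding pos_variation_def using pos_sums_bdd[of a y] assms by (intro cSup_upper) auto
    then show ?thesis by simp
  qed
  then have "pos_variation F a x \<le> pos_variation F a y - (F y - F x)"
    unfolding pos_variation_def[of F a x] using pos_sums_nonempty by (intro cSup_least) auto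
  then show ?thesis by simp
qed

text \<open>Cut a family on \<open>[a, y]\<close> at \<open>x\<close>: the left part is bounded by
  the variation up to \<open>x\<close>, the right part by \<open>B\<close>. The contrapositive
  supplies near-optimal families on \<open>[x, y]\<close>.\<close>

lemma pos_variation_split:
  assumes "a \<le> x" "x \<le> y" "y \<le> b" and B: "\<And>r. r \<in> pos_sums F x y \<Longrightarrow> r \<le> B"
  shows "pos_variation F a y \<le> pos_variation F a x + B"
  unfolding pos_variation_def[of F a y]
proof (rule cSup_least)
  fix r assume "r \<in> pos_sums F a y"
  then obtain I :: "nat set" and s t where f: "interval_family a y I s t" and r: "r = (\<Sum>i\<in>I. F (t i) - F (s i))"
    unfolding pos_sums_def by auto
  have "(\<Sum>i\<in>I. F (min (t i) x) - F (min (s i) x)) \<in> pos_sums F a x"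
    using interval_family_clamp(1)[OF f assms(1,2)] unfolding pos_sums_def by blast
  then have "(\<Sum>i\<in>I. F (min (t i) x) - F (min (s i) x)) \<le> pos_variation F a x"
    unfolding pos_variation_def using pos_sums_bdd[of a x] assms by (intro cSup_upper) auto
  moreover have "(\<Sum>i\<in>I. F (max (t i) x) - F (max (s i) x)) \<le> B"
    using interval_family_clamp(2)[OF f assms(1,2)] B unfolding pos_sums_def by blast
  ultimately show "r \<le> pos_variation F a x + B" unfolding r sum_clamp[where x=x] by simp
qed (rule pos_sums_nonempty)

text \<open>Replace each interval by a nearly optimal family inside it. All these families together
  form one family of no greater total length, so the modulus of \<open>F\<close> for
  \<open>e/2\<close> bounds the sum of their increments.\<close>

lemma abs_cont_on_pos_variation: "abs_cont_on a b (pos_variation F a)"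
  unfolding abs_cont_on_iff_modulus
proof (intro allI impI)
  fix e :: real assume e: "e > 0"
  obtain d where d: "d > 0" "ac_modulus a b F (e/2) d"
    using F e abs_cont_on_iff_modulus half_gt_zero by blast
  let ?P = "pos_variation F a"
  have "ac_modulus a b ?P e d"
    unfolding ac_modulus_def
  proof (intro allI impI)
    fix I :: "nat set" and s t
    assume fam: "interval_family a b I s t" and L: "(\<Sum>i\<in>I. t i - s i) < d"
    have fin: "finite I" and st: "\<And>i. i \<in> I \<Longrightarrow> a \<le> s i \<and> s i \<le> t i \<and> t i \<le> b"
      and dis: "\<And>i j. i \<in> I \<Longrightarrow> j \<in> I \<Longrightarrow> i \<noteq> j \<Longrightarrow> {s i<..<t i} \<inter> {s j<..<t j} = {}"
      using fam unfolding interval_family_def by auto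
    \<comment> \<open>One error per interval, in total below \<open>e / 2\<close>; adding 1 to the
      cardinality covers the empty family.\<close>
    define \<eta> where "\<eta> = e / (4 * (real (card I) + 1))"
    have \<eta>: "\<eta> > 0" "real (card I) * \<eta> < e / 2"
      using e by (auto simp: \<eta>_def field_simps add_pos_nonneg)
    have "\<exists>(J::nat set) p q. interval_family (s i) (t i) J p q \<and>
        ?P (t i) - ?P (s i) - \<eta> < (\<Sum>j\<in>J. F (q j) - F (p j))" if "i \<in> I" for i
    proof (rule ccontr)
      assume "\<not> ?thesis"
      \<comment> \<open>If every family fell short by \<open>\<eta>\<close>,
        \<open>pos_variation_split\<close> with the smaller bound would put \<open>?P (t i)\<close>
        below itself by \<open>\<eta>\<close>.\<close>
      then have "?P (t i) \<le> ?P (s i) + (?P (t i) - ?P (s i) - \<eta>)"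
        using st[OF that] by (intro pos_variation_split) (auto simp: pos_sums_def not_less)
      then show False using \<eta> by simp
    qed
    then have "\<forall>i\<in>I. \<exists>z. interval_family (s i) (t i) (fst z :: nat set) (fst (snd z)) (snd (snd z)) \<and>
        ?P (t i) - ?P (s i) - \<eta> < (\<Sum>j\<in>fst z. F (snd (snd z) j) - F (fst (snd z) j))"
      by fastforce
    then obtain Q where Q: "\<forall>i\<in>I. interval_family (s i) (t i) (fst (Q i) :: nat set) (fst (snd (Q i))) (snd (snd (Q i))) \<and>
        ?P (t i) - ?P (s i) - \<eta> < (\<Sum>j\<in>fst (Q i). F (snd (snd (Q i)) j) - F (fst (snd (Q i)) j))"
      using bchoice[of I "\<lambda>i z. interval_family (s i) (t i) (fst z :: nat set) (fst (snd z)) (snd (snd z)) \<and>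
        ?P (t i) - ?P (s i) - \<eta> < (\<Sum>j\<in>fst z. F (snd (snd z) j) - F (fst (snd z) j))"] by blast
    define J where "J i = fst (Q i)" for i
    define p where "p i = fst (snd (Q i))" for i
    define q where "q i = snd (snd (Q i))" for i
    have J: "interval_family (s i) (t i) (J i) (p i) (q i)"
      and JP: "?P (t i) - ?P (s i) - \<eta> < (\<Sum>j\<in>J i. F (q i j) - F (p i j))" if "i \<in> I" for i
      using Q that by (simp_all add: J_def p_def q_def)
    have finJ: "\<And>i. i \<in> I \<Longrightarrow> finite (J i)" using J unfolding interval_family_def by blast
    have big: "interval_family a b (Sigma I J) (\<lambda>(i,j). p i j) (\<lambda>(i,j). q i j)"
      unfolding interval_family_def
    proof (intro conjI ballI impI)
      show "finite (Sigma I J)" using fin finJ by auto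
    next
      fix z assume "z \<in> Sigma I J"
      then obtain i j where z: "z = (i,j)" "i \<in> I" "j \<in> J i" by auto
      then show "a \<le> (case z of (i,j) \<Rightarrow> p i j)" "(case z of (i,j) \<Rightarrow> p i j) \<le> (case z of (i,j) \<Rightarrow> q i j)"
        "(case z of (i,j) \<Rightarrow> q i j) \<le> b"
        using bspec[OF conjunct1[OF conjunct2[OF J[OF z(2), unfolded interval_family_def]]] z(3)] st[OF z(2)]
        by auto
    next
      fix z w assume zw: "z \<in> Sigma I J" "w \<in> Sigma I J" "z \<noteq> w"
      obtain i j where z: "z = (i,j)" "i \<in> I" "j \<in> J i" using zw by auto
      obtain i' j' where w: "w = (i',j')" "i' \<in> I" "j' \<in> J i'" using zw by auto
      have sub: "{p i j<..<q i j} \<subseteq> {s i<..<t i}" "{p i' j'<..<q i' j'} \<subseteq> {s i'<..<t i'}"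
        using bspec[OF conjunct1[OF conjunct2[OF J[OF z(2), unfolded interval_family_def]]] z(3)]
          bspec[OF conjunct1[OF conjunct2[OF J[OF w(2), unfolded interval_family_def]]] w(3)] by auto
      show "{case z of (i,j) \<Rightarrow> p i j<..<case z of (i,j) \<Rightarrow> q i j} \<inter> {case w of (i,j) \<Rightarrow> p i j<..<case w of (i,j) \<Rightarrow> q i j} = {}"
      proof (cases "i = i'")
        case True
        then show ?thesis using conjunct2[OF conjunct2[OF J[OF z(2), unfolded interval_family_def]]] z w zw(3)
          by (simp del: Int_greaterThanLessThan)
      next
        case False
        then show ?thesis unfolding z(1) w(1) prod.case using dis[OF z(2) w(2) False] sub by blast
      qed
    qed
    have "(\<Sum>z\<in>Sigma I J. (case z of (i,j) \<Rightarrow> q i j) - (case z of (i,j) \<Rightarrow> p i j)) = (\<Sum>i\<in>I. \<Sum>j\<in>J i. q i j - p i j)"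
      using fin finJ by (subst sum.Sigma) (auto intro!: sum.cong)
    also have "\<dots> \<le> (\<Sum>i\<in>I. t i - s i)"
      using J st by (intro sum_mono interval_family_length) auto
    finally have len: "(\<Sum>z\<in>Sigma I J. (case z of (i,j) \<Rightarrow> q i j) - (case z of (i,j) \<Rightarrow> p i j)) < d" using L by simp
    have "(\<Sum>i\<in>I. norm (?P (t i) - ?P (s i))) = (\<Sum>i\<in>I. ?P (t i) - ?P (s i))"
      using pos_variation_mono st by (intro sum.cong) auto
    also have "\<dots> \<le> (\<Sum>i\<in>I. (\<Sum>j\<in>J i. F (q i j) - F (p i j)) + \<eta>)"
      using JP by (intro sum_mono) (smt (verit))
    also have "\<dots> = (\<Sum>i\<in>I. \<Sum>j\<in>J i. F (q i j) - F (p i j)) + real (card I) * \<eta>"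
      by (simp add: sum.distrib)
    also have "(\<Sum>i\<in>I. \<Sum>j\<in>J i. F (q i j) - F (p i j)) = (\<Sum>z\<in>Sigma I J. F (case z of (i,j) \<Rightarrow> q i j) - F (case z of (i,j) \<Rightarrow> p i j))"
      using fin finJ by (subst sum.Sigma) (auto intro!: sum.cong)
    also have "\<dots> \<le> (\<Sum>z\<in>Sigma I J. norm (F (case z of (i,j) \<Rightarrow> q i j) - F (case z of (i,j) \<Rightarrow> p i j)))"
      by (intro sum_mono) auto
    also have "\<dots> < e / 2" by (rule ac_modulusD[OF d(2) big len])
    finally show "(\<Sum>i\<in>I. norm (?P (t i) - ?P (s i))) < e" using \<eta>(2) by simp
  qed
  then show "\<exists>\<delta>>0. ac_modulus a b ?P e \<delta>" using d by blast
qed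

end

section \<open>Absolutely continuous functions are indefinite integrals\<close>

lemma AE_lebesgue_on_iff_negligible:
  "(AE x in lebesgue_on {a..b::real}. P x) \<longleftrightarrow> (\<exists>N. negligible N \<and> (\<forall>x\<in>{a..b} - N. P x))"
proof -
  have "(AE x in lebesgue_on {a..b}. P x) \<longleftrightarrow> (AE x in lebesgue. x \<in> {a..b} \<longrightarrow> P x)"
    by (rule AE_restrict_space_iff) auto
  also have "\<dots> \<longleftrightarrow> (\<exists>N. negligible N \<and> {x. \<not> (x \<in> {a..b} \<longrightarrow> P x)} \<subseteq> N)"
    by (rule eventually_ae_filter_negligible)
  also have "\<dots> \<longleftrightarrow> (\<exists>N. negligible N \<and> (\<forall>x\<in>{a..b} - N. P x))" by blast
  finally show ?thesis .
qed

lemma integrable_lebesgue_on_iff: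
  fixes f :: "real \<Rightarrow> 'v::euclidean_space"
  shows "integrable (lebesgue_on {a..b}) f \<longleftrightarrow> f absolutely_integrable_on {a..b}"
  unfolding set_integrable_def by (rule integrable_restrict_space) auto

text \<open>A null set in \<open>[a, b]\<close> lies in an open set of measure below the modulus.
  The covering lemma covers it by nonoverlapping closed intervals inside that open set, and their
  total Stieltjes measure is a sum of increments of \<open>G\<close>, hence small. The constant
  continuation of \<open>G\<close> makes the outside of \<open>[a, b]\<close> null.\<close>

lemma interval_measure_absolutely_continuous:
  fixes G :: "real \<Rightarrow> real"
  assumes G: "abs_cont_on a b G" and ab: "a < b"
    and mono: "\<And>x y. a \<le> x \<Longrightarrow> x \<le> y \<Longrightarrow> y \<le> b \<Longrightarrow> G x \<le> G y"
  defines "g \<equiv> \<lambda>x. G (max a (min b x))"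
  shows "mono g" "continuous_on UNIV g" "absolutely_continuous lborel (interval_measure g)"
proof -
  show mg: "mono g" unfolding g_def mono_def using ab by (auto intro!: mono)
  then have mg': "x \<le> y \<Longrightarrow> g x \<le> g y" for x y by (rule monoD)
  show cg: "continuous_on UNIV g" unfolding g_def
    by (rule continuous_on_compose2[OF abs_cont_on_imp_continuous_on[OF G]])
      (use ab in \<open>auto intro!: continuous_intros\<close>)
  then have rcg: "continuous (at_right c) g" for c
    by (meson UNIV_I continuous_on_eq_continuous_within continuous_within_subset subset_UNIV)
  let ?\<mu> = "interval_measure g"
  have Icc: "emeasure ?\<mu> {c..d} = ennreal (g d - g c)" if "c \<le> d" for c d
    using emeasure_interval_measure_Icc[OF that mg' cg] by simp
  show "absolutely_continuous lborel ?\<mu>"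
    unfolding absolutely_continuous_def
  proof
    fix A :: "real set" assume A: "A \<in> null_sets lborel"
    then have Ab: "A \<in> sets borel" by (simp add: null_sets_def)
    define S where "S = A \<inter> {a..b}"
    have Sb: "S \<in> sets borel" unfolding S_def using Ab by auto
    have "emeasure ?\<mu> S \<le> 0 + ennreal \<epsilon>" if \<epsilon>: "\<epsilon> > 0" for \<epsilon>
    proof -
      obtain d where d: "d > 0" "ac_modulus a b G \<epsilon> d"
        using G \<epsilon> abs_cont_on_iff_modulus by blast
      have Sn: "S \<in> null_sets lebesgue"
        by (rule null_sets_completionI, rule null_sets_subset[OF A]) (use Sb in \<open>auto simp: S_def\<close>)
      obtain T where T: "open T" "S \<subseteq> T" "(T - S) \<in> lmeasurable" "emeasure lebesgue (T - S) < ennreal d"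
        using sets_lebesgue_outer_open[of S d] d Sb by auto
      have eT: "emeasure lborel T < ennreal d"
      proof -
        have "emeasure lebesgue T = emeasure lebesgue (T - S)"
          using emeasure_Diff_null_set[OF Sn, of T] T(1) by auto
        then show ?thesis using T by (simp add: emeasure_completion main_part_sets)
      qed
      \<comment> \<open>Every interval of the covering contains a point of \<open>S\<close>, and
        \<open>S\<close> lies in \<open>T\<close>, so this gauge forces the interval into
        \<open>T\<close>.\<close>
      define \<gamma> where "\<gamma> x = (if x \<in> T then T else UNIV)" for x :: real
      have "gauge \<gamma>" using T(1) by (auto simp: gauge_def \<gamma>_def)
      have Sc: "S \<subseteq> cbox a b" "box a b \<noteq> {}" using ab by (auto simp: S_def)
      have "\<exists>D. countable D \<and> \<Union>D \<subseteq> cbox a b \<and> (\<forall>K\<in>D. interior K \<noteq> {} \<and> (\<exists>c d. K = cbox c d)) \<and>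
        pairwise (\<lambda>A B. interior A \<inter> interior B = {}) D \<and> (\<forall>K\<in>D. \<exists>x \<in> S \<inter> K. K \<subseteq> \<gamma> x) \<and> S \<subseteq> \<Union>D"
      proof (rule covering_lemma[OF Sc \<open>gauge \<gamma>\<close>])
        fix D :: "real set set"
        assume d: "countable D" "\<Union>D \<subseteq> cbox a b" "pairwise (\<lambda>A B. interior A \<inter> interior B = {}) D" "S \<subseteq> \<Union>D"
          and "\<And>K. K \<in> D \<Longrightarrow> interior K \<noteq> {} \<and> (\<exists>c d. K = cbox c d)"
          and "\<And>K. K \<in> D \<Longrightarrow> \<exists>x \<in> S \<inter> K. K \<subseteq> \<gamma> x"
        then have "\<forall>K\<in>D. interior K \<noteq> {} \<and> (\<exists>c d. K = cbox c d)" "\<forall>K\<in>D. \<exists>x \<in> S \<inter> K. K \<subseteq> \<gamma> x"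
          by simp_all
        then show ?thesis using d by (intro exI[of _ D] conjI)
      qed
      then obtain D where D: "countable D" "\<Union>D \<subseteq> cbox a b"
        "\<And>K. K \<in> D \<Longrightarrow> interior K \<noteq> {} \<and> (\<exists>c d. K = cbox c d)"
        "pairwise (\<lambda>A B. interior A \<inter> interior B = {}) D"
        "\<And>K. K \<in> D \<Longrightarrow> \<exists>x \<in> S \<inter> K. K \<subseteq> \<gamma> x" "S \<subseteq> \<Union>D"
        by (elim exE conjE) (rule that, (erule (1) bspec | assumption)+)
      have "\<exists>c d. K = {c..d} \<and> c \<le> d \<and> a \<le> c \<and> d \<le> b \<and> K \<subseteq> T" if K: "K \<in> D" for K
      proof -
        obtain c d where cd: "K = {c..d}" using D(3)[OF K] by auto
        moreover have "c \<le> d" using D(3)[OF K] cd by (cases "c \<le> d") auto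
        moreover have "K \<subseteq> {a..b}" using D(2) K by auto
        ultimately have "K = {c..d} \<and> c \<le> d \<and> a \<le> c \<and> d \<le> b" by auto
        moreover have "K \<subseteq> T" 
        proof -
          obtain x where "x \<in> S" "K \<subseteq> \<gamma> x" using D(5)[OF K] by blast
          then show ?thesis using T(2) by (auto simp: \<gamma>_def split: if_splits)
        qed
        ultimately show ?thesis by blast
      qed
      then obtain l u where lu: "\<And>K. K \<in> D \<Longrightarrow> K = {l K..u K} \<and> l K \<le> u K \<and> a \<le> l K \<and> u K \<le> b \<and> K \<subseteq> T"
        by metis
      \<comment> \<open>The modulus concerns finite families; the countable covering follows by
        continuity of the measure from below.\<close>
      have fin: "emeasure ?\<mu> (\<Union>E) \<le> ennreal \<epsilon>" if E: "finite E" "E \<subseteq> D" for E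
      proof -
        have int: "interior K = {l K<..<u K}" if "K \<in> E" for K
        proof -
          have "K = {l K..u K}" using lu[of K] E that by blast
          then show ?thesis using interior_atLeastAtMost_real by metis
        qed
        have dis: "disjoint_family_on (\<lambda>K. {l K<..<u K}) E"
          unfolding disjoint_family_on_def using D(4) E int unfolding pairwise_def by (metis subsetD)
        have fam: "interval_family a b E l u"
          unfolding interval_family_def using E lu dis unfolding disjoint_family_on_def by blast
        have "ennreal (\<Sum>K\<in>E. u K - l K) = (\<Sum>K\<in>E. emeasure lborel {l K<..<u K})"
          using lu E by (subst sum_ennreal[symmetric]) (auto intro!: sum.cong)
        also have "\<dots> = emeasure lborel (\<Union>K\<in>E. {l K<..<u K})"
          by (rule sum_emeasure) (use dis E in auto)
        also have "\<dots> \<le> emeasure lborel T"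
        proof (rule emeasure_mono)
          show "(\<Union>K\<in>E. {l K<..<u K}) \<subseteq> T" using lu E by fastforce
        qed (use T in auto)
        finally have "ennreal (\<Sum>K\<in>E. u K - l K) < ennreal d" using eT by simp
        moreover have "0 \<le> (\<Sum>K\<in>E. u K - l K)" using lu E by (intro sum_nonneg) auto
        ultimately have len: "(\<Sum>K\<in>E. u K - l K) < d" by (simp add: ennreal_less_iff)
        have "(\<Union>K\<in>E. {l K..u K}) = (\<Union>K\<in>E. K)"
        proof (rule SUP_cong)
          fix K assume "K \<in> E"
          then show "{l K..u K} = K" using lu[of K] E by blast
        qed simp
        then have "emeasure ?\<mu> (\<Union>E) = emeasure ?\<mu> (\<Union>K\<in>E. {l K..u K})" by simp
        also have "\<dots> \<le> (\<Sum>K\<in>E. emeasure ?\<mu> {l K..u K})"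
          by (rule emeasure_subadditive_finite) (use E in auto)
        also have "\<dots> = (\<Sum>K\<in>E. ennreal (norm (G (u K) - G (l K))))"
        proof (rule sum.cong)
          fix K assume "K \<in> E"
          then have K: "l K \<le> u K" "a \<le> l K" "u K \<le> b" using lu E by auto
          then show "emeasure ?\<mu> {l K..u K} = ennreal (norm (G (u K) - G (l K)))"
            using Icc[OF K(1)] mono[OF K(2,1,3)] by (simp add: g_def)
        qed simp
        also have "\<dots> = ennreal (\<Sum>K\<in>E. norm (G (u K) - G (l K)))" by (simp add: sum_ennreal)
        also have "\<dots> \<le> ennreal \<epsilon>" using ac_modulusD[OF d(2) fam len] by (intro ennreal_leI) simp
        finally show ?thesis .
      qed
      show ?thesis
      proof (cases "D = {}")
        case True
        then show ?thesis using D(6) by simp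
      next
        case False
        define E where "E n = from_nat_into D ` {..n}" for n :: nat
        have En: "finite (E n)" "E n \<subseteq> D" for n
          using False from_nat_into[OF False] by (auto simp: E_def)
        have UD: "(\<Union>n. \<Union>(E n)) = \<Union>D"
        proof -
          have "(\<Union>n. E n) = from_nat_into D ` (\<Union>n. {..n})" by (simp add: E_def image_UN)
          also have "(\<Union>n::nat. {..n}) = UNIV" by auto
          finally have "(\<Union>n. E n) = D" using range_from_nat_into[OF False D(1)] by simp
          then show ?thesis by blast
        qed
        have "emeasure ?\<mu> S \<le> emeasure ?\<mu> (\<Union>n. \<Union>(E n))"
        proof (rule emeasure_mono)
          show "(\<Union>n. \<Union>(E n)) \<in> sets ?\<mu>"
          proof -
            have "\<Union>(E n) \<in> sets borel" for n
            proof (rule sets.finite_Union[OF En(1)])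
              show "E n \<subseteq> sets borel" using lu En(2) by (metis atLeastAtMost_borel subsetD subsetI)
            qed
            then show ?thesis by auto
          qed
        qed (use UD D(6) in auto)
        also have "\<dots> = (SUP n. emeasure ?\<mu> (\<Union>(E n)))"
        proof (rule SUP_emeasure_incseq[symmetric])
          have "\<Union>(E n) \<in> sets borel" for n
          proof (rule sets.finite_Union[OF En(1)])
            show "E n \<subseteq> sets borel" using lu En(2) by (metis atLeastAtMost_borel subsetD subsetI)
          qed
          then show "range (\<lambda>n. \<Union>(E n)) \<subseteq> sets ?\<mu>" by auto
          show "incseq (\<lambda>n. \<Union>(E n))" unfolding incseq_def E_def by (auto; fastforce)
        qed
        also have "\<dots> \<le> ennreal \<epsilon>" using fin En by (intro SUP_least) blast
        finally show ?thesis by simp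
      qed
    qed
    from ennreal_le_epsilon[OF this] have "emeasure ?\<mu> S \<le> 0" .
    then have S0: "S \<in> null_sets ?\<mu>" using Sb by (simp add: null_sets_def)
    \<comment> \<open>\<open>g\<close> is constant on these intervals, which together exhaust the
      complement of the open interval from \<open>a\<close> to \<open>b\<close>.\<close>
    have "{a - real n..a} \<in> null_sets ?\<mu>" "{b..b + real n} \<in> null_sets ?\<mu>" for n
      using Icc[of "a - real n" a] Icc[of b "b + real n"] ab by (auto simp: null_sets_def g_def)
    then have out: "(\<Union>n. {a - real n..a}) \<in> null_sets ?\<mu>" "(\<Union>n. {b..b + real n}) \<in> null_sets ?\<mu>"
      by (auto intro: null_sets_UN)
    have "A \<subseteq> S \<union> ((\<Union>n. {a - real n..a}) \<union> (\<Union>n. {b..b + real n}))"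
    proof
      fix x assume x: "x \<in> A"
      obtain n :: nat where n: "\<bar>x - a\<bar> + \<bar>x - b\<bar> \<le> real n" using real_arch_simple by blast
      consider "x \<in> S" | "x \<in> {a - real n..a}" | "x \<in> {b..b + real n}"
        using n x unfolding S_def by fastforce
      then show "x \<in> S \<union> ((\<Union>n. {a - real n..a}) \<union> (\<Union>n. {b..b + real n}))"
        by cases blast+
    qed
    then show "A \<in> null_sets ?\<mu>"
      using null_sets_subset[OF null_sets.Un[OF S0 null_sets.Un[OF out]]] Ab by auto
  qed
qed

text \<open>The integrand is the Radon-Nikodym density of the Stieltjes measure of
  \<open>G\<close>.\<close>

lemma mono_abs_cont_integral:
  fixes G :: "real \<Rightarrow> real"
  assumes G: "abs_cont_on a b G" and ab: "a < b"
    and mono: "\<And>x y. a \<le> x \<Longrightarrow> x \<le> y \<Longrightarrow> y \<le> b \<Longrightarrow> G x \<le> G y"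
  shows "\<exists>f. f absolutely_integrable_on {a..b} \<and> (\<forall>x\<in>{a..b}. G x = G a + integral {a..x} f)"
proof -
  define g where "g x = G (max a (min b x))" for x
  have g: "mono g" "continuous_on UNIV g" "absolutely_continuous lborel (interval_measure g)"
    using interval_measure_absolutely_continuous[OF assms] unfolding g_def by auto
  have Icc: "emeasure (interval_measure g) {c..d} = ennreal (g d - g c)" if "c \<le> d" for c d
    using emeasure_interval_measure_Icc[OF that monoD[OF g(1)] g(2)] by simp
  obtain f0 where f0: "f0 \<in> borel_measurable lborel" "density lborel f0 = interval_measure g"
    using sigma_finite_measure.Radon_Nikodym[OF sigma_finite_lborel g(3)] by auto
  have dens: "(\<integral>\<^sup>+t. f0 t * indicator {a..x} t \<partial>lborel) = ennreal (G x - G a)" if "x \<in> {a..b}" for x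
    using emeasure_density[OF f0(1), of "{a..x}"] Icc[of a x] that f0(2) ab by (simp add: g_def)
  \<comment> \<open>The density takes extended values. Its integral over \<open>[a, b]\<close> is
    finite, so it is finite a.e. there and agrees a.e. with its real version.\<close>
  define h where "h t = enn2real (f0 t * indicator {a..b} t)" for t
  have hm: "h \<in> borel_measurable borel" unfolding h_def using f0(1) by measurable
  have "AE t in lborel. f0 t * indicator {a..b} t \<noteq> \<infinity>"
    using f0(1) dens[of b] ab by (intro nn_integral_PInf_AE) auto
  then have AEh: "AE t in lborel. ennreal (h t) = f0 t * indicator {a..b} t"
    unfolding h_def by eventually_elim (simp add: ennreal_enn2real_if)
  have int: "(h has_integral (G x - G a)) {a..x}" if x: "x \<in> {a..b}" for x
  proof -
    have "(\<integral>\<^sup>+t. ennreal (indicator {a..x} t * h t) \<partial>lborel) = (\<integral>\<^sup>+t. f0 t * indicator {a..x} t \<partial>lborel)"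
      using AEh by (intro nn_integral_cong_AE, eventually_elim) (use x in \<open>auto simp: indicator_def split: if_splits\<close>)
    then have "(\<integral>\<^sup>+t. ennreal (indicator {a..x} t * h t) \<partial>lborel) = ennreal (G x - G a)" using dens[OF x] by simp
    moreover have hm': "(\<lambda>t. indicator {a..x} t * h t) \<in> borel_measurable borel" using hm by measurable
    have h0: "0 \<le> h t" for t by (simp add: h_def)
    ultimately have "((\<lambda>t. indicator {a..x} t * h t) has_integral (G x - G a)) UNIV"
      using hm' h0 x mono[of a x] ab by (intro nn_integral_has_integral) auto
    moreover have "(\<lambda>t. indicator {a..x} t * h t) = (\<lambda>t. if t \<in> {a..x} then h t else 0)" by auto
    ultimately show ?thesis using has_integral_restrict_UNIV[of "{a..x}" h] by metis
  qed
  show ?thesis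
  proof (intro exI conjI ballI)
    show "h absolutely_integrable_on {a..b}"
      using int[of b] ab by (intro nonnegative_absolutely_integrable_1) (auto simp: h_def)
    fix x assume "x \<in> {a..b}"
    then show "G x = G a + integral {a..x} h" using integral_unique[OF int] by simp
  qed
qed

text \<open>Jordan decomposition: \<open>F\<close> is the difference of its positive variation and
  \<open>pos_variation F a - F\<close>, both nondecreasing and absolutely continuous.\<close>

lemma real_abs_cont_integral:
  fixes F :: "real \<Rightarrow> real"
  assumes F: "abs_cont_on a b F" and ab: "a < b"
  shows "\<exists>f. f absolutely_integrable_on {a..b} \<and> (\<forall>x\<in>{a..b}. F x = F a + integral {a..x} f)"
proof -
  let ?P = "pos_variation F a"
  have P: "abs_cont_on a b ?P" using abs_cont_on_pos_variation[OF F] ab by simp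
  have "?P x \<le> ?P y" if "a \<le> x" "x \<le> y" "y \<le> b" for x y
    using pos_variation_mono[OF F _ that] ab by simp
  then have "\<exists>f. f absolutely_integrable_on {a..b} \<and> (\<forall>x\<in>{a..b}. ?P x = ?P a + integral {a..x} f)"
    by (rule mono_abs_cont_integral[OF P ab])
  then obtain p where p: "p absolutely_integrable_on {a..b}" "\<And>x. x \<in> {a..b} \<Longrightarrow> ?P x = ?P a + integral {a..x} p"
    by (elim exE conjE) (rule that, assumption, erule bspec)
  have "?P x - F x \<le> ?P y - F y" if "a \<le> x" "x \<le> y" "y \<le> b" for x y
    using pos_variation_increment[OF F _ that] ab by simp
  moreover define Q where "Q x = ?P x - F x" for x
  moreover have "abs_cont_on a b Q" unfolding Q_def by (rule abs_cont_on_minus[OF P F])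
  ultimately have "\<exists>f. f absolutely_integrable_on {a..b} \<and> (\<forall>x\<in>{a..b}. Q x = Q a + integral {a..x} f)"
    using mono_abs_cont_integral[of a b Q, OF _ ab] by simp
  then obtain q where q: "q absolutely_integrable_on {a..b}"
      "\<And>x. x \<in> {a..b} \<Longrightarrow> Q x = Q a + integral {a..x} q"
    by (elim exE conjE) (rule that, assumption, erule bspec)
  show ?thesis
  proof (intro exI conjI ballI)
    show "(\<lambda>x. p x - q x) absolutely_integrable_on {a..b}"
      by (rule set_integral_diff(1)[OF p(1) q(1)])
    fix x assume x: "x \<in> {a..b}"
    have "p integrable_on {a..x}" "q integrable_on {a..x}"
      using p(1) q(1) x by (auto intro: integrable_on_subinterval set_lebesgue_integral_eq_integral(1))
    then show "F x = F a + integral {a..x} (\<lambda>x. p x - q x)"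
      using p(2)[OF x] q(2)[OF x] by (simp add: Q_def Henstock_Kurzweil_Integration.integral_diff)
  qed
qed

text \<open>The working form of absolute continuity. The integrand is carried along as data, so that
  later arguments can manipulate it up to a.e. equality instead of choosing a derivative.\<close>

definition primitive_on :: "real \<Rightarrow> real \<Rightarrow> (real \<Rightarrow> 'v::euclidean_space) \<Rightarrow> (real \<Rightarrow> 'v) \<Rightarrow> bool" where
  "primitive_on a b F f \<longleftrightarrow> f absolutely_integrable_on {a..b} \<and> (\<forall>x\<in>{a..b}. F x = F a + integral {a..x} f)"

lemma abs_cont_on_primitive:
  fixes F :: "real \<Rightarrow> 'v::euclidean_space"
  assumes F: "abs_cont_on a b F" and ab: "a < b"
  shows "\<exists>f. primitive_on a b F f"
proof -
  have "\<exists>f. f absolutely_integrable_on {a..b} \<and> (\<forall>x\<in>{a..b}. F x \<bullet> i = F a \<bullet> i + integral {a..x} f)"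
    if "i \<in> Basis" for i
  proof -
    have "abs_cont_on a b (\<lambda>x. F x \<bullet> i)"
    proof (rule abs_cont_on_lipschitz_image[OF F, where L=1])
      fix x y
      have "norm (F x \<bullet> i - F y \<bullet> i) = \<bar>(F x - F y) \<bullet> i\<bar>" by (simp add: inner_diff_left)
      then show "norm (F x \<bullet> i - F y \<bullet> i) \<le> 1 * norm (F x - F y)"
        using Basis_le_norm[OF that, of "F x - F y"] by linarith
    qed
    from real_abs_cont_integral[OF this ab] show ?thesis .
  qed
  then have "\<forall>i\<in>Basis. \<exists>f. f absolutely_integrable_on {a..b} \<and> (\<forall>x\<in>{a..b}. F x \<bullet> i = F a \<bullet> i + integral {a..x} f)" ..
  from bchoice[OF this] obtain f where f: "\<And>i. i \<in> Basis \<Longrightarrow> f i absolutely_integrable_on {a..b}"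
    "\<And>i x. i \<in> Basis \<Longrightarrow> x \<in> {a..b} \<Longrightarrow> F x \<bullet> i = F a \<bullet> i + integral {a..x} (f i)"
    by (auto simp del: atLeastAtMost_iff)
  define h where "h x = (\<Sum>i\<in>Basis. f i x *\<^sub>R i)" for x
  have hi: "(\<lambda>x. h x \<bullet> i) = f i" if "i \<in> Basis" for i
    using that by (auto simp: h_def fun_eq_iff inner_sum_left inner_Basis if_distrib cong: if_cong)
  have abs: "h absolutely_integrable_on {a..b}"
    by (rule absolutely_integrable_componentwise) (use f(1) hi in auto)
  have "F x = F a + integral {a..x} h" if x: "x \<in> {a..b}" for x
  proof (rule euclidean_eqI)
    fix i :: 'v assume i: "i \<in> Basis"
    have "h integrable_on {a..x}"
      using abs x by (auto intro: integrable_on_subinterval set_lebesgue_integral_eq_integral(1))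
    then have "integral {a..x} h \<bullet> i = integral {a..x} (f i)"
      using integral_component_eq[of h "{a..x}" i] hi[OF i] by simp
    then show "F x \<bullet> i = (F a + integral {a..x} h) \<bullet> i" using f(2)[OF i x] by (simp add: inner_add_left)
  qed
  then show ?thesis using abs unfolding primitive_on_def by blast
qed

lemma interval_family_integral_le:
  fixes r :: "real \<Rightarrow> real"
  assumes fam: "interval_family a b I s t" and r: "r integrable_on {a..b}"
    and nonneg: "\<And>x. x \<in> {a..b} \<Longrightarrow> 0 \<le> r x"
  shows "(\<Sum>i\<in>I. integral {s i..t i} r) \<le> integral {a..b} r"
proof -
  have sub: "{s i..t i} \<subseteq> {a..b}" if "i \<in> I" for i
    using fam that by (auto simp: interval_family_def)
  have neg: "pairwise (\<lambda>i j. negligible ({s i..t i} \<inter> {s j..t j})) I"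
  proof (rule pairwiseI)
    fix i j assume "i \<in> I" "j \<in> I" "i \<noteq> j"
    then have dis: "{s i<..<t i} \<inter> {s j<..<t j} = {}" using fam unfolding interval_family_def by blast
    have "{s i..t i} \<inter> {s j..t j} \<subseteq> {s i, t i, s j, t j} \<union> {s i<..<t i} \<inter> {s j<..<t j}"
      by auto
    then show "negligible ({s i..t i} \<inter> {s j..t j})"
      unfolding dis by (rule negligible_subset[rotated]) auto
  qed
  have hi: "(r has_integral integral {s i..t i} r) {s i..t i}" if "i \<in> I" for i
    using integrable_integral integrable_on_subinterval[OF r sub[OF that]] by blast
  have "finite I" using fam by (simp add: interval_family_def)
  from has_integral_UN[OF this hi neg]
  have U: "(r has_integral (\<Sum>i\<in>I. integral {s i..t i} r)) (\<Union>i\<in>I. {s i..t i})" .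
  then have "(\<Sum>i\<in>I. integral {s i..t i} r) = integral (\<Union>i\<in>I. {s i..t i}) r"
    by (simp add: integral_unique)
  also have "\<dots> \<le> integral {a..b} r"
  proof (rule integral_subset_le)
    show "(\<Union>i\<in>I. {s i..t i}) \<subseteq> {a..b}" using sub by blast
    show "r integrable_on (\<Union>i\<in>I. {s i..t i})" using U by blast
  qed (use r nonneg in auto)
  finally show ?thesis .
qed

section \<open>Calculus of indefinite integrals\<close>

lemma primitive_onI:
  assumes "f absolutely_integrable_on {a..b}" "\<And>x. x \<in> {a..b} \<Longrightarrow> F x = F a + integral {a..x} f"
  shows "primitive_on a b F f"
  unfolding primitive_on_def using assms by blast

lemma primitive_onD:
  assumes "primitive_on a b F f"
  shows "f absolutely_integrable_on {a..b}" "x \<in> {a..b} \<Longrightarrow> F x = F a + integral {a..x} f"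
  using assms unfolding primitive_on_def by blast+

lemma primitive_on_increment:
  assumes "primitive_on a b F f" "a \<le> s" "s \<le> t" "t \<le> b"
  shows "f integrable_on {s..t}" "(\<lambda>x. norm (f x)) integrable_on {s..t}" "F t - F s = integral {s..t} f"
proof -
  have f: "f absolutely_integrable_on {a..b}" and F: "\<And>x. x \<in> {a..b} \<Longrightarrow> F x = F a + integral {a..x} f"
    using primitive_onD[OF assms(1)] by blast+
  have "f absolutely_integrable_on {s..t}"
    using absolutely_integrable_on_subinterval[OF f, of s t] assms by auto
  then show "f integrable_on {s..t}" "(\<lambda>x. norm (f x)) integrable_on {s..t}"
    by (auto simp: absolutely_integrable_on_def)
  have "f integrable_on {a..t}"
    using absolutely_integrable_on_subinterval[OF f, of a t] assms by (auto simp: absolutely_integrable_on_def)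
  then have "integral {a..s} f + integral {s..t} f = integral {a..t} f"
    using assms by (intro Henstock_Kurzweil_Integration.integral_combine) auto
  then have "integral {s..t} f = integral {a..t} f - integral {a..s} f" by (metis add_diff_cancel_left')
  then show "F t - F s = integral {s..t} f" using F[of s] F[of t] assms by simp
qed

text \<open>Truncation: \<open>norm (f x)\<close> splits into its minimum with \<open>n\<close>,
  which contributes at most \<open>n\<close> times the length, and a remainder of small
  integral.\<close>

lemma primitive_imp_abs_cont_on:
  assumes prim: "primitive_on a b F f" and ab: "a \<le> b"
  shows "abs_cont_on a b F"
  unfolding abs_cont_on_iff_modulus
proof (intro allI impI)
  fix e :: real assume e: "e > 0"
  define k where "k x = norm (f x)" for x
  define kn where "kn n x = min (k x) (real n)" for n x
  have kint: "k integrable_on {a..b}" using primitive_on_increment(2)[OF prim order_refl ab order_refl] unfolding k_def .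
  have kabs: "k absolutely_integrable_on {a..b}" using kint by (intro nonnegative_absolutely_integrable_1) (auto simp: k_def)
  have knint: "kn n integrable_on {a..b}" for n
  proof -
    have "(\<lambda>x. min (k x) (real n)) absolutely_integrable_on {a..b}"
      using absolutely_integrable_min[OF kabs, of "\<lambda>_. real n"]
      by (simp add: absolutely_integrable_continuous_real Basis_real_def)
    then show ?thesis unfolding kn_def absolutely_integrable_on_def by blast
  qed
  have "(\<lambda>n. integral {a..b} (kn n)) \<longlonglongrightarrow> integral {a..b} k"
  proof (rule dominated_convergence(2))
    show "(\<lambda>n. kn n x) \<longlonglongrightarrow> k x" for x
    proof (rule tendsto_eventually)
      obtain m :: nat where "k x \<le> real m" using real_arch_simple by blast
      then have "kn n x = k x" if "n \<ge> m" for n using that by (simp add: kn_def min_def)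
      then show "\<forall>\<^sub>F n in sequentially. kn n x = k x" unfolding eventually_sequentially by blast
    qed
  qed (use knint kint in \<open>auto simp: kn_def k_def\<close>)
  then obtain n where n: "norm (integral {a..b} (kn n) - integral {a..b} k) < e / 2"
    using e by (meson LIMSEQ_D half_gt_zero order_refl)
  \<comment> \<open>With this \<open>d\<close> the bounded part contributes at most
    \<open>e / 2\<close>; adding 1 covers \<open>n = 0\<close>.\<close>
  define d where "d = e / (2 * (real n + 1))"
  have d: "d > 0" using e by (auto simp: d_def)
  have "ac_modulus a b F e d"
    unfolding ac_modulus_def
  proof (intro allI impI)
    fix I :: "nat set" and s t
    assume fam: "interval_family a b I s t" and len: "(\<Sum>i\<in>I. t i - s i) < d"
    have st: "a \<le> s i" "s i \<le> t i" "t i \<le> b" if "i \<in> I" for i using fam that by (auto simp: interval_family_def)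
    have "(\<Sum>i\<in>I. norm (F (t i) - F (s i))) \<le> (\<Sum>i\<in>I. integral {s i..t i} (\<lambda>x. k x - kn n x) + real n * (t i - s i))"
    proof (rule sum_mono)
      fix i assume i: "i \<in> I"
      note p = primitive_on_increment[OF prim st[OF i]]
      have kn: "kn n integrable_on {s i..t i}" and k: "k integrable_on {s i..t i}"
        using st[OF i] by (auto intro!: integrable_on_subinterval[OF knint] integrable_on_subinterval[OF kint])
      have "norm (F (t i) - F (s i)) \<le> integral {s i..t i} k"
        unfolding p(3) using p k by (intro integral_norm_bound_integral) (auto simp: k_def)
      also have "\<dots> = integral {s i..t i} (\<lambda>x. k x - kn n x) + integral {s i..t i} (kn n)"
        using k kn by (simp add: Henstock_Kurzweil_Integration.integral_diff)
      also have "integral {s i..t i} (kn n) \<le> integral {s i..t i} (\<lambda>x. real n)"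
        using kn by (intro integral_le) (auto simp: kn_def)
      also have "\<dots> = real n * (t i - s i)" using st[OF i] by simp
      finally show "norm (F (t i) - F (s i)) \<le> integral {s i..t i} (\<lambda>x. k x - kn n x) + real n * (t i - s i)" by simp
    qed
    also have "\<dots> = (\<Sum>i\<in>I. integral {s i..t i} (\<lambda>x. k x - kn n x)) + real n * (\<Sum>i\<in>I. t i - s i)"
      by (simp add: sum.distrib sum_distrib_left)
    also have "(\<Sum>i\<in>I. integral {s i..t i} (\<lambda>x. k x - kn n x)) \<le> integral {a..b} (\<lambda>x. k x - kn n x)"
    proof (rule interval_family_integral_le[OF fam])
      show "(\<lambda>x. k x - kn n x) integrable_on {a..b}"
        by (rule Henstock_Kurzweil_Integration.integrable_diff[OF kint knint])
    qed (simp add: kn_def)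
    also have "\<dots> = integral {a..b} k - integral {a..b} (kn n)"
      using kint knint by (simp add: Henstock_Kurzweil_Integration.integral_diff)
    also have "\<dots> < e / 2" using n unfolding real_norm_def by linarith
    also have "real n * (\<Sum>i\<in>I. t i - s i) \<le> real n * d" using len by (intro mult_left_mono) auto
    also have "real n * d \<le> e / 2" using e by (simp add: d_def field_simps)
    finally show "(\<Sum>i\<in>I. norm (F (t i) - F (s i))) < e" by simp
  qed
  then show "\<exists>\<delta>>0. ac_modulus a b F e \<delta>" using d by blast
qed

text \<open>Lebesgue differentiation. The explicit theorem behind it averages to the right of a
  point, so the left derivative comes from the reflected function. The endpoints are excluded so
  that uniqueness of derivatives is available at the remaining points.\<close>

lemma primitive_on_has_vector_derivative:
  assumes prim: "primitive_on a b F f"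
  shows "AE x in lebesgue_on {a..b}. x \<in> {a<..<b} \<and> (F has_vector_derivative f x) (at x within {a..b})"
proof -
  have f: "f absolutely_integrable_on {a..b}" using prim by (rule primitive_onD)
  \<comment> \<open>Extension by zero, because the differentiation theorem asks for integrability on
    every bounded interval of the line.\<close>
  define h where "h x = (if x \<in> {a..b} then f x else 0)" for x
  have "h absolutely_integrable_on UNIV" unfolding h_def using f by (simp only: absolutely_integrable_restrict_UNIV)
  then have hint: "h integrable_on cbox c d" for c d
    by (meson absolutely_integrable_on_def integrable_on_subcbox subset_UNIV)
  have hint': "(\<lambda>x. h (- x)) integrable_on cbox c d" for c d :: real
    using hint[of "-d" "-c"] Henstock_Kurzweil_Integration.integrable_reflect_real[where f=h and a="-d" and b="-c"] by simp
  obtain N1 where N1: "negligible N1" "\<And>x e. \<lbrakk>x \<notin> N1; 0 < e\<rbrakk> \<Longrightarrow>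
      \<exists>d>0. \<forall>t. 0 < t \<and> t < d \<longrightarrow> norm (integral (cbox x (x + t *\<^sub>R One)) h /\<^sub>R t ^ DIM(real) - h x) < e"
    by (rule integrable_ccontinuous_explicit[OF hint]) (rule that, assumption, simp)
  obtain N2 where N2: "negligible N2" "\<And>x e. \<lbrakk>x \<notin> N2; 0 < e\<rbrakk> \<Longrightarrow>
      \<exists>d>0. \<forall>t. 0 < t \<and> t < d \<longrightarrow> norm (integral (cbox x (x + t *\<^sub>R One)) (\<lambda>x. h (- x)) /\<^sub>R t ^ DIM(real) - h (- x)) < e"
    by (rule integrable_ccontinuous_explicit[OF hint']) (rule that, assumption, simp)
  define N where "N = N1 \<union> uminus ` N2 \<union> {a, b}"
  have "negligible (uminus ` N2)"
    by (rule negligible_differentiable_image_negligible[OF order_refl N2(1)]) (auto intro!: derivative_intros)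
  then have "negligible N" using N1(1) unfolding N_def by (auto intro: negligible_Un)
  moreover have "x \<in> {a<..<b} \<and> (F has_vector_derivative f x) (at x within {a..b})" if x: "x \<in> {a..b} - N" for x
  proof
    show xi: "x \<in> {a<..<b}" using x by (auto simp: N_def)
    have x1: "x \<notin> N1" "- x \<notin> N2" using x by (auto simp: N_def image_iff) 
    show "(F has_vector_derivative f x) (at x within {a..b})"
      unfolding has_vector_derivative_def has_derivative_within_alt
    proof (intro conjI allI impI)
      fix e :: real assume e: "e > 0"
      obtain d1 where d1: "d1 > 0" "\<forall>t. 0 < t \<and> t < d1 \<longrightarrow> norm (integral {x..x + t} h /\<^sub>R t - h x) < e"
        using N1(2)[OF x1(1) e] by auto
      obtain d2 where d2: "d2 > 0" "\<forall>t. 0 < t \<and> t < d2 \<longrightarrow> norm (integral {-x..-x + t} (\<lambda>x. h (- x)) /\<^sub>R t - h x) < e"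
        using N2(2)[OF x1(2) e] by auto
      have *: "norm (integral {s..t} f - (t - s) *\<^sub>R f x) \<le> e * (t - s)"
        if "a \<le> s" "s < t" "t \<le> b" "norm (integral {s..t} h /\<^sub>R (t - s) - h x) < e" for s t
      proof -
        have "integral {s..t} f = integral {s..t} h"
          using that by (intro integral_cong) (auto simp: h_def)
        moreover have "h x = f x" using x by (simp add: h_def)
        ultimately have "integral {s..t} f - (t - s) *\<^sub>R f x = (t - s) *\<^sub>R (integral {s..t} h /\<^sub>R (t - s) - h x)"
          using that by (simp add: scaleR_diff_right)
        then have "norm (integral {s..t} f - (t - s) *\<^sub>R f x) = (t - s) * norm (integral {s..t} h /\<^sub>R (t - s) - h x)"
          using that by simp
        also have "\<dots> \<le> (t - s) * e" using that by (intro mult_left_mono) auto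
        finally show ?thesis by (simp add: mult.commute)
      qed
      show "\<exists>d>0. \<forall>y\<in>{a..b}. norm (y - x) < d \<longrightarrow> norm (F y - F x - (y - x) *\<^sub>R f x) \<le> e * norm (y - x)"
      proof (intro exI[of _ "min d1 d2"] conjI ballI impI)
        fix y assume y: "y \<in> {a..b}" "norm (y - x) < min d1 d2"
        consider "y = x" | "x < y" | "y < x" by linarith
        then show "norm (F y - F x - (y - x) *\<^sub>R f x) \<le> e * norm (y - x)"
        proof cases
          case 2
          have "norm (integral {x..x + (y - x)} h /\<^sub>R (y - x) - h x) < e"
            using spec[OF d1(2), of "y - x"] y(2) 2 by simp
          then have "norm (integral {x..y} f - (y - x) *\<^sub>R f x) \<le> e * (y - x)" using * x y 2 by auto
          then show ?thesis using primitive_on_increment(3)[OF prim, of x y] x y 2 by simp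
        next
          case 3
          have "norm (integral {-x..-x + (x - y)} (\<lambda>x. h (- x)) /\<^sub>R (x - y) - h x) < e"
            using spec[OF d2(2), of "x - y"] y(2) 3 by simp
          moreover have "integral {-x..-y} (\<lambda>x. h (- x)) = integral {y..x} h" by simp
          ultimately have "norm (integral {y..x} f - (x - y) *\<^sub>R f x) \<le> e * (x - y)" using * x y 3 by auto
          moreover have "F y - F x - (y - x) *\<^sub>R f x = - (integral {y..x} f - (x - y) *\<^sub>R f x)"
            using primitive_on_increment(3)[OF prim, of y x] x y 3 by (simp add: algebra_simps)
          moreover have "norm (y - x) = x - y" using 3 by simp
          ultimately show ?thesis by (metis norm_minus_cancel)
        qed simp
      qed (use d1 d2 in auto)
    qed (rule bounded_linear_scaleR_left)
  qed
  ultimately show ?thesis unfolding AE_lebesgue_on_iff_negligible by blast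
qed

text \<open>\<open>F\<close> is the integral of some \<open>g\<close>, and differentiating this
  integral gives \<open>g\<close>; uniqueness of the derivative identifies \<open>f\<close> with
  \<open>g\<close> a.e. In this way pointwise differentiation rules turn into integral
  identities.\<close>

lemma abs_cont_on_deriv_primitive:
  fixes F :: "real \<Rightarrow> 'v::euclidean_space"
  assumes F: "abs_cont_on a b F" and ab: "a < b"
    and der: "AE x in lebesgue_on {a..b}. (F has_vector_derivative f x) (at x within {a..b})"
  shows "primitive_on a b F f"
proof -
  obtain g where g: "primitive_on a b F g" using abs_cont_on_primitive[OF F ab] by blast
  have "AE x in lebesgue_on {a..b}. f x = g x"
    using der primitive_on_has_vector_derivative[OF g]
  proof eventually_elim
    case (elim x)
    have "at x within {a..b} \<noteq> bot" using elim by (simp add: at_within_Icc_at)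
    then show ?case using elim vector_derivative_unique_within by blast
  qed
  then obtain N where N: "negligible N" "\<And>x. x \<in> {a..b} - N \<Longrightarrow> f x = g x"
    unfolding AE_lebesgue_on_iff_negligible by blast
  have "f absolutely_integrable_on {a..b}"
    by (rule absolutely_integrable_spike[OF primitive_onD(1)[OF g] N])
  moreover have "integral {a..x} f = integral {a..x} g" if "x \<in> {a..b}" for x
    by (rule integral_spike[OF N(1)]) (use that N(2) in auto)
  ultimately show ?thesis using primitive_onD(2)[OF g] by (intro primitive_onI) metis+
qed

lemma primitive_on_AE_eq:
  assumes "primitive_on a b F f" "AE x in lebesgue_on {a..b}. g x = f x"
  shows "primitive_on a b F g"
proof -
  obtain N where N: "negligible N" "\<And>x. x \<in> {a..b} - N \<Longrightarrow> g x = f x"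
    using assms(2) unfolding AE_lebesgue_on_iff_negligible by blast
  have "g absolutely_integrable_on {a..b}"
    by (rule absolutely_integrable_spike[OF primitive_onD(1)[OF assms(1)] N])
  moreover have "integral {a..x} g = integral {a..x} f" if "x \<in> {a..b}" for x
    by (rule integral_spike[OF N(1)]) (use that N(2) in auto)
  ultimately show ?thesis using primitive_onD(2)[OF assms(1)] by (intro primitive_onI) metis+
qed

text \<open>The integrated product rule, from which the Lagrange identity is obtained. Products stay
  absolutely continuous because both factors are bounded on the interval.\<close>

lemma primitive_on_bilinear:
  fixes F :: "real \<Rightarrow> 'u::euclidean_space" and G :: "real \<Rightarrow> 'v::euclidean_space" and prod :: "'u \<Rightarrow> 'v \<Rightarrow> 'w::euclidean_space"
  assumes bil: "bounded_bilinear prod" and F: "primitive_on a b F f" and G: "primitive_on a b G g" and ab: "a < b"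
  shows "primitive_on a b (\<lambda>x. prod (F x) (G x)) (\<lambda>x. prod (F x) (g x) + prod (f x) (G x))"
proof (rule abs_cont_on_deriv_primitive[OF _ ab])
  interpret bounded_bilinear prod by (rule bil)
  have FA: "abs_cont_on a b F" and GA: "abs_cont_on a b G"
    using primitive_imp_abs_cont_on[OF F] primitive_imp_abs_cont_on[OF G] ab by auto
  have "compact (F ` {a..b})" "compact (G ` {a..b})"
    using abs_cont_on_imp_continuous_on[OF FA] abs_cont_on_imp_continuous_on[OF GA] by (auto intro: compact_continuous_image)
  then obtain B1 B2 where "\<forall>x\<in>F ` {a..b}. norm x \<le> B1" "\<forall>x\<in>G ` {a..b}. norm x \<le> B2"
    by (meson compact_imp_bounded bounded_iff)
  then have B: "norm (F x) \<le> max B1 B2" "norm (G x) \<le> max B1 B2" if "x \<in> {a..b}" for x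
    using that by (auto simp: le_max_iff_disj)
  define B where "B = max B1 B2"
  obtain K where K: "K > 0" "\<And>x y. norm (prod x y) \<le> norm x * norm y * K" using pos_bounded by blast
  show "abs_cont_on a b (\<lambda>x. prod (F x) (G x))"
  proof (rule abs_cont_on_lipschitz2[OF FA GA])
    fix x y assume xy: "x \<in> {a..b}" "y \<in> {a..b}"
    have "prod (F x) (G x) - prod (F y) (G y) = prod (F x - F y) (G x) + prod (F y) (G x - G y)"
      by (simp add: diff_left diff_right)
    then have "norm (prod (F x) (G x) - prod (F y) (G y)) \<le> norm (prod (F x - F y) (G x)) + norm (prod (F y) (G x - G y))"
      by (metis norm_triangle_ineq)
    also have "\<dots> \<le> norm (F x - F y) * norm (G x) * K + norm (F y) * norm (G x - G y) * K"
      by (intro add_mono K(2))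
    also have "\<dots> \<le> norm (F x - F y) * B * K + B * norm (G x - G y) * K"
      using B[OF xy(1)] B[OF xy(2)] K(1) unfolding B_def
      by (intro add_mono mult_right_mono mult_left_mono) auto
    also have "\<dots> = (B * K) * (norm (F x - F y) + norm (G x - G y))" by (simp add: algebra_simps)
    finally show "norm (prod (F x) (G x) - prod (F y) (G y)) \<le> (B * K) * (norm (F x - F y) + norm (G x - G y))" .
  qed
  show "AE x in lebesgue_on {a..b}. ((\<lambda>x. prod (F x) (G x)) has_vector_derivative prod (F x) (g x) + prod (f x) (G x)) (at x within {a..b})"
    using primitive_on_has_vector_derivative[OF F] primitive_on_has_vector_derivative[OF G]
    by eventually_elim (auto intro: bounded_bilinear.has_vector_derivative[OF bil])
qed

lemma primitive_on_sum:
  fixes F :: "'i \<Rightarrow> real \<Rightarrow> 'v::euclidean_space"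
  assumes "finite I" "\<And>i. i \<in> I \<Longrightarrow> primitive_on a b (F i) (f i)"
  shows "primitive_on a b (\<lambda>x. \<Sum>i\<in>I. F i x) (\<lambda>x. \<Sum>i\<in>I. f i x)"
proof (rule primitive_onI)
  show "(\<lambda>x. \<Sum>i\<in>I. f i x) absolutely_integrable_on {a..b}"
    using assms(1) primitive_onD(1)[OF assms(2)] by (intro absolutely_integrable_sum)
  fix x assume x: "x \<in> {a..b}"
  have "f i integrable_on {a..x}" if "i \<in> I" for i
    using primitive_on_increment(1)[OF assms(2)[OF that], of a x] x by auto
  then have "integral {a..x} (\<lambda>x. \<Sum>i\<in>I. f i x) = (\<Sum>i\<in>I. integral {a..x} (f i))"
    using assms(1) by (intro integral_sum) auto
  moreover have "F i x = F i a + integral {a..x} (f i)" if "i \<in> I" for i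
    by (rule primitive_onD(2)[OF assms(2)[OF that] x])
  ultimately show "(\<Sum>i\<in>I. F i x) = (\<Sum>i\<in>I. F i a) + integral {a..x} (\<lambda>x. \<Sum>i\<in>I. f i x)"
    by (simp only: sum.distrib[symmetric] cong: sum.cong)
qed

lemma primitive_on_linear:
  fixes F :: "real \<Rightarrow> 'u::euclidean_space" and h :: "'u \<Rightarrow> 'v::euclidean_space"
  assumes h: "bounded_linear h" and F: "primitive_on a b F f"
  shows "primitive_on a b (\<lambda>x. h (F x)) (\<lambda>x. h (f x))"
proof (rule primitive_onI)
  show "(\<lambda>x. h (f x)) absolutely_integrable_on {a..b}"
    using absolutely_integrable_linear[OF primitive_onD(1)[OF F] h] by (simp add: o_def)
  fix x assume x: "x \<in> {a..b}"
  have "f integrable_on {a..x}" using primitive_on_increment(1)[OF F, of a x] x by auto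
  then have "integral {a..x} (\<lambda>x. h (f x)) = h (integral {a..x} f)"
    using integral_linear[OF _ h] by (fastforce simp: o_def)
  moreover have "h (F x) = h (F a) + h (integral {a..x} f)"
    unfolding primitive_onD(2)[OF F x] by (rule linear_simps(1)[OF h])
  ultimately show "h (F x) = h (F a) + integral {a..x} (\<lambda>x. h (f x))" by simp
qed

lemma primitive_on_exp:
  fixes K k :: "real \<Rightarrow> real"
  assumes K: "primitive_on a b K k" and ab: "a < b"
  shows "primitive_on a b (\<lambda>x. exp (K x)) (\<lambda>x. k x * exp (K x))"
proof (rule abs_cont_on_deriv_primitive[OF _ ab])
  have KA: "abs_cont_on a b K" using primitive_imp_abs_cont_on[OF K] ab by auto
  have "compact (K ` {a..b})" using abs_cont_on_imp_continuous_on[OF KA] by (auto intro: compact_continuous_image)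
  then obtain B where "\<forall>x\<in>K ` {a..b}. norm x \<le> B" by (meson compact_imp_bounded bounded_iff)
  then have B: "K x \<le> B" if "x \<in> {a..b}" for x using that by (fastforce simp: abs_le_iff)
  have e: "exp u - exp v \<le> exp B * \<bar>u - v\<bar>" if "u \<le> B" "v \<le> B" for u v :: real
  proof -
    have "exp v * (1 + (u - v)) \<le> exp v * exp (u - v)" by (intro mult_left_mono exp_ge_add_one_self) auto
    have "exp u * (1 + (v - u)) \<le> exp u * exp (v - u)" by (intro mult_left_mono exp_ge_add_one_self) auto
    then have "exp u - exp v \<le> exp u * (u - v)" by (simp add: exp_diff algebra_simps)
    also have "\<dots> \<le> exp u * \<bar>u - v\<bar>" by (intro mult_left_mono) auto
    also have "\<dots> \<le> exp B * \<bar>u - v\<bar>" using that by (intro mult_right_mono) auto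
    finally show ?thesis .
  qed
  show "abs_cont_on a b (\<lambda>x. exp (K x))"
  proof (rule abs_cont_on_lipschitz_image[OF KA])
    fix x y assume "x \<in> {a..b}" "y \<in> {a..b}"
    then show "norm (exp (K x) - exp (K y)) \<le> exp B * norm (K x - K y)"
      using e[OF B B, of x y] e[OF B B, of y x] by (auto simp: abs_minus_commute abs_le_iff)
  qed
  show "AE x in lebesgue_on {a..b}. ((\<lambda>x. exp (K x)) has_vector_derivative k x * exp (K x)) (at x within {a..b})"
    using primitive_on_has_vector_derivative[OF K]
  proof eventually_elim
    case (elim x)
    then have "(K has_field_derivative k x) (at x within {a..b})"
      by (simp add: has_real_derivative_iff_has_vector_derivative)
    then have "((\<lambda>x. exp (K x)) has_field_derivative exp (K x) * k x) (at x within {a..b})"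
      by (auto intro!: derivative_eq_intros)
    then show ?case by (simp add: has_real_derivative_iff_has_vector_derivative mult.commute)
  qed
qed

section \<open>Linear systems with integrable coefficients\<close>

lemma bilinear_matrix_vector_mult:
  "bilinear ((*v) :: complex^'m::finite^'m \<Rightarrow> complex^'m \<Rightarrow> complex^'m)"
  unfolding bilinear_def
proof (intro conjI allI)
  show "linear (\<lambda>x. M *v x)" for M :: "complex^'m^'m"
    by (rule linearI)
      (auto simp: vec_eq_iff matrix_vector_mult_def sum.distrib algebra_simps scaleR_sum_right)
  show "linear (\<lambda>M. M *v x)" for x :: "complex^'m"
    by (rule linearI)
      (auto simp: vec_eq_iff matrix_vector_mult_def sum.distrib algebra_simps scaleR_sum_right)
qed

text \<open>A weight of Bielecki type: if \<open>w\<close> is the exponential of twice the integral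
  of \<open>k\<close> away from \<open>x0\<close>, then integrating from \<open>x0\<close> gains the
  factor 1/2, however long the interval is. Picard iteration therefore contracts globally.\<close>

lemma exponential_weight_exists:
  fixes k :: "real \<Rightarrow> real"
  assumes kint: "k absolutely_integrable_on {a..b}" and k0: "\<And>t. 0 \<le> k t" and ab: "a < b"
    and x0: "x0 = a \<or> x0 = b"
  shows "\<exists>w. continuous_on {a..b} w \<and> (\<forall>x. 0 < w x) \<and>
    (\<forall>(g :: real \<Rightarrow> 'v::euclidean_space) D x. x \<in> {a..b} \<longrightarrow> g integrable_on {a..b} \<longrightarrow> 0 \<le> D \<longrightarrow>
      (\<forall>t\<in>{a..b}. norm (g t) \<le> D * (k t * w t)) \<longrightarrow>
      norm (integral {a..x} g - integral {a..x0} g) \<le> D * w x / 2)"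
proof -
  define \<kappa> where "\<kappa> x = integral {a..x} k" for x
  have \<kappa>: "primitive_on a b \<kappa> k" using kint by (intro primitive_onI) (auto simp: \<kappa>_def)
  \<comment> \<open>The sign makes \<open>w\<close> grow away from \<open>x0\<close>, to the right
    of \<open>a\<close> or to the left of \<open>b\<close>; the modulus 2 is the origin of the
    factor 1/2.\<close>
  define \<sigma> where "\<sigma> = (if x0 = a then 2 else -2 :: real)"
  define w where "w x = exp (\<sigma> * (\<kappa> x - \<kappa> x0))" for x
  have "primitive_on a b (\<lambda>x. \<sigma> * (\<kappa> x - \<kappa> x0)) (\<lambda>x. \<sigma> * k x)"
  proof (rule primitive_onI)
    show "(\<lambda>x. \<sigma> * k x) absolutely_integrable_on {a..b}" using kint by (rule set_integrable_mult_right)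
    fix x assume x: "x \<in> {a..b}"
    have "\<kappa> a = 0" by (simp add: \<kappa>_def)
    then show "\<sigma> * (\<kappa> x - \<kappa> x0) = \<sigma> * (\<kappa> a - \<kappa> x0) + integral {a..x} (\<lambda>x. \<sigma> * k x)"
      by (simp add: \<kappa>_def algebra_simps)
  qed
  from primitive_on_exp[OF this ab] have w: "primitive_on a b w (\<lambda>x. \<sigma> * k x * w x)"
    unfolding w_def[abs_def] .
  have wc: "continuous_on {a..b} w"
    using primitive_imp_abs_cont_on[OF w] ab abs_cont_on_imp_continuous_on by auto
  have w0: "0 < w x" for x by (simp add: w_def)
  have wx0: "w x0 = 1" by (simp add: w_def)
  have "norm (integral {a..x} g - integral {a..x0} g) \<le> D * w x / 2"
    if x: "x \<in> {a..b}" and g: "g integrable_on {a..b}" and D: "0 \<le> D"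
      and le: "\<forall>t\<in>{a..b}. norm (g t) \<le> D * (k t * w t)"
    for g :: "real \<Rightarrow> 'v" and D x
  proof -
    have main: "norm (integral {s..t} g) \<le> (D / \<sigma>) * (w t - w s)" if "a \<le> s" "s \<le> t" "t \<le> b" for s t
    proof -
      have i: "(\<lambda>x. \<sigma> * k x * w x) integrable_on {s..t}" "w t - w s = integral {s..t} (\<lambda>x. \<sigma> * k x * w x)"
        using primitive_on_increment(1,3)[OF w that] by auto
      \<comment> \<open>The derivative of \<open>w\<close> is \<open>\<sigma> * k * w\<close>, so
        the dominating function is an exact derivative up to the factor
        \<open>D / \<sigma>\<close>.\<close>
      have e: "(\<lambda>x. D * (k x * w x)) = (\<lambda>x. (D / \<sigma>) * (\<sigma> * k x * w x))" by (auto simp: \<sigma>_def)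
      have "(\<lambda>x. D * (k x * w x)) integrable_on {s..t}"
        unfolding e using integrable_on_cmult_left[OF i(1), of "D / \<sigma>"] by simp
      moreover have "g integrable_on {s..t}" using g that by (intro integrable_on_subinterval[OF g]) auto
      ultimately have "norm (integral {s..t} g) \<le> integral {s..t} (\<lambda>x. D * (k x * w x))"
        using le that by (intro integral_norm_bound_integral) auto
      also have "\<dots> = (D / \<sigma>) * integral {s..t} (\<lambda>x. \<sigma> * k x * w x)" unfolding e by (rule integral_mult_right)
      finally show ?thesis using i(2) by simp
    qed
    show ?thesis
    proof (cases "x0 = a")
      case True
      then have "norm (integral {a..x} g) \<le> (D / 2) * (w x - 1)"
        using main[of a x] x wx0 by (simp add: \<sigma>_def)
      also have "\<dots> \<le> D * w x / 2" using D by (simp add: algebra_simps)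
      finally show ?thesis using True by simp
    next
      case False
      then have xb: "x0 = b" using x0 by simp
      have "integral {a..x} g + integral {x..b} g = integral {a..b} g"
        using x g by (intro Henstock_Kurzweil_Integration.integral_combine) auto
      then have "integral {a..x} g - integral {a..b} g = - integral {x..b} g"
        by (metis add_diff_cancel_left minus_diff_eq diff_add_cancel add_diff_cancel_left' )
      then have "norm (integral {a..x} g - integral {a..x0} g) = norm (integral {x..b} g)" by (simp add: xb)
      also have "\<dots> \<le> (D / 2) * (w x - 1)"
        using main[of x b] x wx0 False unfolding xb by (simp add: \<sigma>_def xb field_simps)
      also have "\<dots> \<le> D * w x / 2" using D by (simp add: algebra_simps)
      finally show ?thesis .
    qed
  qed
  then show ?thesis using wc w0 by blast
qed

text \<open>A finite system of unknown functions is treated as one bounded continuous function on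
  \<open>nat \<times> real\<close>, whose completeness needs a metric on the domain.\<close>

instantiation nat :: metric_space
begin

definition dist_nat :: "nat \<Rightarrow> nat \<Rightarrow> real" where "dist_nat m n = \<bar>real m - real n\<bar>"

definition uniformity_nat :: "(nat \<times> nat) filter" where
  "uniformity_nat = (INF e\<in>{0 <..}. principal {(x, y). dist x y < e})"

instance
proof
  show "open U \<longleftrightarrow> (\<forall>x\<in>U. \<forall>\<^sub>F (x', y) in uniformity. x' = x \<longrightarrow> y \<in> U)" for U :: "nat set"
  proof -
    have eq: "x = b" if "\<bar>real x - real b\<bar> < 1" for x b :: nat using that by linarith
    have "\<forall>\<^sub>F (x', y) in uniformity. x' = x \<longrightarrow> y \<in> U" if "x \<in> U" for x
      unfolding uniformity_nat_def
      by (rule eventually_INF1[of 1]) (use that in \<open>auto simp: eventually_principal dist_nat_def dest: eq\<close>)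
    then show ?thesis by (simp add: open_discrete)
  qed
qed (auto simp: dist_nat_def uniformity_nat_def)

end

text \<open>\<open>nat\<close> is discrete, so near a point the first coordinate is
  constant.\<close>

lemma continuous_on_nat_times:
  fixes f :: "nat \<Rightarrow> real \<Rightarrow> 'b::topological_space"
  assumes "\<And>j. continuous_on UNIV (f j)"
  shows "continuous_on UNIV (\<lambda>p. f (fst p) (snd p))"
  unfolding continuous_on_eq_continuous_at[OF open_UNIV]
proof
  fix p :: "nat \<times> real"
  have "open ({fst p} \<times> (UNIV :: real set))" by (intro open_Times open_discrete) auto
  then have "eventually (\<lambda>q. q \<in> {fst p} \<times> UNIV) (at p)"
    by (intro eventually_at_in_open'[of _ p]) (auto simp: mem_Times_iff)
  then have ev: "eventually (\<lambda>q. f (fst q) (snd q) = f (fst p) (snd q)) (at p)"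
    by eventually_elim auto
  have "continuous_on UNIV (\<lambda>q :: nat \<times> real. f (fst p) (snd q))"
    by (rule continuous_on_compose2[OF assms]) (auto intro: continuous_intros)
  then have "isCont (\<lambda>q :: nat \<times> real. f (fst p) (snd q)) p"
    by (simp add: continuous_on_eq_continuous_at del: split_paired_All)
  then show "isCont (\<lambda>p. f (fst p) (snd p)) p"
    unfolding isCont_def using tendsto_cong[OF ev] by simp
qed

definition lin_rhs ::
  "nat \<Rightarrow> (nat \<Rightarrow> nat \<Rightarrow> real \<Rightarrow> complex^'m::finite^'m) \<Rightarrow> (nat \<Rightarrow> real \<Rightarrow> complex^'m) \<Rightarrow> (nat \<Rightarrow> real \<Rightarrow> complex^'m) \<Rightarrow> nat \<Rightarrow> real \<Rightarrow> complex^'m"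
  where "lin_rhs n A F Y j t = (\<Sum>k=1..n. A j k t *v Y k t) + F j t"

lemma absolutely_integrable_continuous_matrix_mult:
  fixes A :: "real \<Rightarrow> complex^'m::finite^'m"
  assumes A: "A absolutely_integrable_on {a..b}" and Y: "continuous_on {a..b} Y"
  shows "(\<lambda>t. A t *v Y t) absolutely_integrable_on {a..b}"
proof (rule absolutely_integrable_bounded_measurable_product[where h = "\<lambda>v M. M *v v"])
  show "bilinear (\<lambda>(v :: complex^'m) (M :: complex^'m^'m). M *v v)"
    using bilinear_matrix_vector_mult unfolding bilinear_def by blast
  show "Y \<in> borel_measurable (lebesgue_on {a..b})"
    by (rule continuous_imp_measurable_on_sets_lebesgue[OF Y]) auto
  show "bounded (Y ` {a..b})"
    using Y by (intro compact_imp_bounded compact_continuous_image) auto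
qed (use A in auto)

lemma lin_rhs_absolutely_integrable:
  assumes "\<And>j k. j \<in> {1..n} \<Longrightarrow> k \<in> {1..n} \<Longrightarrow> A j k absolutely_integrable_on {a..b}"
    and "\<And>j. j \<in> {1..n} \<Longrightarrow> F j absolutely_integrable_on {a..b}"
    and "\<And>k. k \<in> {1..n} \<Longrightarrow> continuous_on {a..b} (Y k)" and "j \<in> {1..n}"
  shows "lin_rhs n A F Y j absolutely_integrable_on {a..b}"
  unfolding lin_rhs_def [abs_def]
  by (intro set_integral_add(1) absolutely_integrable_sum absolutely_integrable_continuous_matrix_mult)
    (use assms in auto)

text \<open>Banach's fixed point theorem for the integral equation. The unknown is
  \<open>U = Y / w\<close>, so that the sup distance of bounded continuous functions is the weighted
  distance in which the iteration contracts.\<close>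

lemma linear_ode_exists:
  fixes A :: "nat \<Rightarrow> nat \<Rightarrow> real \<Rightarrow> complex^'m::finite^'m"
  assumes A: "\<And>j k. j \<in> {1..n} \<Longrightarrow> k \<in> {1..n} \<Longrightarrow> A j k absolutely_integrable_on {a..b}"
    and F: "\<And>j. j \<in> {1..n} \<Longrightarrow> F j absolutely_integrable_on {a..b}"
    and ab: "a < b" and x0: "x0 = a \<or> x0 = b"
  shows "\<exists>Y. \<forall>j\<in>{1..n}. primitive_on a b (Y j) (lin_rhs n A F Y j) \<and> Y j x0 = c j"
proof -
  obtain C where C: "C > 0" "\<And>(M :: complex^'m^'m) (v :: complex^'m). norm (M *v v) \<le> C * norm M * norm v"
  proof -
    have "bounded_bilinear ((*v) :: complex^'m^'m \<Rightarrow> complex^'m \<Rightarrow> complex^'m)"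
      using bilinear_matrix_vector_mult by (simp only: bilinear_conv_bounded_bilinear)
    from bounded_bilinear.pos_bounded[OF this]
    obtain K where K: "K > 0" "\<And>(M :: complex^'m^'m) (v :: complex^'m). norm (M *v v) \<le> norm M * norm v * K"
      by blast
    show thesis
    proof (rule that[OF K(1)])
      show "norm (M *v v) \<le> K * norm M * norm v" for M :: "complex^'m^'m" and v :: "complex^'m"
        using K(2)[of M v] by (simp add: mult_ac)
    qed
  qed
  define k where "k t = (\<Sum>j=1..n. \<Sum>l=1..n. C * norm (A j l t))" for t
  have k0: "0 \<le> k t" for t unfolding k_def using C(1) by (intro sum_nonneg) auto
  have kint: "k absolutely_integrable_on {a..b}"
    unfolding k_def[abs_def]
    by (intro absolutely_integrable_sum set_integrable_mult_right absolutely_integrable_norm[unfolded o_def])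
      (use A in auto)
  from exponential_weight_exists[OF kint k0 ab x0, where 'v = "complex^'m"]
  obtain w where wc: "continuous_on {a..b} w" and w0': "\<forall>x. 0 < w x" and
    w': "\<forall>(g :: real \<Rightarrow> complex^'m) D x. x \<in> {a..b} \<longrightarrow> g integrable_on {a..b} \<longrightarrow> 0 \<le> D \<longrightarrow>
      (\<forall>t\<in>{a..b}. norm (g t) \<le> D * (k t * w t)) \<longrightarrow>
      norm (integral {a..x} g - integral {a..x0} g) \<le> D * w x / 2"
    by (elim exE conjE) (rule that)
  note w0 = w0'[rule_format] and w = w'[rule_format]
  \<comment> \<open>Bounded continuous functions live on the whole line; clamping transplants
    functions on \<open>[a, b]\<close> to it.\<close>
  define cl where "cl x = max a (min b x)" for x
  have cl: "cl x \<in> {a..b}" for x using ab by (auto simp: cl_def)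
  have cl': "cl x = x" if "x \<in> {a..b}" for x using that by (auto simp: cl_def)
  have clc: "continuous_on UNIV cl" unfolding cl_def by (intro continuous_intros)
  define YU where "YU U j t = w t *\<^sub>R apply_bcontfun U (j, t)" for U :: "(nat \<times> real) \<Rightarrow>\<^sub>C (complex^'m)" and j :: nat and t
  have YUc: "continuous_on {a..b} (YU U j)" for U j
  proof -
    have "continuous_on {a..b} (\<lambda>t. apply_bcontfun U (j, t))"
      by (rule continuous_on_compose2[OF continuous_on_apply_bcontfun[of UNIV]]) (auto intro: continuous_intros)
    then show ?thesis unfolding YU_def[abs_def] using wc by (intro continuous_intros)
  qed
  have R: "lin_rhs n A F (YU U) j absolutely_integrable_on {a..b}" if "j \<in> {1..n}" for U j
    using A F YUc that by (intro lin_rhs_absolutely_integrable) auto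
  \<comment> \<open>Subtracting the integral up to \<open>x0\<close> prescribes the value at either
    endpoint by one formula.\<close>
  define P where "P U j x = c j + (integral {a..x} (lin_rhs n A F (YU U) j) - integral {a..x0} (lin_rhs n A F (YU U) j))" for U j x
  have Pp: "primitive_on a b (P U j) (lin_rhs n A F (YU U) j)" if "j \<in> {1..n}" for U j
    by (rule primitive_onI[OF R[OF that]]) (simp add: P_def)
  have Pc: "continuous_on {a..b} (P U j)" if "j \<in> {1..n}" for U j
    using primitive_imp_abs_cont_on[OF Pp[OF that]] ab abs_cont_on_imp_continuous_on by auto
  \<comment> \<open>Components with index outside \<open>{1..n}\<close> are set to 0, which keeps
    \<open>T U\<close> bounded.\<close>
  define T where "T U p = (if fst p \<in> {1..n} then inverse (w (cl (snd p))) *\<^sub>R P U (fst p) (cl (snd p)) else 0)" for U and p :: "nat \<times> real"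
  have wi: "continuous_on {a..b} (\<lambda>x. inverse (w x))" using wc w0
    by (intro continuous_on_inverse) (auto simp: less_imp_neq[OF w0, symmetric])
  have Tb: "T U \<in> bcontfun" for U
  proof -
    have "continuous_on UNIV (\<lambda>x. T U (j, x))" for j
    proof (cases "j \<in> {1..n}")
      case True
      have "continuous_on {a..b} (\<lambda>x. inverse (w x) *\<^sub>R P U j x)" by (rule continuous_on_scaleR[OF wi Pc[OF True]])
      then have "continuous_on UNIV (\<lambda>x. inverse (w (cl x)) *\<^sub>R P U j (cl x))"
        by (rule continuous_on_compose2[OF _ clc]) (use cl in auto)
      then show ?thesis using True by (simp add: T_def)
    next
      case False
      show ?thesis unfolding T_def fst_conv if_not_P[OF False] by (rule continuous_on_const)
    qed
    from continuous_on_nat_times[of "\<lambda>j x. T U (j, x)", OF this]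
    have 1: "continuous_on UNIV (T U)" by simp
    have "range (T U) \<subseteq> insert 0 (\<Union>j\<in>{1..n}. (\<lambda>x. inverse (w x) *\<^sub>R P U j x) ` {a..b})"
      using cl by (auto simp: T_def)
    moreover have "bounded (insert 0 (\<Union>j\<in>{1..n}. (\<lambda>x. inverse (w x) *\<^sub>R P U j x) ` {a..b}))"
    proof -
      have "bounded ((\<lambda>x. inverse (w x) *\<^sub>R P U j x) ` {a..b})" if "j \<in> {1..n}" for j
        using continuous_on_scaleR[OF wi Pc[OF that]] by (intro compact_imp_bounded compact_continuous_image) auto
      then show ?thesis by (simp add: bounded_UN)
    qed
    ultimately have "bounded (range (T U))" by (rule bounded_subset[rotated])
    with 1 show ?thesis by (simp add: bcontfun_def)
  qed
  have contr: "dist (Bcontfun (T U)) (Bcontfun (T V)) \<le> 1/2 * dist U V" for U V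
  proof (rule dist_bound)
    fix p :: "nat \<times> real"
    obtain j x where p: "p = (j, x)" by (cases p)
    show "dist (apply_bcontfun (Bcontfun (T U)) p) (apply_bcontfun (Bcontfun (T V)) p) \<le> 1/2 * dist U V"
    proof (cases "j \<in> {1..n}")
      case True
      define g where "g t = lin_rhs n A F (YU U) j t - lin_rhs n A F (YU V) j t" for t
      have Ri: "lin_rhs n A F (YU U) j integrable_on {a..b}" for U
        using R[OF True] absolutely_integrable_on_def by blast
      have Ri': "lin_rhs n A F (YU U) j integrable_on {a..x}" if "x \<in> {a..b}" for U x
        using that by (intro integrable_on_subinterval[OF Ri]) auto
      have gint: "g integrable_on {a..b}" unfolding g_def[abs_def]
        by (rule Henstock_Kurzweil_Integration.integrable_diff[OF Ri Ri])
      have gb: "norm (g t) \<le> dist U V * (k t * w t)" if t: "t \<in> {a..b}" for t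
      proof -
        have "g t = (\<Sum>l=1..n. A j l t *v (YU U l t - YU V l t))"
          by (simp add: g_def lin_rhs_def matrix_vector_mult_diff_distrib sum_subtractf)
        then have "norm (g t) \<le> (\<Sum>l=1..n. norm (A j l t *v (YU U l t - YU V l t)))"
          by (simp add: norm_sum)
        also have "\<dots> \<le> (\<Sum>l=1..n. C * norm (A j l t) * (w t * dist U V))"
        proof (rule sum_mono)
          fix l
          have "norm (YU U l t - YU V l t) = w t * dist (apply_bcontfun U (l, t)) (apply_bcontfun V (l, t))"
            using w0[of t] by (simp add: YU_def dist_norm scaleR_diff_right[symmetric])
          also have "\<dots> \<le> w t * dist U V" using w0[of t] dist_bounded by (intro mult_left_mono) auto
          finally have "C * norm (A j l t) * norm (YU U l t - YU V l t) \<le> C * norm (A j l t) * (w t * dist U V)"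
            using C(1) by (intro mult_left_mono) auto
          then show "norm (A j l t *v (YU U l t - YU V l t)) \<le> C * norm (A j l t) * (w t * dist U V)"
            using C(2)[of "A j l t"] order_trans by blast
        qed
        also have "\<dots> = (\<Sum>l=1..n. C * norm (A j l t)) * (w t * dist U V)" by (simp add: sum_distrib_right)
        \<comment> \<open>\<open>k\<close> sums over all rows, so one weight serves every
          component.\<close>
        also have "\<dots> \<le> k t * (w t * dist U V)"
        proof (rule mult_right_mono)
          show "(\<Sum>l=1..n. C * norm (A j l t)) \<le> k t"
            unfolding k_def using True C(1)
            by (intro member_le_sum[of j "{1..n}" "\<lambda>j. \<Sum>l=1..n. C * norm (A j l t)"]) (auto intro!: sum_nonneg)
        qed (use w0[of t] in auto)
        finally show ?thesis by (simp add: mult_ac)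
      qed
      define y where "y = cl x"
      have y: "y \<in> {a..b}" using cl by (simp add: y_def)
      have x0': "x0 \<in> {a..b}" using x0 ab by auto
      have "P U j y - P V j y = integral {a..y} g - integral {a..x0} g"
        unfolding P_def g_def[abs_def] using Ri'[OF y] Ri'[OF x0']
        by (simp add: Henstock_Kurzweil_Integration.integral_diff)
      then have "norm (P U j y - P V j y) \<le> dist U V * w y / 2"
        using w[OF y gint zero_le_dist[of U V]] gb by (metis (lifting))
      moreover have "dist (T U p) (T V p) = inverse (w y) * norm (P U j y - P V j y)"
        using True w0[of y] by (simp add: T_def p y_def dist_norm scaleR_diff_right[symmetric])
      ultimately have "dist (T U p) (T V p) \<le> inverse (w y) * (dist U V * w y / 2)"
        using w0[of y] by (simp add: mult_left_mono)
      also have "\<dots> = 1/2 * dist U V" using w0[of y] by (simp add: field_simps)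
      finally show ?thesis by (simp add: Bcontfun_inverse[OF Tb])
    next
      case False
      have "T U p = 0" for U unfolding T_def p fst_conv if_not_P[OF False] ..
      then show ?thesis by (simp add: Bcontfun_inverse[OF Tb])
    qed
  qed
  have "\<exists>!U. Bcontfun (T U) = U"
    by (rule banach_fix_type[of "1/2" "\<lambda>U. Bcontfun (T U)"]) (use contr in auto)
  then obtain U where U: "Bcontfun (T U) = U" by blast
  have YP: "YU U j x = P U j x" if "j \<in> {1..n}" "x \<in> {a..b}" for j x
  proof -
    have "apply_bcontfun U (j, x) = T U (j, x)" using Bcontfun_inverse[OF Tb[of U]] U by simp
    then show ?thesis using that w0[of x] by (simp add: YU_def T_def cl')
  qed
  have "primitive_on a b (YU U j) (lin_rhs n A F (YU U) j) \<and> YU U j x0 = c j" if j: "j \<in> {1..n}" for j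
  proof
    show "primitive_on a b (YU U j) (lin_rhs n A F (YU U) j)"
    proof (rule primitive_onI[OF R[OF j]])
      fix x assume x: "x \<in> {a..b}"
      have a: "a \<in> {a..b}" using ab by simp
      show "YU U j x = YU U j a + integral {a..x} (lin_rhs n A F (YU U) j)"
        unfolding YP[OF j x] YP[OF j a] by (rule primitive_onD(2)[OF Pp[OF j] x])
    qed
    have "x0 \<in> {a..b}" using x0 ab by auto
    then show "YU U j x0 = c j" using YP[OF j] by (simp add: P_def)
  qed
  then show ?thesis by blast
qed

section \<open>Positive forms and Hilbert spaces\<close>

text \<open>A semidefinite Hermitian form on a set of vectors. Three instances occur: the form of a
  positive definite matrix, the weighted inner product, and the form of an operator on its
  graph.\<close>

locale pos_form =
  fixes sc :: "complex \<Rightarrow> 'v::ab_group_add \<Rightarrow> 'v" and D :: "'v set" and q :: "'v \<Rightarrow> 'v \<Rightarrow> complex"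
  assumes D_zero: "0 \<in> D"
    and D_add: "u \<in> D \<Longrightarrow> v \<in> D \<Longrightarrow> u + v \<in> D"
    and D_sc: "u \<in> D \<Longrightarrow> sc c u \<in> D"
    and q_add_left: "u \<in> D \<Longrightarrow> v \<in> D \<Longrightarrow> w \<in> D \<Longrightarrow> q (u + v) w = q u w + q v w"
    and q_sc_left: "u \<in> D \<Longrightarrow> w \<in> D \<Longrightarrow> q (sc c u) w = c * q u w"
    and q_cnj: "u \<in> D \<Longrightarrow> v \<in> D \<Longrightarrow> q v u = cnj (q u v)"
    and q_nonneg: "u \<in> D \<Longrightarrow> 0 \<le> Re (q u u)"
begin

lemma q_add_right:
  assumes "u \<in> D" "v \<in> D" "w \<in> D"
  shows "q w (u + v) = q w u + q w v"
proof -
  have "q w (u + v) = cnj (q (u + v) w)" by (rule q_cnj[OF D_add[OF assms(1,2)] assms(3)])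
  also have "\<dots> = cnj (q u w) + cnj (q v w)" by (simp only: q_add_left[OF assms] complex_cnj_add)
  also have "\<dots> = q w u + q w v" by (simp only: q_cnj[OF assms(1,3)] q_cnj[OF assms(2,3)])
  finally show ?thesis .
qed

lemma q_sc_right:
  assumes "u \<in> D" "w \<in> D"
  shows "q w (sc c u) = cnj c * q w u"
proof -
  have "q w (sc c u) = cnj (q (sc c u) w)" by (rule q_cnj[OF D_sc[OF assms(1)] assms(2)])
  also have "\<dots> = cnj c * cnj (q u w)" by (simp only: q_sc_left[OF assms] complex_cnj_mult)
  also have "\<dots> = cnj c * q w u" by (simp only: q_cnj[OF assms])
  finally show ?thesis .
qed

lemma q_self: "u \<in> D \<Longrightarrow> q u u = of_real (Re (q u u))"
  by (metis q_cnj complex_is_Real_iff Reals_cnj_iff of_real_Re)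

lemma q_perturb:
  assumes "u \<in> D" "v \<in> D"
  shows "Re (q (u + sc c v) (u + sc c v)) = Re (q u u) + 2 * Re (cnj c * q u v) + (cmod c)\<^sup>2 * Re (q v v)"
proof -
  have "q (u + sc c v) (u + sc c v) = q u u + cnj c * q u v + (c * q v u + c * (cnj c * q v v))"
    using assms by (simp add: q_add_left q_add_right q_sc_left q_sc_right D_sc D_add distrib_left)
  then have 1: "Re (q (u + sc c v) (u + sc c v)) = Re (q u u) + Re (cnj c * q u v) + (Re (c * q v u) + Re (c * (cnj c * q v v)))"
    by (simp only: plus_complex.sel)
  have "c * (cnj c * q v v) = of_real ((cmod c)\<^sup>2) * q v v" by (simp only: complex_norm_square mult.assoc)
  also have "\<dots> = of_real ((cmod c)\<^sup>2) * of_real (Re (q v v))"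
    by (rule arg_cong[where f = "\<lambda>z. of_real ((cmod c)\<^sup>2) * z", OF q_self[OF assms(2)]])
  also have "\<dots> = of_real ((cmod c)\<^sup>2 * Re (q v v))" by (simp only: of_real_mult)
  finally have 2: "Re (c * (cnj c * q v v)) = (cmod c)\<^sup>2 * Re (q v v)" by (simp only: Re_complex_of_real)
  have "c * q v u = cnj (cnj c * q u v)" unfolding q_cnj[OF assms] by simp
  then have 3: "Re (c * q v u) = Re (cnj c * q u v)" by (simp only: cnj.sel)
  show ?thesis unfolding 1 2 3 by simp
qed

text \<open>Along the multiples \<open>c = - t * q u v\<close> with real \<open>t\<close> the cross
  term is real, and nonnegativity becomes a quadratic inequality in \<open>t\<close>.\<close>

lemma q_Cauchy_Schwarz:
  assumes "u \<in> D" "v \<in> D"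
  shows "(cmod (q u v))\<^sup>2 \<le> Re (q u u) * Re (q v v)"
proof -
  have ineq: "0 \<le> Re (q u u) - 2 * t * (cmod (q u v))\<^sup>2 + t\<^sup>2 * (cmod (q u v))\<^sup>2 * Re (q v v)" for t :: real
  proof -
    have "0 \<le> Re (q (u + sc (- of_real t * q u v) v) (u + sc (- of_real t * q u v) v))"
      using assms by (intro q_nonneg D_add D_sc)
    also have "\<dots> = Re (q u u) + 2 * Re (cnj (- of_real t * q u v) * q u v) + (cmod (- of_real t * q u v))\<^sup>2 * Re (q v v)"
      by (rule q_perturb[OF assms])
    also have "cnj (- of_real t * q u v) * q u v = of_real (- t * (cmod (q u v))\<^sup>2)"
      unfolding of_real_mult complex_norm_square by (simp add: mult_ac)
    finally show ?thesis by (simp add: norm_mult power_mult_distrib)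
  qed
  show ?thesis
  proof (cases "Re (q v v) = 0")
    case True
    have "(cmod (q u v))\<^sup>2 = 0"
    proof (rule ccontr)
      assume "(cmod (q u v))\<^sup>2 \<noteq> 0"
      then have pos: "(cmod (q u v))\<^sup>2 > 0" by (simp add: less_le)
      \<comment> \<open>When \<open>q v v\<close> vanishes the inequality is affine in
        \<open>t\<close>, and this \<open>t\<close> makes its right side equal to -1.\<close>
      have "2 * ((Re (q u u) + 1) / (2 * (cmod (q u v))\<^sup>2)) * (cmod (q u v))\<^sup>2 = Re (q u u) + 1"
        using pos by (simp add: field_simps)
      then show False using ineq[of "(Re (q u u) + 1) / (2 * (cmod (q u v))\<^sup>2)"] True by simp
    qed
    then show ?thesis using True by simp
  next
    case False
    then have d: "Re (q v v) > 0" using q_nonneg[OF assms(2)] by simp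
    \<comment> \<open>\<open>1 / Re (q v v)\<close> is the minimizer of the quadratic in
      \<open>t\<close>.\<close>
    have "0 \<le> (Re (q u u) - 2 * (1 / Re (q v v)) * (cmod (q u v))\<^sup>2 + (1 / Re (q v v))\<^sup>2 * (cmod (q u v))\<^sup>2 * Re (q v v)) * Re (q v v)"
      using ineq[of "1 / Re (q v v)"] d by (intro mult_nonneg_nonneg) auto
    also have "\<dots> = Re (q u u) * Re (q v v) - (cmod (q u v))\<^sup>2"
      using d by (simp add: field_simps power2_eq_square)
    finally show ?thesis by simp
  qed
qed

end

section \<open>Semi-inner products and their null vectors\<close>

locale pre_hilbert = vector_space sc + pos_form sc H ip
  for sc :: "complex \<Rightarrow> 'v::ab_group_add \<Rightarrow> 'v" and H :: "'v set" and ip :: "'v \<Rightarrow> 'v \<Rightarrow> complex"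
begin

definition nm :: "'v \<Rightarrow> real" where "nm u = sqrt (Re (ip u u))"

lemma H_uminus: "u \<in> H \<Longrightarrow> - u \<in> H"
  using D_sc[of u "-1"] by (simp add: scale_minus_left)

lemma H_diff: "u \<in> H \<Longrightarrow> v \<in> H \<Longrightarrow> u - v \<in> H"
  using D_add[of u "- v"] H_uminus[of v] by simp

lemmas H_closed = D_zero D_add D_sc H_uminus H_diff

lemma ip_uminus_left: "u \<in> H \<Longrightarrow> w \<in> H \<Longrightarrow> ip (- u) w = - ip u w"
  using q_sc_left[of u w "-1"] by (simp add: scale_minus_left)

lemma ip_uminus_right: "u \<in> H \<Longrightarrow> w \<in> H \<Longrightarrow> ip w (- u) = - ip w u"
  using q_sc_right[of u w "-1"] by (simp add: scale_minus_left)

lemma ip_diff_left: "u \<in> H \<Longrightarrow> v \<in> H \<Longrightarrow> w \<in> H \<Longrightarrow> ip (u - v) w = ip u w - ip v w"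
  using q_add_left[of u "- v" w] ip_uminus_left[of v w] H_uminus[of v] by simp

lemma ip_diff_right: "u \<in> H \<Longrightarrow> v \<in> H \<Longrightarrow> w \<in> H \<Longrightarrow> ip w (u - v) = ip w u - ip w v"
  using q_add_right[of u "- v" w] ip_uminus_right[of v w] H_uminus[of v] by simp

lemmas ip_simps = q_add_left q_add_right q_sc_left q_sc_right ip_uminus_left ip_uminus_right ip_diff_left ip_diff_right

lemma nm_nonneg: "u \<in> H \<Longrightarrow> 0 \<le> nm u"
  by (simp add: nm_def q_nonneg)

lemma nm_sq: "u \<in> H \<Longrightarrow> (nm u)\<^sup>2 = Re (ip u u)"
  by (simp add: nm_def q_nonneg)

lemma nm_zero: "nm 0 = 0"
  using q_sc_left[of 0 0 0] D_zero by (simp add: nm_def)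

lemma nm_sc: "u \<in> H \<Longrightarrow> nm (sc c u) = cmod c * nm u"
proof -
  assume u: "u \<in> H"
  have "ip (sc c u) (sc c u) = (c * cnj c) * ip u u" using u by (simp add: ip_simps D_sc)
  then have "ip (sc c u) (sc c u) = of_real ((cmod c)\<^sup>2) * ip u u" by (simp only: complex_norm_square)
  then have "Re (ip (sc c u) (sc c u)) = (cmod c)\<^sup>2 * Re (ip u u)" by simp
  then show ?thesis by (simp add: nm_def real_sqrt_mult)
qed

lemma nm_uminus: "u \<in> H \<Longrightarrow> nm (- u) = nm u"
  by (simp add: nm_def ip_simps H_uminus)

lemma nm_minus_commute: "u \<in> H \<Longrightarrow> v \<in> H \<Longrightarrow> nm (u - v) = nm (v - u)"
  using nm_uminus[of "u - v"] H_diff by simp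

lemma Cauchy_Schwarz: "u \<in> H \<Longrightarrow> v \<in> H \<Longrightarrow> cmod (ip u v) \<le> nm u * nm v"
  using q_Cauchy_Schwarz[of u v] by (simp add: nm_def real_sqrt_mult[symmetric] real_le_rsqrt)

lemma nm_triangle:
  assumes "u \<in> H" "v \<in> H" shows "nm (u + v) \<le> nm u + nm v"
proof -
  have "(nm (u + v))\<^sup>2 = (nm u)\<^sup>2 + 2 * Re (ip u v) + (nm v)\<^sup>2"
    using q_perturb[OF assms, of 1] assms by (simp add: nm_sq D_add scale_one)
  also have "\<dots> \<le> (nm u)\<^sup>2 + 2 * (nm u * nm v) + (nm v)\<^sup>2"
    using Cauchy_Schwarz[OF assms] complex_Re_le_cmod[of "ip u v"] by simp
  also have "\<dots> = (nm u + nm v)\<^sup>2" by (simp add: power2_sum)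
  finally have "(nm (u + v))\<^sup>2 \<le> (nm u + nm v)\<^sup>2" .
  then show ?thesis by (rule power2_le_imp_le) (simp add: assms nm_nonneg)
qed

lemma nm_triangle_diff:
  assumes "u \<in> H" "v \<in> H" "w \<in> H" shows "nm (u - w) \<le> nm (u - v) + nm (v - w)"
  using nm_triangle[of "u - v" "v - w"] assms by (simp add: H_diff)

text \<open>Equality modulo null vectors replaces the passage to a quotient; in the weighted space
  it is a.e. equality.\<close>

definition eqv :: "'v \<Rightarrow> 'v \<Rightarrow> bool" where "eqv u v \<longleftrightarrow> nm (u - v) = 0"

lemma eqv_sym: "u \<in> H \<Longrightarrow> v \<in> H \<Longrightarrow> eqv u v \<Longrightarrow> eqv v u"
  by (simp add: eqv_def nm_minus_commute)

lemma eqv_trans: "u \<in> H \<Longrightarrow> v \<in> H \<Longrightarrow> w \<in> H \<Longrightarrow> eqv u v \<Longrightarrow> eqv v w \<Longrightarrow> eqv u w"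
  unfolding eqv_def using nm_triangle_diff[of u v w] nm_nonneg[OF H_diff[of u w]] by simp

lemma ip_eqv_right:
  assumes "u \<in> H" "v \<in> H" "w \<in> H" "eqv u v" shows "ip w u = ip w v"
  using Cauchy_Schwarz[of w "u - v"] assms by (simp add: eqv_def ip_simps H_diff)

lemma ip_eqv_left:
  assumes "u \<in> H" "v \<in> H" "w \<in> H" "eqv u v" shows "ip u w = ip v w"
  using Cauchy_Schwarz[of "u - v" w] assms by (simp add: eqv_def ip_simps H_diff)

lemma tendsto_ip_right:
  assumes X: "\<And>n. X n \<in> H" and l: "l \<in> H" and w: "w \<in> H" and lim: "(\<lambda>n. nm (X n - l)) \<longlonglongrightarrow> 0"
  shows "(\<lambda>n. ip w (X n)) \<longlonglongrightarrow> ip w l"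
proof -
  have "(\<lambda>n. ip w (X n) - ip w l) \<longlonglongrightarrow> 0"
  proof (rule Lim_null_comparison)
    show "\<forall>\<^sub>F n in sequentially. norm (ip w (X n) - ip w l) \<le> nm w * nm (X n - l)"
      using Cauchy_Schwarz[OF w H_diff[OF X l]] X l w by (intro always_eventually) (simp add: ip_simps)
    show "(\<lambda>n. nm w * nm (X n - l)) \<longlonglongrightarrow> 0" using tendsto_mult[OF tendsto_const[of "nm w"] lim] by simp
  qed
  then show ?thesis by (simp add: LIM_zero_iff)
qed

lemma ip_zero_right: "u \<in> H \<Longrightarrow> ip u 0 = 0"
  using ip_diff_right[of u u u] by simp

lemma ip_zero_left: "u \<in> H \<Longrightarrow> ip 0 u = 0"
  using ip_diff_left[of u u u] by simp

text \<open>Gram-Schmidt by induction on \<open>B\<close>: the new vector \<open>x\<close> is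
  replaced by its component \<open>e\<close> orthogonal to the old span.\<close>

lemma finite_span_projection:
  assumes "finite B" "B \<subseteq> H"
  shows "\<forall>u\<in>H. \<exists>n\<in>local.span B. \<forall>m\<in>local.span B. ip (u - n) m = 0"
  using assms
proof (induction B)
  case empty
  show ?case using ip_zero_right by (simp add: span_empty)
next
  case (insert x B)
  have H_sub: "local.subspace H" by (simp add: subspace_def H_closed)
  have sH: "local.span B \<subseteq> H" using insert.prems H_sub by (intro span_minimal) auto
  obtain p where p: "p \<in> local.span B" "\<And>m. m \<in> local.span B \<Longrightarrow> ip (x - p) m = 0"
    using insert by blast
  define e where "e = x - p"
  have xH: "x \<in> H" and pH: "p \<in> H" using insert.prems p(1) sH by auto
  have eH: "e \<in> H" by (simp add: e_def H_diff xH pH)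
  have mono: "local.span B \<subseteq> local.span (insert x B)" by (rule span_mono) auto
  have e_span: "e \<in> local.span (insert x B)"
  proof -
    have "x \<in> local.span (insert x B)" by (rule span_base) simp
    moreover have "p \<in> local.span (insert x B)" using p(1) mono by blast
    ultimately show ?thesis unfolding e_def by (rule span_diff)
  qed
  show ?case
  proof
    fix u assume u: "u \<in> H"
    obtain n where n: "n \<in> local.span B" "\<And>m. m \<in> local.span B \<Longrightarrow> ip (u - n) m = 0"
      using insert u by blast
    have nH: "n \<in> H" using n(1) sH by auto
    \<comment> \<open>If \<open>ip e e = 0\<close>, division by zero makes this 0; Cauchy-Schwarz
      then makes \<open>ip (u - n) e\<close> vanish as well, so the equation for \<open>k\<close>
      survives.\<close>
    define k where "k = ip (u - n) e / ip e e"
    have k: "ip (u - n) e - k * ip e e = 0"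
    proof (cases "ip e e = 0")
      case True
      then have "nm e = 0" by (simp add: nm_def)
      then have "ip (u - n) e = 0" using Cauchy_Schwarz[OF H_diff[OF u nH] eH] by simp
      then show ?thesis using True by simp
    qed (simp add: k_def)
    show "\<exists>n\<in>local.span (insert x B). \<forall>m\<in>local.span (insert x B). ip (u - n) m = 0"
    proof (intro bexI ballI)
      show "n + sc k e \<in> local.span (insert x B)"
        using n(1) mono e_span by (intro span_add span_scale) auto
      fix y assume "y \<in> local.span (insert x B)"
      then obtain l where l: "y - sc l x \<in> local.span B" using span_insert[of x B] by blast
      define z where "z = (y - sc l x) + sc l p"
      have z: "z \<in> local.span B" unfolding z_def by (intro span_add span_scale l p(1))
      then have zH: "z \<in> H" using sH by auto
      have y: "y = z + sc l e" by (simp add: z_def e_def scale_right_diff_distrib)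
      have "ip ((u - n) - sc k e) (z + sc l e) = (ip (u - n) z - k * ip e z) + cnj l * (ip (u - n) e - k * ip e e)"
      proof -
        define r where "r = u - n"
        have "r \<in> H" unfolding r_def by (rule H_diff[OF u nH])
        then show ?thesis unfolding r_def[symmetric] using eH zH
          by (simp add: ip_diff_left q_add_right q_sc_left q_sc_right H_closed distrib_left right_diff_distrib mult_ac)
      qed
      moreover have "ip e z = 0" using p(2)[OF z] by (simp add: e_def)
      ultimately show "ip (u - (n + sc k e)) y = 0"
        unfolding y diff_diff_eq[symmetric] using n(2)[OF z] k by simp
    qed
  qed
qed

end

text \<open>Completeness is stated for geometrically fast sequences: minimizing sequences and
  approximate preimages can be chosen so, and such increments lead directly to a.e. convergence in
  the weighted space.\<close>

locale semi_hilbert = pre_hilbert sc H ip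
  for sc :: "complex \<Rightarrow> 'v::ab_group_add \<Rightarrow> 'v" and H :: "'v set" and ip :: "'v \<Rightarrow> 'v \<Rightarrow> complex" +
  assumes fast_Cauchy_convergent:
    "(\<And>n. X n \<in> H) \<Longrightarrow> (\<And>n. nm (X (Suc n) - X n) \<le> (1/2) ^ n) \<Longrightarrow>
      \<exists>l\<in>H. (\<lambda>n. nm (X n - l)) \<longlonglongrightarrow> 0"
begin

text \<open>First-order condition at a minimum: moving along \<open>m\<close> by
  \<open>- t * b\<close> lowers the squared norm by a term linear in \<open>t\<close>, against a
  gain quadratic in \<open>t\<close>.\<close>

lemma perp_if_minimal:
  assumes "r \<in> H" "m \<in> H" and min: "\<And>c. (nm r)\<^sup>2 \<le> (nm (r + sc c m))\<^sup>2"
  shows "ip m r = 0"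
proof (rule ccontr)
  assume "ip m r \<noteq> 0"
  define b where "b = ip r m"
  have "b \<noteq> 0" using \<open>ip m r \<noteq> 0\<close> q_cnj[of m r] assms by (simp add: b_def)
  have *: "2 * (cmod b)\<^sup>2 \<le> t * (cmod b)\<^sup>2 * (nm m)\<^sup>2" if t: "t > 0" for t
  proof -
    have "(nm r)\<^sup>2 \<le> (nm (r + sc (- of_real t * b) m))\<^sup>2" by (rule min)
    also have "\<dots> = (nm r)\<^sup>2 + 2 * Re (cnj (- of_real t * b) * b) + (cmod (- of_real t * b))\<^sup>2 * (nm m)\<^sup>2"
      unfolding nm_sq[OF D_add[OF assms(1) D_sc[OF assms(2)]]] nm_sq[OF assms(1)] nm_sq[OF assms(2)] b_def
      by (rule q_perturb[OF assms(1,2)])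
    also have "cnj (- of_real t * b) * b = of_real (- t * (cmod b)\<^sup>2)"
      unfolding of_real_mult complex_norm_square by (simp add: mult_ac)
    finally have "t * (2 * (cmod b)\<^sup>2) \<le> t * (t * (cmod b)\<^sup>2 * (nm m)\<^sup>2)"
      by (simp add: norm_mult power_mult_distrib power2_eq_square mult_ac)
    then show ?thesis using t by simp
  qed
  have b2: "(cmod b)\<^sup>2 > 0" using \<open>b \<noteq> 0\<close> by simp
  have "2 \<le> t * (nm m)\<^sup>2" if "t > 0" for t
  proof -
    have "(cmod b)\<^sup>2 * 2 \<le> (cmod b)\<^sup>2 * (t * (nm m)\<^sup>2)" using *[OF that] by (simp add: mult_ac)
    then show ?thesis using b2 by (simp only: mult_le_cancel_left_pos)
  qed
  \<comment> \<open>At this \<open>t\<close> the product \<open>t * (nm m)\<^sup>2\<close> is less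
    than 1.\<close>
  from this[of "1 / ((nm m)\<^sup>2 + 1)"] have "2 \<le> (nm m)\<^sup>2 / ((nm m)\<^sup>2 + 1)" by (simp add: add_nonneg_pos)
  moreover have "(nm m)\<^sup>2 / ((nm m)\<^sup>2 + 1) \<le> 1" by (simp add: divide_le_eq add_nonneg_pos)
  ultimately show False by simp
qed

text \<open>The projection argument without a closed subspace: a minimizing sequence in
  \<open>M\<close> converges to some \<open>l\<close>, perhaps outside \<open>M\<close>;
  \<open>u - l\<close> is orthogonal to \<open>M\<close>, hence null by \<open>perp\<close>.\<close>

lemma dense_if_perp_trivial:
  assumes M: "M \<subseteq> H" "0 \<in> M" "\<And>u v. u \<in> M \<Longrightarrow> v \<in> M \<Longrightarrow> u + v \<in> M" "\<And>c u. u \<in> M \<Longrightarrow> sc c u \<in> M"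
    and perp: "\<And>h. h \<in> H \<Longrightarrow> (\<And>m. m \<in> M \<Longrightarrow> ip m h = 0) \<Longrightarrow> nm h = 0"
    and u: "u \<in> H" and \<epsilon>: "\<epsilon> > 0"
  shows "\<exists>m\<in>M. nm (u - m) < \<epsilon>"
proof -
  define d where "d = Inf ((\<lambda>m. (nm (u - m))\<^sup>2) ` M)"
  have bdd: "bdd_below ((\<lambda>m. (nm (u - m))\<^sup>2) ` M)" by (rule bdd_belowI[of _ 0]) auto
  have d_le: "d \<le> (nm (u - m))\<^sup>2" if "m \<in> M" for m
    unfolding d_def using bdd that by (intro cINF_lower) auto
  have d0: "0 \<le> d" unfolding d_def using M(2) by (intro cINF_greatest) auto
  \<comment> \<open>With these errors the parallelogram identity bounds successive differences by
    \<open>(1/2) ^ n\<close>.\<close>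
  have "\<exists>m\<in>M. (nm (u - m))\<^sup>2 < d + (1/4) ^ n / 4" for n :: nat
    using cInf_lessD[of "(\<lambda>m. (nm (u - m))\<^sup>2) ` M" "d + (1/4) ^ n / 4"] M(2) unfolding d_def by auto
  then obtain X where X: "\<And>n. X n \<in> M" "\<And>n. (nm (u - X n))\<^sup>2 < d + (1/4) ^ n / 4" by metis
  have XH: "X n \<in> H" for n using X(1) M(1) by blast
  have par: "(nm (X n - X k))\<^sup>2 \<le> 2 * (nm (u - X n))\<^sup>2 + 2 * (nm (u - X k))\<^sup>2 - 4 * d" for n k
  proof -
    define p where "p = u - X n" define r where "r = u - X k"
    have pr: "p \<in> H" "r \<in> H" using u XH by (auto simp: p_def r_def H_diff)
    have s: "(nm (p + r))\<^sup>2 + (nm (p - r))\<^sup>2 = 2 * (nm p)\<^sup>2 + 2 * (nm r)\<^sup>2"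
      using pr by (simp add: nm_sq ip_simps H_diff D_add)
    \<comment> \<open>The midpoint of \<open>X n\<close> and \<open>X k\<close> lies in
      \<open>M\<close>, so its squared distance from \<open>u\<close> is at least the infimum
      \<open>d\<close>.\<close>
    define h where "h = u - sc (1/2) (X n + X k)"
    have "sc 2 h = sc 2 u - (X n + X k)" by (simp add: h_def scale_right_diff_distrib scale_scale)
    also have "sc 2 u = u + u" using scale_left_distrib[of 1 1 u] by (simp add: scale_one)
    finally have "p + r = sc 2 h" by (simp add: p_def r_def algebra_simps)
    moreover have hH: "h \<in> H" using u XH by (simp add: h_def H_diff D_sc D_add)
    ultimately have "nm (p + r) = 2 * nm h" by (simp add: nm_sc)
    moreover have "d \<le> (nm h)\<^sup>2" unfolding h_def using X(1) M by (intro d_le) auto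
    moreover have "p - r = - (X n - X k)" by (simp add: p_def r_def)
    then have "nm (p - r) = nm (X n - X k)" using XH by (simp only: nm_uminus H_diff)
    ultimately show ?thesis using s by (simp add: p_def r_def power_mult_distrib)
  qed
  have "nm (X (Suc n) - X n) \<le> (1/2) ^ n" for n
  proof (rule power2_le_imp_le)
    define e where "e = (1/4 :: real) ^ n"
    have "e \<ge> 0" by (simp add: e_def)
    moreover have "(nm (u - X n))\<^sup>2 < d + e / 4" "(nm (u - X (Suc n)))\<^sup>2 < d + e / 16"
      using X(2)[of n] X(2)[of "Suc n"] by (auto simp: e_def)
    ultimately have "(nm (X (Suc n) - X n))\<^sup>2 \<le> (1/4) ^ n"
      using par[of "Suc n" n] unfolding e_def[symmetric] by argo
    also have "\<dots> = ((1/2) ^ n)\<^sup>2" by (simp add: power2_eq_square power_mult_distrib[symmetric])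
    finally show "(nm (X (Suc n) - X n))\<^sup>2 \<le> ((1/2) ^ n)\<^sup>2" .
  qed simp
  from fast_Cauchy_convergent[OF XH this]
  obtain l where l: "l \<in> H" "(\<lambda>n. nm (X n - l)) \<longlonglongrightarrow> 0" by blast
  have "(\<lambda>n. d + (1/4) ^ n / 4) \<longlonglongrightarrow> d + 0 / 4"
    by (intro tendsto_intros LIMSEQ_realpow_zero) auto
  then have dl: "(\<lambda>n. sqrt (d + (1/4) ^ n / 4)) \<longlonglongrightarrow> sqrt d" using tendsto_real_sqrt by fastforce
  have "nm (u - X n) \<le> sqrt (d + (1/4) ^ n / 4)" for n
    using X(2)[of n] by (intro real_le_rsqrt) simp
  then have "nm (u - l) \<le> sqrt (d + (1/4) ^ n / 4) + nm (X n - l)" for n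
    using nm_triangle_diff[OF u XH[of n] l(1)] add_right_mono order_trans by blast
  moreover have "(\<lambda>n. sqrt (d + (1/4) ^ n / 4) + nm (X n - l)) \<longlonglongrightarrow> sqrt d + 0"
    by (intro tendsto_add dl l(2))
  ultimately have ul: "nm (u - l) \<le> sqrt d" using LIMSEQ_le_const by fastforce
  \<comment> \<open>\<open>X n + sc (- c) m\<close> belongs to \<open>M\<close>, so its distance
    from \<open>u\<close> is at least \<open>sqrt d\<close>; then let \<open>n\<close> tend to
    infinity.\<close>
  have lower: "sqrt d \<le> nm (u - l + sc c m)" if m: "m \<in> M" for c m
  proof -
    have mH: "m \<in> H" using m M by blast
    have "sqrt d \<le> nm (u - l + sc c m) + nm (X n - l)" for n
    proof -
      have "X n + sc (- c) m \<in> M" using X(1) m M by blast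
      then have "d \<le> (nm (u - (X n + sc (- c) m)))\<^sup>2" by (rule d_le)
      then have "sqrt d \<le> nm (u - (X n + sc (- c) m))"
        using real_sqrt_le_mono[of d "(nm (u - (X n + sc (- c) m)))\<^sup>2"] u XH mH by (simp add: nm_nonneg H_closed)
      also have "u - (X n + sc (- c) m) = (u - l + sc c m) - (X n - l)" by (simp add: scale_minus_left algebra_simps)
      also have "nm \<dots> \<le> nm (u - l + sc c m) + nm (X n - l)"
        using nm_triangle[of "u - l + sc c m" "- (X n - l)"] nm_uminus[of "X n - l"] u XH[of n] mH l(1)
        by (simp add: H_closed)
      finally show ?thesis .
    qed
    moreover have "(\<lambda>n. nm (u - l + sc c m) + nm (X n - l)) \<longlonglongrightarrow> nm (u - l + sc c m) + 0"
      by (intro tendsto_add tendsto_const l(2))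
    ultimately show ?thesis using LIMSEQ_le_const by fastforce
  qed
  have "ip m (u - l) = 0" if m: "m \<in> M" for m
  proof (rule perp_if_minimal)
    show "u - l \<in> H" "m \<in> H" using u l m M by (auto simp: H_diff)
    fix c
    show "(nm (u - l))\<^sup>2 \<le> (nm (u - l + sc c m))\<^sup>2"
      by (rule power_mono[OF order_trans[OF ul lower[OF m]]]) (simp add: u l(1) nm_nonneg H_diff)
  qed
  then have "nm (u - l) = 0" using perp u l by (simp add: H_diff)
  then have "(\<lambda>n. nm (u - X n)) \<longlonglongrightarrow> 0"
    using tendsto_sandwich[of "\<lambda>n. 0" "\<lambda>n. nm (u - X n)" sequentially "\<lambda>n. nm (X n - l)" 0]
      nm_triangle_diff[OF u l(1) XH] nm_minus_commute[OF l(1) XH] nm_nonneg[OF H_diff[OF u XH]] l(2) by simp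
  then obtain n where "norm (nm (u - X n) - 0) < \<epsilon>" using LIMSEQ_D \<epsilon> by blast
  then show ?thesis using X(1) by (intro bexI[of _ "X n"]) auto
qed

end

section \<open>Nonnegative self-adjoint operators\<close>

context semi_hilbert
begin

definition lin_graph :: "('v \<times> 'v) set \<Rightarrow> bool" where
  "lin_graph T \<longleftrightarrow> T \<subseteq> H \<times> H \<and> (0, 0) \<in> T \<and>
     (\<forall>f g f' g'. (f, g) \<in> T \<longrightarrow> (f', g') \<in> T \<longrightarrow> (f + f', g + g') \<in> T) \<and>
     (\<forall>c f g. (f, g) \<in> T \<longrightarrow> (sc c f, sc c g) \<in> T)"

definition adj :: "('v \<times> 'v) set \<Rightarrow> ('v \<times> 'v) set" where
  "adj T = {(u, v). u \<in> H \<and> v \<in> H \<and> (\<forall>f g. (f, g) \<in> T \<longrightarrow> ip g u = ip f v)}"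

definition nonneg :: "('v \<times> 'v) set \<Rightarrow> bool" where
  "nonneg T \<longleftrightarrow> (\<forall>u v. (u, v) \<in> T \<longrightarrow> 0 \<le> ip u v)"

lemma lin_graphD:
  assumes "lin_graph T"
  shows "(f, g) \<in> T \<Longrightarrow> f \<in> H" "(f, g) \<in> T \<Longrightarrow> g \<in> H" "(0, 0) \<in> T"
    "(f, g) \<in> T \<Longrightarrow> (f', g') \<in> T \<Longrightarrow> (f + f', g + g') \<in> T"
    "(f, g) \<in> T \<Longrightarrow> (sc c f, sc c g) \<in> T"
  using assms unfolding lin_graph_def by blast+

lemma lin_graph_diff:
  assumes "lin_graph T" "(f, g) \<in> T" "(f', g') \<in> T"
  shows "(f - f', g - g') \<in> T"
  using lin_graphD(4)[OF assms(1,2) lin_graphD(5)[OF assms(1,3), of "-1"]] by (simp add: scale_minus_left)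

lemma adjD: "T = adj T \<Longrightarrow> (f, g) \<in> T \<Longrightarrow> (u, v) \<in> T \<Longrightarrow> ip g u = ip f v"
  unfolding adj_def by blast

lemma nonnegD: "nonneg T \<Longrightarrow> (u, v) \<in> T \<Longrightarrow> 0 \<le> ip u v"
  unfolding nonneg_def by blast

text \<open>In the expansion of the squared norm the cross term is
  \<open>2 * c * Re (ip g f)\<close>, which is nonnegative. Injectivity of \<open>T + c\<close> and
  convergence of approximate preimages both rest on these bounds.\<close>

lemma nonneg_shift_bound:
  assumes T: "lin_graph T" "nonneg T" and fg: "(f, g) \<in> T" and c: "c > 0"
  shows "c * nm f \<le> nm (g + sc (of_real c) f)" "nm g \<le> nm (g + sc (of_real c) f)"
proof -
  have H: "f \<in> H" "g \<in> H" using lin_graphD(1,2)[OF T(1) fg] .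
  have "(nm (g + sc (of_real c) f))\<^sup>2 = (nm g)\<^sup>2 + 2 * (c * Re (ip g f)) + c\<^sup>2 * (nm f)\<^sup>2"
    unfolding nm_sq[OF D_add[OF H(2) D_sc[OF H(1)]]] nm_sq[OF H(1)] nm_sq[OF H(2)]
    by (subst q_perturb[OF H(2,1)]) simp
  moreover have "Re (ip g f) \<ge> 0"
    using nonnegD[OF T(2) fg] unfolding q_cnj[OF H] by (simp add: less_eq_complex_def)
  then have "0 \<le> 2 * (c * Re (ip g f))" using c by simp
  ultimately have "(c * nm f)\<^sup>2 \<le> (nm (g + sc (of_real c) f))\<^sup>2" "(nm g)\<^sup>2 \<le> (nm (g + sc (of_real c) f))\<^sup>2"
    by (auto simp: power_mult_distrib)
  then show "c * nm f \<le> nm (g + sc (of_real c) f)" "nm g \<le> nm (g + sc (of_real c) f)"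
    using H by (auto intro!: power2_le_imp_le nm_nonneg D_add D_sc)
qed

text \<open>A vector \<open>h\<close> orthogonal to the range of \<open>T + c\<close> satisfies
  \<open>T h = - c h\<close> by self-adjointness, and nonnegativity then forces it to be
  null.\<close>

lemma shift_dense:
  assumes T: "lin_graph T" "nonneg T" "T = adj T" and c: "c > 0" and u: "u \<in> H" and \<epsilon>: "\<epsilon> > 0"
  shows "\<exists>f g. (f, g) \<in> T \<and> nm (u - (g + sc (of_real c) f)) < \<epsilon>"
proof -
  define M where "M = {g + sc (of_real c) f | f g. (f, g) \<in> T}"
  have "\<exists>m\<in>M. nm (u - m) < \<epsilon>"
  proof (rule dense_if_perp_trivial[OF _ _ _ _ _ u \<epsilon>])
    show "M \<subseteq> H" using lin_graphD(1,2)[OF T(1)] by (auto simp: M_def intro!: D_add D_sc)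
    show "0 \<in> M" unfolding M_def using lin_graphD(3)[OF T(1)] by (rule_tac CollectI, rule_tac x=0 in exI, rule_tac x=0 in exI) simp
    show "p + r \<in> M" if pr: "p \<in> M" "r \<in> M" for p r
    proof -
      obtain f g where 1: "p = g + sc (of_real c) f" "(f, g) \<in> T" using pr(1) by (auto simp: M_def)
      obtain f' g' where 2: "r = g' + sc (of_real c) f'" "(f', g') \<in> T" using pr(2) by (auto simp: M_def)
      have "p + r = (g + g') + sc (of_real c) (f + f')" by (simp add: 1 2 scale_right_distrib algebra_simps)
      then show ?thesis using lin_graphD(4)[OF T(1) 1(2) 2(2)] unfolding M_def by blast
    qed
    show "sc d p \<in> M" if p: "p \<in> M" for d p
    proof -
      obtain f g where 1: "p = g + sc (of_real c) f" "(f, g) \<in> T" using p by (auto simp: M_def)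
      have "sc d p = sc d g + sc (of_real c) (sc d f)" by (simp add: 1 scale_right_distrib mult.commute)
      then show ?thesis using lin_graphD(5)[OF T(1) 1(2)] unfolding M_def by blast
    qed
    show "nm h = 0" if h: "h \<in> H" and perp: "\<And>m. m \<in> M \<Longrightarrow> ip m h = 0" for h
    proof -
      have "ip g h = ip f (sc (- of_real c) h)" if fg: "(f, g) \<in> T" for f g
      proof -
        have H: "f \<in> H" "g \<in> H" using lin_graphD(1,2)[OF T(1) fg] .
        have "ip (g + sc (of_real c) f) h = 0" using fg by (intro perp) (auto simp: M_def)
        then show ?thesis using H h by (simp add: ip_simps D_sc add_eq_0_iff)
      qed
      then have "(h, sc (- of_real c) h) \<in> adj T" using h D_sc[OF h] unfolding adj_def by blast
      then have "(h, sc (- of_real c) h) \<in> T" using T(3) by simp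
      from nonnegD[OF T(2) this] have "0 \<le> - (c * Re (ip h h))"
        using h by (simp add: ip_simps D_sc less_eq_complex_def)
      then have "Re (ip h h) = 0" using c q_nonneg[OF h] by (simp add: mult_le_0_iff)
      then show ?thesis by (simp add: nm_def)
    qed
  qed
  then show ?thesis unfolding M_def by blast
qed

text \<open>Adjoint graphs are closed, because the defining equations are continuous in the second
  argument of the inner product.\<close>

lemma self_adjoint_closed:
  assumes T: "T = adj T" and X: "\<And>n. (X n, Y n) \<in> T" and lim: "f \<in> H" "g \<in> H" "(\<lambda>n. nm (X n - f)) \<longlonglongrightarrow> 0" "(\<lambda>n. nm (Y n - g)) \<longlonglongrightarrow> 0"
  shows "(f, g) \<in> T"
proof -
  have H: "X n \<in> H" "Y n \<in> H" for n
  proof -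
    have "(X n, Y n) \<in> adj T" using X T by simp
    then show "X n \<in> H" "Y n \<in> H" unfolding adj_def by auto
  qed
  have "ip s f = ip r g" if rs: "(r, s) \<in> T" for r s
  proof -
    have "(r, s) \<in> adj T" using rs T by simp
    then have RS: "r \<in> H" "s \<in> H" unfolding adj_def by auto
    have 1: "(\<lambda>n. ip s (X n)) \<longlonglongrightarrow> ip s f" by (rule tendsto_ip_right[OF H(1) lim(1) RS(2) lim(3)])
    have 2: "(\<lambda>n. ip r (Y n)) \<longlonglongrightarrow> ip r g" by (rule tendsto_ip_right[OF H(2) lim(2) RS(1) lim(4)])
    have "(\<lambda>n. ip s (X n)) = (\<lambda>n. ip r (Y n))" using adjD[OF T rs X] by (rule ext)
    then show ?thesis using LIMSEQ_unique 1 2 by metis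
  qed
  then have "(f, g) \<in> adj T" using lim unfolding adj_def by blast
  then show ?thesis using T by simp
qed

text \<open>Approximate preimages exist by density of the range. The lower bounds make them converge
  geometrically in both components, and the limit stays in the closed graph.\<close>

lemma shift_surjective:
  assumes T: "lin_graph T" "nonneg T" "T = adj T" and c: "c > 0" and u: "u \<in> H"
  shows "\<exists>f g. (f, g) \<in> T \<and> eqv (g + sc (of_real c) f) u"
proof -
  \<comment> \<open>Successive residuals differ by at most \<open>2 * \<eta> * (1/2) ^ n\<close>.
    The bound for \<open>X\<close> divides this by \<open>c\<close> and the bound for
    \<open>Y\<close> by 1, whence half of the minimum.\<close>
  define \<eta> where "\<eta> = min 1 c / 2"
  have \<eta>: "\<eta> > 0" "2 * \<eta> \<le> 1" "2 * \<eta> \<le> c" using c by (auto simp: \<eta>_def)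
  have "\<exists>z. z \<in> T \<and> nm (u - (snd z + sc (of_real c) (fst z))) < \<eta> * (1/2) ^ n" for n :: nat
  proof -
    obtain f g where "(f, g) \<in> T" "nm (u - (g + sc (of_real c) f)) < \<eta> * (1/2) ^ n"
      using shift_dense[OF T c u, of "\<eta> * (1/2) ^ n"] \<eta> by auto
    then show ?thesis by (intro exI[of _ "(f, g)"]) simp
  qed
  then have "\<exists>z. \<forall>n. z n \<in> T \<and> nm (u - (snd (z n) + sc (of_real c) (fst (z n)))) < \<eta> * (1/2) ^ n" by (intro choice allI)
  then obtain z where z: "\<And>n. z n \<in> T" "\<And>n. nm (u - (snd (z n) + sc (of_real c) (fst (z n)))) < \<eta> * (1/2) ^ n" by blast
  define X where "X n = fst (z n)" for n
  define Y where "Y n = snd (z n)" for n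
  have XY: "(X n, Y n) \<in> T" for n using z(1)[of n] by (simp add: X_def Y_def)
  have H: "X n \<in> H" "Y n \<in> H" for n using lin_graphD(1,2)[OF T(1) XY] .
  define R where "R n = Y n + sc (of_real c) (X n)" for n
  have RH: "R n \<in> H" for n unfolding R_def by (intro D_add D_sc H)
  have Ru: "nm (u - R n) < \<eta> * (1/2) ^ n" for n using z(2)[of n] by (simp add: R_def X_def Y_def)
  have inc: "nm (R (Suc n) - R n) \<le> 2 * \<eta> * (1/2) ^ n" for n
  proof -
    have "nm (R (Suc n) - R n) \<le> nm (R (Suc n) - u) + nm (u - R n)" by (rule nm_triangle_diff[OF RH u RH])
    also have "nm (R (Suc n) - u) = nm (u - R (Suc n))" by (rule nm_minus_commute[OF RH u])
    finally have "nm (R (Suc n) - R n) \<le> \<eta> * (1/2) ^ Suc n + \<eta> * (1/2) ^ n" using Ru[of n] Ru[of "Suc n"] by simp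
    also have "\<dots> \<le> 2 * \<eta> * (1/2) ^ n" using \<eta>(1) by simp
    finally show ?thesis .
  qed
  have dRe: "R (Suc n) - R n = (Y (Suc n) - Y n) + sc (of_real c) (X (Suc n) - X n)" for n
    by (simp add: R_def scale_right_diff_distrib algebra_simps)
  have dX: "nm (X (Suc n) - X n) \<le> (1/2) ^ n" and dY: "nm (Y (Suc n) - Y n) \<le> (1/2) ^ n" for n
  proof -
    note b = nonneg_shift_bound[OF T(1,2) lin_graph_diff[OF T(1) XY XY] c, of "Suc n" n, folded dRe]
    have p: "(0::real) \<le> (1/2) ^ n" by simp
    have "c * nm (X (Suc n) - X n) \<le> 2 * \<eta> * (1/2) ^ n" using b(1) inc[of n] by simp
    also have "\<dots> \<le> c * (1/2) ^ n" using \<eta>(3) p by (rule mult_right_mono)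
    finally show "nm (X (Suc n) - X n) \<le> (1/2) ^ n" using c by (simp only: mult_le_cancel_left_pos)
    have "nm (Y (Suc n) - Y n) \<le> 2 * \<eta> * (1/2) ^ n" using b(2) inc[of n] by simp
    also have "\<dots> \<le> 1 * (1/2) ^ n" using \<eta>(2) p by (rule mult_right_mono)
    finally show "nm (Y (Suc n) - Y n) \<le> (1/2) ^ n" by simp
  qed
  obtain f where f: "f \<in> H" "(\<lambda>n. nm (X n - f)) \<longlonglongrightarrow> 0" using fast_Cauchy_convergent[OF H(1) dX] by blast
  obtain g where g: "g \<in> H" "(\<lambda>n. nm (Y n - g)) \<longlonglongrightarrow> 0" using fast_Cauchy_convergent[OF H(2) dY] by blast
  have fg: "(f, g) \<in> T" by (rule self_adjoint_closed[OF T(3) XY f(1) g(1) f(2) g(2)])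
  have "nm ((g + sc (of_real c) f) - u) \<le> nm (Y n - g) + c * nm (X n - f) + \<eta> * (1/2) ^ n" for n
  proof -
    have w: "g + sc (of_real c) f \<in> H" by (intro D_add D_sc f g)
    have "nm ((g + sc (of_real c) f) - u) \<le> nm ((g + sc (of_real c) f) - R n) + nm (R n - u)"
      by (rule nm_triangle_diff[OF w RH u])
    also have "(g + sc (of_real c) f) - R n = (g - Y n) + sc (of_real c) (f - X n)"
      by (simp add: R_def scale_right_diff_distrib algebra_simps)
    also have "nm ((g - Y n) + sc (of_real c) (f - X n)) \<le> nm (g - Y n) + nm (sc (of_real c) (f - X n))"
      by (intro nm_triangle D_sc H_diff f g H)
    also have "nm (sc (of_real c) (f - X n)) = c * nm (X n - f)"
      using c by (simp add: nm_sc H_diff f H nm_minus_commute[OF f(1) H(1)])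
    also have "nm (g - Y n) = nm (Y n - g)" by (rule nm_minus_commute[OF g(1) H(2)])
    finally show ?thesis using Ru[of n] nm_minus_commute[OF RH[of n] u] by simp
  qed
  moreover have "(\<lambda>n. nm (Y n - g) + c * nm (X n - f) + \<eta> * (1/2) ^ n) \<longlonglongrightarrow> 0 + c * 0 + \<eta> * 0"
    by (intro tendsto_add tendsto_mult tendsto_const f g LIMSEQ_realpow_zero) auto
  ultimately have "nm ((g + sc (of_real c) f) - u) \<le> 0" using LIMSEQ_le_const by fastforce
  then have "eqv (g + sc (of_real c) f) u"
    unfolding eqv_def using nm_nonneg[of "g + sc (of_real c) f - u"] f g u by (simp add: H_closed)
  then show ?thesis using fg by blast
qed

lemma shift_injective:
  assumes T: "lin_graph T" "nonneg T" and c: "c > 0" and fg: "(f, g) \<in> T" "(f', g') \<in> T"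
    and eq: "eqv (g + sc (of_real c) f) (g' + sc (of_real c) f')"
  shows "eqv f f'" "eqv g g'"
proof -
  have H: "f \<in> H" "g \<in> H" "f' \<in> H" "g' \<in> H" using lin_graphD(1,2)[OF T(1)] fg by blast+
  have "(g + sc (of_real c) f) - (g' + sc (of_real c) f') = (g - g') + sc (of_real c) (f - f')"
    by (simp add: scale_right_diff_distrib algebra_simps)
  then have z: "nm ((g - g') + sc (of_real c) (f - f')) = 0" using eq unfolding eqv_def by metis
  note b = nonneg_shift_bound[OF T lin_graph_diff[OF T(1) fg] c]
  have "c * nm (f - f') \<le> 0" "nm (g - g') \<le> 0" using b z by auto
  then show "eqv f f'" "eqv g g'"
    unfolding eqv_def using nm_nonneg[of "f - f'"] nm_nonneg[of "g - g'"] H c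
    by (auto simp: H_diff mult_le_0_iff)
qed

text \<open>The form pairs the value of one graph element with the argument of another; it is
  Hermitian because \<open>T = adj T\<close>. It lives on pairs rather than on a domain, since a
  relation need not be a function.\<close>

lemma graph_form_Cauchy_Schwarz:
  assumes T: "lin_graph T" "nonneg T" "T = adj T" and fg: "(f, g) \<in> T" "(f', g') \<in> T"
  shows "(cmod (ip g f'))\<^sup>2 \<le> Re (ip g f) * Re (ip g' f')"
proof -
  interpret G: pos_form "\<lambda>c z. (sc c (fst z), sc c (snd z))" T "\<lambda>z w. ip (snd z) (fst w)"
  proof
    show "0 \<in> T" using lin_graphD(3)[OF T(1)] by (simp add: zero_prod_def)
  next
    fix u v assume uv: "u \<in> T" "v \<in> T"
    obtain f g f' g' where e: "u = (f, g)" "v = (f', g')" by (cases u, cases v)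
    have H: "f \<in> H" "g \<in> H" "f' \<in> H" "g' \<in> H" using lin_graphD(1,2)[OF T(1)] uv e by blast+
    show "u + v \<in> T" using lin_graphD(4)[OF T(1)] uv e by simp
    have "ip g' f = ip f' g" using adjD[OF T(3)] uv e by blast
    then show "ip (snd v) (fst u) = cnj (ip (snd u) (fst v))" using q_cnj[OF H(2,3)] e by simp
    show "ip (snd (u + v)) (fst w) = ip (snd u) (fst w) + ip (snd v) (fst w)" if "w \<in> T" for w
    proof -
      have "fst w \<in> H" using lin_graphD(1)[OF T(1), of "fst w" "snd w"] that by simp
      then show ?thesis using H e by (simp add: ip_simps)
    qed
  next
    fix u c assume u: "u \<in> T"
    obtain f g where e: "u = (f, g)" by (cases u)
    have H: "f \<in> H" "g \<in> H" using lin_graphD(1,2)[OF T(1)] u e by blast+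
    show "(sc c (fst u), sc c (snd u)) \<in> T" using lin_graphD(5)[OF T(1)] u e by simp
    show "ip (snd (sc c (fst u), sc c (snd u))) (fst w) = c * ip (snd u) (fst w)" if "w \<in> T" for w
    proof -
      have "fst w \<in> H" using lin_graphD(1)[OF T(1), of "fst w" "snd w"] that by simp
      then show ?thesis using H e by (simp add: ip_simps)
    qed
    have "0 \<le> ip f g" using nonnegD[OF T(2)] u e by blast
    then show "0 \<le> Re (ip (snd u) (fst u))" using q_cnj[OF H] e by (simp add: less_eq_complex_def)
  qed
  show ?thesis using G.q_Cauchy_Schwarz[OF fg] by simp
qed

text \<open>The variational core of the minimality of the Krein--von Neumann extension (Ando--Nishio):
  a vector \<open>v\<close> of the extension is compared with its component \<open>v0\<close> in the domain of the
  minimal operator, on which every nonnegative extension \<open>T\<close> acts in the same way.\<close>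

lemma resolvent_form_le:
  assumes T: "lin_graph T" "nonneg T" "T = adj T" and c: "c > 0"
    and v0: "(v0, g) \<in> T" and v: "v \<in> H" "ip g v = ip g v0"
    and w: "(w, h) \<in> T" and u: "u \<in> H" and uv: "eqv (g + sc (of_real c) v) u" and uw: "eqv (h + sc (of_real c) w) u"
  shows "ip u w \<le> ip u v"
proof -
  have H: "v0 \<in> H" "g \<in> H" "w \<in> H" "h \<in> H" using lin_graphD(1,2)[OF T(1)] v0 w by blast+
  have gvH: "g + sc (of_real c) v \<in> H" "h + sc (of_real c) w \<in> H" by (intro D_add D_sc H v)+
  have real: "ip y x = of_real (Re (ip y x))" "0 \<le> Re (ip y x)" if "(x, y) \<in> T" for x y
  proof -
    have xy: "x \<in> H" "y \<in> H" using lin_graphD(1,2)[OF T(1) that] .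
    have "0 \<le> ip x y" by (rule nonnegD[OF T(2) that])
    then show "ip y x = of_real (Re (ip y x))" "0 \<le> Re (ip y x)"
      unfolding q_cnj[OF xy] by (auto simp: less_eq_complex_def complex_eq_iff)
  qed
  define p where "p = Re (ip g v0)"
  define r where "r = Re (ip h w)"
  have p0: "0 \<le> p" and r0: "0 \<le> r" using real(2) v0 w by (auto simp: p_def r_def)
  have uv': "ip u v = of_real (p + c * (nm v)\<^sup>2)"
  proof -
    have "ip u v = ip (g + sc (of_real c) v) v" by (rule ip_eqv_left[OF gvH(1) u v(1) uv, symmetric])
    also have "\<dots> = ip g v0 + of_real c * ip v v" using H v by (simp add: ip_simps D_sc)
    also have "\<dots> = of_real p + of_real c * of_real ((nm v)\<^sup>2)"
      using real(1)[OF v0] q_self[OF v(1)] unfolding p_def nm_sq[OF v(1)] by metis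
    finally show ?thesis by simp
  qed
  have uw': "ip u w = of_real (r + c * (nm w)\<^sup>2)"
  proof -
    have "ip u w = ip (h + sc (of_real c) w) w" by (rule ip_eqv_left[OF gvH(2) u H(3) uw, symmetric])
    also have "\<dots> = ip h w + of_real c * ip w w" using H v by (simp add: ip_simps D_sc)
    also have "\<dots> = of_real r + of_real c * of_real ((nm w)\<^sup>2)"
      using real(1)[OF w] q_self[OF H(3)] unfolding r_def nm_sq[OF H(3)] by metis
    finally show ?thesis by simp
  qed
  define s where "s = r + c * (nm w)\<^sup>2"
  define t where "t = p + c * (nm v)\<^sup>2"
  have s0: "0 \<le> s" and t0: "0 \<le> t" using p0 r0 c by (auto simp: s_def t_def)
  \<comment> \<open>A second expression for \<open>ip u w\<close>, with \<open>u\<close> written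
    through \<open>v\<close>. Since \<open>(v0, g)\<close> is in \<open>T\<close>, the term
    \<open>ip g w\<close> is a value of the form of \<open>T\<close>.\<close>
  have "ip u w = ip (g + sc (of_real c) v) w" by (rule ip_eqv_left[OF gvH(1) u H(3) uv, symmetric])
  also have "\<dots> = ip g w + of_real c * ip v w" using H v by (simp add: ip_simps D_sc)
  finally have "cmod (ip u w) \<le> cmod (ip g w) + c * cmod (ip v w)"
    using norm_triangle_ineq[of "ip g w" "of_real c * ip v w"] c by (simp add: norm_mult)
  moreover have "cmod (ip g w) \<le> sqrt p * sqrt r"
    using graph_form_Cauchy_Schwarz[OF T v0 w] by (simp add: real_sqrt_mult[symmetric] real_le_rsqrt p_def r_def)
  moreover have "c * cmod (ip v w) \<le> c * (nm v * nm w)" using Cauchy_Schwarz[OF v(1) H(3)] c by simp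
  moreover have "cmod (ip u w) = s" unfolding uw' s_def[symmetric] using s0 by simp
  ultimately have s1: "s \<le> sqrt p * sqrt r + c * (nm v * nm w)" by simp
  have "s\<^sup>2 \<le> (sqrt p * sqrt r + c * (nm v * nm w))\<^sup>2" using s1 s0 by (rule power_mono)
  also have "\<dots> \<le> t * s"
  proof -
    define A where "A = sqrt p" define B where "B = sqrt r"
    define x where "x = nm v" define y where "y = nm w"
    have pr: "p = A\<^sup>2" "r = B\<^sup>2" using p0 r0 by (auto simp: A_def B_def)
    \<comment> \<open>Lagrange's identity for the pairs \<open>(A, sqrt c * x)\<close> and
      \<open>(B, sqrt c * y)\<close>.\<close>
    have "t * s - (A * B + c * (x * y))\<^sup>2 = c * (A * y - B * x)\<^sup>2"
      unfolding t_def s_def pr x_def[symmetric] y_def[symmetric] by (simp add: power2_eq_square algebra_simps)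
    moreover have "0 \<le> c * (A * y - B * x)\<^sup>2" using c by simp
    ultimately show ?thesis unfolding A_def B_def x_def y_def by linarith
  qed
  finally have "s * s \<le> t * s" by (simp add: power2_eq_square)
  then have "s \<le> t" using s0 t0 by (cases "s = 0") auto
  then show ?thesis unfolding uv' uw' s_def t_def by (simp add: less_eq_complex_def)
qed

text \<open>Polarization recovers the resolvents at 1 from their diagonal values, and a resolvent
  determines its graph, because \<open>(f, g)\<close> is recovered from \<open>u = g + f\<close>.
  \<open>R1\<close> and \<open>R2\<close> are arbitrary selections, so all intermediate equalities
  hold up to \<open>eqv\<close>.\<close>

lemma nonneg_self_adjoint_eqI:
  assumes T1: "lin_graph T1" "nonneg T1" "T1 = adj T1" and T2: "lin_graph T2" "nonneg T2" "T2 = adj T2"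
    and R1: "\<And>u. u \<in> H \<Longrightarrow> \<exists>w. (R1 u, w) \<in> T1 \<and> eqv (w + R1 u) u"
    and R2: "\<And>u. u \<in> H \<Longrightarrow> \<exists>w. (R2 u, w) \<in> T2 \<and> eqv (w + R2 u) u"
    and eq: "\<And>u. u \<in> H \<Longrightarrow> ip u (R1 u) = ip u (R2 u)"
  shows "T1 = T2"
proof -
  \<comment> \<open>A selected resolvent is linear only up to null vectors, by injectivity of
    \<open>T + 1\<close>; the inner product hides the difference.\<close>
  have lin: "ip x (R (u + sc c v)) = ip x (R u) + cnj c * ip x (R v)"
    if T: "lin_graph T" "nonneg T" and R: "\<And>u. u \<in> H \<Longrightarrow> \<exists>w. (R u, w) \<in> T \<and> eqv (w + R u) u"
      and uv: "u \<in> H" "v \<in> H" and x: "x \<in> H" for T R u v x c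
  proof -
    have uvc: "u + sc c v \<in> H" using uv by (intro D_add D_sc)
    obtain w1 where 1: "(R u, w1) \<in> T" "eqv (w1 + R u) u" using R uv by blast
    obtain w2 where 2: "(R v, w2) \<in> T" "eqv (w2 + R v) v" using R uv by blast
    obtain w3 where 3: "(R (u + sc c v), w3) \<in> T" "eqv (w3 + R (u + sc c v)) (u + sc c v)" using R uvc by blast
    have H: "R u \<in> H" "w1 \<in> H" "R v \<in> H" "w2 \<in> H" "R (u + sc c v) \<in> H" "w3 \<in> H"
      using lin_graphD(1,2)[OF T(1)] 1 2 3 by blast+
    have c12: "(R u + sc c (R v), w1 + sc c w2) \<in> T"
      by (intro lin_graphD(4)[OF T(1)] lin_graphD(5)[OF T(1)] 1 2)
    have "nm ((w1 + sc c w2 + (R u + sc c (R v))) - (u + sc c v)) \<le> nm ((w1 + R u) - u) + nm (sc c ((w2 + R v) - v))"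
    proof -
      have "(w1 + sc c w2 + (R u + sc c (R v))) - (u + sc c v) = ((w1 + R u) - u) + sc c ((w2 + R v) - v)"
        by (simp add: scale_right_diff_distrib scale_right_distrib algebra_simps)
      moreover have "(w1 + R u) - u \<in> H" "sc c ((w2 + R v) - v) \<in> H" using H uv by (simp_all add: H_closed)
      ultimately show ?thesis using nm_triangle[of "(w1 + R u) - u" "sc c ((w2 + R v) - v)"] by metis
    qed
    also have "\<dots> = 0" using 1(2) 2(2) H uv by (simp add: nm_sc H_closed eqv_def)
    finally have "eqv (w1 + sc c w2 + (R u + sc c (R v))) (u + sc c v)"
      unfolding eqv_def using nm_nonneg[of "(w1 + sc c w2 + (R u + sc c (R v))) - (u + sc c v)"] H uv by (simp add: H_closed)
    then have "eqv (w1 + sc c w2 + (R u + sc c (R v))) (w3 + R (u + sc c v))"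
      using eqv_trans[OF _ uvc _ _ eqv_sym[OF _ uvc 3(2)]] H uv by (simp add: H_closed)
    then have "eqv (R u + sc c (R v)) (R (u + sc c v))"
      using shift_injective(1)[OF T zero_less_one c12 3(1)] by (simp add: scale_one)
    then have "ip x (R u + sc c (R v)) = ip x (R (u + sc c v))"
      using H x by (intro ip_eqv_right) (auto intro: H_closed)
    then show ?thesis using H x by (simp add: ip_simps D_sc)
  qed
  have lin1: "ip x (R1 (u + sc c v)) = ip x (R1 u) + cnj c * ip x (R1 v)"
    and lin2: "ip x (R2 (u + sc c v)) = ip x (R2 u) + cnj c * ip x (R2 v)"
    if "u \<in> H" "v \<in> H" "x \<in> H" for u v x c
    using lin[of T1 R1 u v x c] lin[of T2 R2 u v x c] T1(1,2) T2(1,2) R1 R2 that by blast+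
  have RH: "R1 u \<in> H" "R2 u \<in> H" if "u \<in> H" for u
    using R1[OF that] R2[OF that] lin_graphD(1)[OF T1(1)] lin_graphD(1)[OF T2(1)] by blast+
  have pol: "ip x (R1 y) = ip x (R2 y)" if xy: "x \<in> H" "y \<in> H" for x y
  proof -
    \<comment> \<open>The values of \<open>d\<close> at \<open>x + y\<close> and at
      \<open>x + \<i> y\<close> isolate \<open>d x y\<close>.\<close>
    define d where "d u v = ip u (R1 v) - ip u (R2 v)" for u v
    have d: "d (x + sc c y) (x + sc c y) = d x x + cnj c * d x y + c * d y x + c * cnj c * d y y" for c
    proof -
      have "x + sc c y \<in> H" using xy by (intro D_add D_sc)
      then show ?thesis unfolding d_def using xy lin1[OF xy] lin2[OF xy] RH
        by (simp add: ip_simps D_sc algebra_simps)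
    qed
    have d0: "d u u = 0" if "u \<in> H" for u using eq[OF that] by (simp add: d_def)
    have "d x y + d y x = 0"
      using d[of 1] d0[OF D_add[OF xy]] d0 xy by simp
    moreover have "cnj \<i> * d x y + \<i> * d y x = 0"
      using d[of \<i>] d0[OF D_add[OF xy(1) D_sc[OF xy(2)]]] d0 xy by simp
    then have "\<i> * (d y x - d x y) = 0" by (simp add: algebra_simps)
    then have "d y x = d x y" by simp
    ultimately have "d x y = 0" by simp
    then show ?thesis by (simp add: d_def)
  qed
  have RR: "eqv (R1 u) (R2 u)" if u: "u \<in> H" for u
  proof -
    have dH: "R1 u - R2 u \<in> H" using RH[OF u] by (rule H_diff)
    have "ip (R1 u - R2 u) (R1 u - R2 u) = 0"
      using pol[OF dH u] RH[OF u] dH by (simp add: ip_diff_right)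
    then show ?thesis by (simp add: eqv_def nm_def)
  qed
  \<comment> \<open>Adjoint graphs absorb null vectors in both components.\<close>
  have eqv_closed: "(f', g') \<in> T" if T: "T = adj T" and fg: "(f, g) \<in> T" and e: "f' \<in> H" "g' \<in> H" "eqv f f'" "eqv g g'" for T f g f' g'
  proof -
    have TH: "r \<in> H" "s \<in> H" if "(r, s) \<in> T" for r s
    proof -
      have "(r, s) \<in> adj T" using that T by simp
      then show "r \<in> H" "s \<in> H" unfolding adj_def by auto
    qed
    have "ip s f' = ip r g'" if rs: "(r, s) \<in> T" for r s
      using adjD[OF T rs fg] ip_eqv_right[OF TH(1)[OF fg] e(1) TH(2)[OF rs] e(3)]
        ip_eqv_right[OF TH(2)[OF fg] e(2) TH(1)[OF rs] e(4)] by simp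
    then have "(f', g') \<in> adj T" unfolding adj_def using e by blast
    then show ?thesis using T by simp
  qed
  have sub: "T \<subseteq> S" if T: "lin_graph T" "nonneg T" and S: "lin_graph S" "S = adj S"
    and R: "\<And>u. u \<in> H \<Longrightarrow> \<exists>w. (R u, w) \<in> T \<and> eqv (w + R u) u"
    and Q: "\<And>u. u \<in> H \<Longrightarrow> \<exists>w. (Q u, w) \<in> S \<and> eqv (w + Q u) u"
    and RQ: "\<And>u. u \<in> H \<Longrightarrow> eqv (R u) (Q u)" for T S R Q
  proof (rule subrelI)
    fix f g assume fg: "(f, g) \<in> T"
    have H: "f \<in> H" "g \<in> H" using lin_graphD(1,2)[OF T(1) fg] .
    define u where "u = g + f"
    have u: "u \<in> H" using H by (simp add: u_def D_add)
    obtain w1 where w1: "(R u, w1) \<in> T" "eqv (w1 + R u) u" using R[OF u] by blast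
    obtain w2 where w2: "(Q u, w2) \<in> S" "eqv (w2 + Q u) u" using Q[OF u] by blast
    have WH: "R u \<in> H" "w1 \<in> H" "Q u \<in> H" "w2 \<in> H" using lin_graphD(1,2)[OF T(1) w1(1)] lin_graphD(1,2)[OF S(1) w2(1)] .
    have "eqv (R u) f" using shift_injective(1)[OF T zero_less_one w1(1) fg] w1(2) by (simp add: scale_one u_def)
    then have Qf: "eqv (Q u) f"
      using eqv_trans[OF WH(3,1) H(1) eqv_sym[OF WH(1,3) RQ[OF u]]] by blast
    have "w2 - g = (w2 + Q u - u) + - (Q u - f)" by (simp add: u_def)
    moreover have "w2 + Q u - u \<in> H" "- (Q u - f) \<in> H" using WH H u by (simp_all add: H_closed)
    ultimately have "nm (w2 - g) \<le> nm (w2 + Q u - u) + nm (- (Q u - f))"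
      using nm_triangle[of "w2 + Q u - u" "- (Q u - f)"] by metis
    also have "\<dots> = 0" using w2(2) Qf nm_uminus[OF H_diff[OF WH(3) H(1)]] by (simp add: eqv_def)
    finally have "eqv w2 g" unfolding eqv_def using nm_nonneg[OF H_diff[OF WH(4) H(2)]] by simp
    then show "(f, g) \<in> S" using eqv_closed[OF S(2) w2(1) H Qf] by blast
  qed
  show ?thesis
  proof
    show "T1 \<subseteq> T2" by (rule sub[OF T1(1,2) T2(1,3) R1 R2 RR])
    show "T2 \<subseteq> T1" by (rule sub[OF T2(1,2) T1(1,3) R2 R1 eqv_sym[OF RH RR]])
  qed
qed

end

section \<open>The weighted space of square integrable functions\<close>

lemma sesq_sum: "sesq v A u = (\<Sum>i\<in>UNIV. \<Sum>j\<in>UNIV. cnj (v $ i) * (A $ i $ j * u $ j))"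
  by (simp add: sesq_def matrix_vector_mult_def sum_distrib_left)

lemma sesq_add_right: "sesq v A (u + w) = sesq v A u + sesq v A w"
  by (simp add: sesq_sum algebra_simps sum.distrib)

lemma sesq_add_left: "sesq (v + w) A u = sesq v A u + sesq w A u"
  by (simp add: sesq_sum algebra_simps sum.distrib)

lemma sesq_sc_right: "sesq v A (c *s u) = c * sesq v A u"
  by (simp add: sesq_sum sum_distrib_left mult_ac)

lemma sesq_sc_left: "sesq (c *s v) A u = cnj c * sesq v A u"
  by (simp add: sesq_sum sum_distrib_left mult_ac)

lemma positive_definite_nonneg: "positive_definite A \<Longrightarrow> 0 \<le> sesq v A v"
  unfolding positive_definite_def by (cases "v = 0") (auto simp: sesq_sum order_less_imp_le)

text \<open>Over the complex numbers a real-valued quadratic form comes from a Hermitian one: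
  compare its values at \<open>u + v\<close> and \<open>u + \<i> v\<close>. That the values are real
  is contained in the complex order.\<close>

lemma positive_definite_hermitian:
  assumes "positive_definite A"
  shows "sesq v A u = cnj (sesq u A v)"
proof -
  have p: "Im (sesq w A w) = 0" for w
    using positive_definite_nonneg[OF assms, of w] by (simp add: less_eq_complex_def)
  have "sesq (u + v) A (u + v) = sesq u A u + sesq u A v + (sesq v A u + sesq v A v)"
    by (simp add: sesq_add_left sesq_add_right)
  then have 1: "Im (sesq u A v) + Im (sesq v A u) = 0" using p[of "u + v"] p[of u] p[of v] by simp
  have "sesq (u + \<i> *s v) A (u + \<i> *s v) = sesq u A u + \<i> * sesq u A v + (- \<i> * sesq v A u + sesq v A v)"
    by (simp add: sesq_add_left sesq_add_right sesq_sc_left sesq_sc_right algebra_simps)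
  then have 2: "Re (sesq u A v) - Re (sesq v A u) = 0" using p[of "u + \<i> *s v"] p[of u] p[of v] by simp
  show ?thesis using 1 2 by (simp add: complex_eq_iff)
qed

text \<open>The arguments are exchanged because \<open>sesq\<close> is antilinear in its first
  one.\<close>

lemma pos_form_sesq:
  assumes "positive_definite A"
  shows "pos_form (*s) UNIV (\<lambda>u v. sesq v A u)"
proof
  show "sesq u A v = cnj (sesq v A u)" for u v by (rule positive_definite_hermitian[OF assms])
  show "0 \<le> Re (sesq u A u)" for u
    using positive_definite_nonneg[OF assms, of u] by (simp add: less_eq_complex_def)
qed (simp_all add: sesq_add_right sesq_sc_right)

lemma positive_definite_self:
  assumes "positive_definite A"
  shows "sesq v A v = of_real (Re (sesq v A v))" "0 \<le> Re (sesq v A v)" "norm (sesq v A v) = Re (sesq v A v)"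
proof -
  have "0 \<le> sesq v A v" by (rule positive_definite_nonneg[OF assms])
  then show 1: "sesq v A v = of_real (Re (sesq v A v))" and 2: "0 \<le> Re (sesq v A v)"
    by (auto simp: less_eq_complex_def complex_eq_iff)
  have "norm (complex_of_real (Re (sesq v A v))) = Re (sesq v A v)" using 2 by simp
  then show "norm (sesq v A v) = Re (sesq v A v)" using 1 by metis
qed

text \<open>Cauchy-Schwarz followed by the inequality of the means; it supplies the integrable
  majorant for the inner product.\<close>

lemma positive_definite_bound:
  assumes "positive_definite A"
  shows "2 * norm (sesq v A u) \<le> Re (sesq u A u) + Re (sesq v A v)"
proof -
  define p where "p = Re (sesq u A u)"
  define r where "r = Re (sesq v A v)"
  have pr: "0 \<le> p" "0 \<le> r" using positive_definite_self(2)[OF assms] by (auto simp: p_def r_def)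
  have "(norm (sesq v A u))\<^sup>2 \<le> p * r"
    using pos_form.q_Cauchy_Schwarz[OF pos_form_sesq[OF assms], of u v] by (simp add: p_def r_def)
  moreover have "4 * (p * r) \<le> (p + r)\<^sup>2"
    using zero_le_power2[of "p - r"] by (simp add: power2_eq_square algebra_simps)
  ultimately have "(2 * norm (sesq v A u))\<^sup>2 \<le> (p + r)\<^sup>2" by (simp add: power_mult_distrib)
  then have "2 * norm (sesq v A u) \<le> p + r" by (rule power2_le_imp_le) (use pr in simp)
  then show ?thesis by (simp add: p_def r_def)
qed

text \<open>The constant is the minimum over the compact unit sphere. It depends on the matrix, so
  for a weight it varies from point to point.\<close>

lemma positive_definite_coercive:
  assumes "positive_definite A"
  shows "\<exists>c>0. \<forall>v. c * (norm v)\<^sup>2 \<le> Re (sesq v A v)"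
proof -
  let ?S = "sphere (0 :: complex^'a) 1"
  have ne: "?S \<noteq> {}" by simp
  have cont: "continuous_on ?S (\<lambda>v. Re (sesq v A v))"
    unfolding sesq_sum by (intro continuous_intros)
  obtain w where w: "w \<in> ?S" "\<And>v. v \<in> ?S \<Longrightarrow> Re (sesq w A w) \<le> Re (sesq v A v)"
    using continuous_attains_inf[OF compact_sphere ne cont] by blast
  have "w \<noteq> 0" using w(1) by auto
  then have c: "0 < Re (sesq w A w)" using assms unfolding positive_definite_def by (auto simp: less_complex_def)
  have "Re (sesq w A w) * (norm v)\<^sup>2 \<le> Re (sesq v A v)" for v
  proof (cases "v = 0")
    case True then show ?thesis by (simp add: sesq_sum)
  next
    case False
    define e where "e = (1 / norm v) *\<^sub>R v"
    have "e \<in> ?S" using False by (simp add: e_def)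
    have "v = of_real (norm v) *s e" 
      using False unfolding e_def vec_eq_iff vector_smult_component vector_scaleR_component
      by (simp add: scaleR_conv_of_real)
    then have "sesq v A v = of_real ((norm v)\<^sup>2) * sesq e A e"
      by (metis sesq_sc_left sesq_sc_right complex_cnj_complex_of_real mult.assoc of_real_mult power2_eq_square)
    then have "Re (sesq v A v) = (norm v)\<^sup>2 * Re (sesq e A e)" by simp
    then show ?thesis using mult_right_mono[OF w(2)[OF \<open>e \<in> ?S\<close>], of "(norm v)\<^sup>2"] by (simp add: mult.commute)
  qed
  then show ?thesis using c by blast
qed

lemma borel_measurable_vec_nth_comp:
  fixes f :: "'a \<Rightarrow> 'b::{second_countable_topology, t2_space, real_normed_vector} ^ 'm::finite"
  shows "f \<in> borel_measurable M \<Longrightarrow> (\<lambda>x. f x $ i) \<in> borel_measurable M"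
  by (rule measurable_compose[of f M borel "\<lambda>v. v $ i"])
    (auto intro!: borel_measurable_continuous_onI continuous_intros)

lemma borel_measurable_sesq:
  assumes "f \<in> borel_measurable M" "g \<in> borel_measurable M" "W \<in> borel_measurable M"
  shows "(\<lambda>x. sesq (g x) (W x) (f x)) \<in> borel_measurable M"
proof -
  have [measurable]: "(\<lambda>x. f x $ i) \<in> borel_measurable M" "(\<lambda>x. W x $ i $ j) \<in> borel_measurable M" for i j
    using assms by (auto intro: borel_measurable_vec_nth_comp)
  have [measurable]: "(\<lambda>x. cnj (g x $ i)) \<in> borel_measurable M" for i
    by (rule measurable_compose[OF borel_measurable_vec_nth_comp[OF assms(2)]])
      (auto intro!: borel_measurable_continuous_onI continuous_intros)
  show ?thesis unfolding sesq_sum by measurable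
qed

section \<open>Completeness of the weighted space\<close>

locale weighted_L2 =
  fixes a b :: real and W :: "real \<Rightarrow> complex ^ 'm::finite ^ 'm"
  assumes weight_integrable: "integrable (lebesgue_on {a..b}) W"
    and weight_pos: "AE x in lebesgue_on {a..b}. positive_definite (W x)"
begin

abbreviation "M \<equiv> lebesgue_on {a..b}"
abbreviation "L2 \<equiv> L2W a b W"
abbreviation "inner2 \<equiv> inner_W a b W"

lemma W_measurable: "W \<in> borel_measurable M"
  using weight_integrable by auto

lemma L2W_measurable: "f \<in> L2 \<Longrightarrow> f \<in> borel_measurable M"
  by (simp add: L2W_def)

lemma integrable_sesq:
  assumes "f \<in> L2" "g \<in> L2"
  shows "integrable M (\<lambda>x. sesq (g x) (W x) (f x))"
proof (rule Bochner_Integration.integrable_bound)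
  show "integrable M (\<lambda>x. Re (sesq (f x) (W x) (f x)) + Re (sesq (g x) (W x) (g x)))"
    using assms by (auto simp: L2W_def)
  show "(\<lambda>x. sesq (g x) (W x) (f x)) \<in> borel_measurable M"
    using assms by (intro borel_measurable_sesq L2W_measurable W_measurable)
  show "AE x in M. norm (sesq (g x) (W x) (f x)) \<le> norm (Re (sesq (f x) (W x) (f x)) + Re (sesq (g x) (W x) (g x)))"
    using weight_pos
  proof eventually_elim
    case (elim x)
    show ?case using positive_definite_bound[OF elim, of "g x" "f x"] norm_ge_zero[of "sesq (g x) (W x) (f x)"]
      unfolding real_norm_def by linarith
  qed
qed

lemma inner_W_self_ennreal:
  assumes "f \<in> L2"
  shows "(\<integral>\<^sup>+x. ennreal (Re (sesq (f x) (W x) (f x))) \<partial>M) = ennreal (Re (inner2 f f))"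
proof -
  have i: "integrable M (\<lambda>x. sesq (f x) (W x) (f x))" using assms by (simp add: L2W_def)
  have "(\<integral>\<^sup>+x. ennreal (Re (sesq (f x) (W x) (f x))) \<partial>M) = ennreal (\<integral>x. Re (sesq (f x) (W x) (f x)) \<partial>M)"
  proof (rule nn_integral_eq_integral)
    show "AE x in M. 0 \<le> Re (sesq (f x) (W x) (f x))"
      using weight_pos by eventually_elim (rule positive_definite_self(2))
  qed (use i in auto)
  then show ?thesis using i by (simp add: inner_W_def)
qed

lemma L2W_I:
  assumes f: "f \<in> borel_measurable M" and fin: "(\<integral>\<^sup>+x. ennreal (Re (sesq (f x) (W x) (f x))) \<partial>M) < \<infinity>"
  shows "f \<in> L2"
proof -
  have m: "(\<lambda>x. sesq (f x) (W x) (f x)) \<in> borel_measurable M"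
    using f by (intro borel_measurable_sesq W_measurable)
  have "(\<integral>\<^sup>+x. ennreal (norm (sesq (f x) (W x) (f x))) \<partial>M) = (\<integral>\<^sup>+x. ennreal (Re (sesq (f x) (W x) (f x))) \<partial>M)"
    by (rule nn_integral_cong_AE) (use weight_pos in \<open>eventually_elim, simp add: positive_definite_self(3)\<close>)
  then have "integrable M (\<lambda>x. sesq (f x) (W x) (f x))" using m fin by (intro integrableI_bounded) auto
  then show ?thesis using f by (simp add: L2W_def)
qed

lemma pre_hilbert_L2W: "pre_hilbert (\<lambda>c f x. c *s f x) L2 inner2"
proof -
  have vs: "vector_space (\<lambda>c (f :: real \<Rightarrow> complex^'m) x. c *s f x)"
    by unfold_locales (auto simp: fun_eq_iff vec_eq_iff algebra_simps)
  have "pos_form (\<lambda>c (f :: real \<Rightarrow> complex^'m) x. c *s f x) L2 inner2"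
  proof
    show "0 \<in> L2" by (simp add: L2W_def sesq_sum zero_fun_def)
  next
    fix f g assume f: "f \<in> L2" and g: "g \<in> L2"
    have i: "integrable M (\<lambda>x. sesq (f x) (W x) (f x) + sesq (f x) (W x) (g x) + (sesq (g x) (W x) (f x) + sesq (g x) (W x) (g x)))"
      by (intro Bochner_Integration.integrable_add integrable_sesq f g)
    then show "f + g \<in> L2"
      using L2W_measurable[OF f] L2W_measurable[OF g]
      by (simp add: L2W_def plus_fun_def sesq_add_left sesq_add_right add_ac)
    have "inner2 g f = (LINT x|M. cnj (sesq (g x) (W x) (f x)))"
      unfolding inner_W_def
      by (rule integral_cong_AE)
        (use f g weight_pos in \<open>auto intro!: borel_measurable_sesq L2W_measurable W_measurable
          measurable_compose[of "\<lambda>x. sesq (g x) (W x) (f x)" M borel cnj] borel_measurable_continuous_onI continuous_intros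
          elim!: eventually_mono intro: positive_definite_hermitian\<close>)
    then show "inner2 g f = cnj (inner2 f g)"
      using integral_bounded_linear[OF bounded_linear_cnj integrable_sesq[OF f g]] by (simp add: inner_W_def)
    show "inner2 (f + g) h = inner2 f h + inner2 g h" if h: "h \<in> L2" for h
      unfolding inner_W_def plus_fun_def sesq_add_right
      by (intro Bochner_Integration.integral_add integrable_sesq f g h)
  next
    fix f c assume f: "f \<in> L2"
    have "(\<lambda>x. c *s f x) \<in> borel_measurable M"
      using L2W_measurable[OF f]
      by (rule measurable_compose[of f M borel "\<lambda>v. c *s v"])
        (auto intro!: borel_measurable_continuous_onI continuous_intros simp: vector_scalar_mult_def)
    then show "(\<lambda>x. c *s f x) \<in> L2" using integrable_sesq[OF f f]
      by (simp add: L2W_def sesq_sc_left sesq_sc_right)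
    show "inner2 (\<lambda>x. c *s f x) h = c * inner2 f h" if h: "h \<in> L2" for h
      unfolding inner_W_def by (simp add: sesq_sc_right)
    have "0 \<le> (\<integral>x. Re (sesq (f x) (W x) (f x)) \<partial>M)"
      by (rule integral_nonneg_AE) (use weight_pos in \<open>eventually_elim, simp add: positive_definite_self(2)\<close>)
    then show "0 \<le> Re (inner2 f f)" using f by (simp add: inner_W_def L2W_def)
  qed
  then show ?thesis using vs by (simp add: pre_hilbert_def)
qed

text \<open>Riesz-Fischer for a matrix weight. The weight need not have a uniform lower bound, so
  a.e. convergence is obtained with a separate coercivity constant at each point; Fatou's lemma then
  gives convergence in norm.\<close>

lemma semi_hilbert_L2W: "semi_hilbert (\<lambda>c f x. c *s f x) L2 inner2"
proof -
  interpret pre_hilbert "\<lambda>c f x. c *s f x" L2 inner2 by (rule pre_hilbert_L2W)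
  define p where "p f x = Re (sesq (f x) (W x) (f x))" for f x
  have p_nn: "(\<integral>\<^sup>+x. ennreal (p f x) \<partial>M) = ennreal ((nm f)\<^sup>2)" if "f \<in> L2" for f
    using inner_W_self_ennreal[OF that] nm_sq[OF that] by (simp add: p_def)
  have p_meas: "p f \<in> borel_measurable M" if "f \<in> borel_measurable M" for f
    unfolding p_def [abs_def] using borel_measurable_sesq[OF that that W_measurable] by measurable
  have "\<exists>l\<in>L2. (\<lambda>n. nm (X n - l)) \<longlonglongrightarrow> 0"
    if X: "\<And>n. X n \<in> L2" and inc: "\<And>n. nm (X (Suc n) - X n) \<le> (1/2) ^ n" for X
  proof -
    define D where "D n = X (Suc n) - X n" for n
    have DH: "D n \<in> L2" for n unfolding D_def by (intro H_diff X)
    have Xm: "X n \<in> borel_measurable M" and Dm: "D n \<in> borel_measurable M" for n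
      using X DH by (auto intro: L2W_measurable)
    \<comment> \<open>The squared norms of the increments are at most \<open>(1/4) ^ n\<close>, so
      the factor \<open>2 ^ n\<close> still leaves a convergent series.\<close>
    have "AE x in M. (\<Sum>n. ennreal (2 ^ n * p (D n) x)) \<noteq> \<infinity>"
    proof (rule nn_integral_PInf_AE)
      have m: "(\<lambda>x. ennreal (2 ^ n * p (D n) x)) \<in> borel_measurable M" for n
        using p_meas[OF Dm] by measurable
      then show "(\<lambda>x. \<Sum>n. ennreal (2 ^ n * p (D n) x)) \<in> borel_measurable M" by measurable
      have "(\<integral>\<^sup>+x. (\<Sum>n. ennreal (2 ^ n * p (D n) x)) \<partial>M) = (\<Sum>n. \<integral>\<^sup>+x. ennreal (2 ^ n * p (D n) x) \<partial>M)"
        using m by (rule nn_integral_suminf)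
      also have "\<dots> \<le> (\<Sum>n. ennreal ((1/2) ^ n))"
      proof (intro suminf_le summableI)
        fix n
        have "(\<integral>\<^sup>+x. ennreal (2 ^ n * p (D n) x) \<partial>M) = (\<integral>\<^sup>+x. ennreal (2 ^ n) * ennreal (p (D n) x) \<partial>M)"
          by (simp add: ennreal_mult')
        also have "\<dots> = ennreal (2 ^ n) * ennreal ((nm (D n))\<^sup>2)"
          using p_meas[OF Dm[of n]] p_nn[OF DH[of n]] by (subst nn_integral_cmult) auto
        also have "\<dots> = ennreal (2 ^ n * (nm (D n))\<^sup>2)" by (simp add: ennreal_mult')
        also have "\<dots> \<le> ennreal ((1/2) ^ n)"
        proof (rule ennreal_leI)
          have "(nm (D n))\<^sup>2 \<le> ((1/2) ^ n)\<^sup>2"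
            using inc[of n] nm_nonneg[OF DH[of n]] by (intro power_mono) (auto simp: D_def)
          then have "2 ^ n * (nm (D n))\<^sup>2 \<le> 2 ^ n * ((1/2) ^ n)\<^sup>2" by simp
          also have "\<dots> = (1/2) ^ n" by (simp add: power2_eq_square power_one_over)
          finally show "2 ^ n * (nm (D n))\<^sup>2 \<le> (1/2) ^ n" .
        qed
        finally show "(\<integral>\<^sup>+x. ennreal (2 ^ n * p (D n) x) \<partial>M) \<le> ennreal ((1/2) ^ n)" .
      qed
      also have "\<dots> = ennreal (\<Sum>n. (1/2) ^ n)" by (intro suminf_ennreal2 summable_geometric) auto
      finally show "(\<integral>\<^sup>+x. (\<Sum>n. ennreal (2 ^ n * p (D n) x)) \<partial>M) \<noteq> \<infinity>" by (auto simp: top_unique)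
    qed
    then have conv: "AE x in M. positive_definite (W x) \<and> convergent (\<lambda>n. X n x)"
      using weight_pos
    proof eventually_elim
      case (elim x)
      have p0: "0 \<le> p (D n) x" for n unfolding p_def by (rule positive_definite_self(2)[OF elim(2)])
      have sp: "summable (\<lambda>n. 2 ^ n * p (D n) x)"
        using elim(1) p0 by (intro summable_suminf_not_top) auto
      obtain c where c: "c > 0" "\<And>v. c * (norm v)\<^sup>2 \<le> Re (sesq v (W x) v)"
        using positive_definite_coercive[OF elim(2)] by blast
      \<comment> \<open>The inequality of the means bounds \<open>norm (D n x)\<close> by
        \<open>(1/2) ^ n\<close> plus \<open>2 ^ n\<close> times its square, and coercivity bounds
        the square by \<open>p (D n) x / c\<close>. Both parts are summable.\<close>
      have "norm (D n x) \<le> (1/2) ^ n + (2 ^ n * p (D n) x) * (1 / c)" for n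
      proof -
        define t where "t = norm (D n x)"
        define e where "e = (2 :: real) ^ n"
        have e: "e > 0" by (simp add: e_def)
        have t2: "t\<^sup>2 \<le> p (D n) x * (1 / c)" using c(1) c(2)[of "D n x"] by (simp add: p_def t_def field_simps)
        have "0 \<le> (e * t - 1)\<^sup>2" by simp
        then have "2 * (t * e) \<le> 1 + (e * t)\<^sup>2" by (simp add: power2_eq_square algebra_simps)
        moreover have "0 \<le> t * e" using e by (simp add: t_def)
        ultimately have "t * e \<le> 1 + (e * t)\<^sup>2" by linarith
        also have "1 + (e * t)\<^sup>2 = (1 / e + e * t\<^sup>2) * e" using e by (simp add: field_simps power2_eq_square)
        finally have "t * e \<le> (1 / e + e * t\<^sup>2) * e" .
        then have "t \<le> 1 / e + e * t\<^sup>2" using e by (simp only: mult_le_cancel_right_pos)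
        also have "\<dots> \<le> 1 / e + e * (p (D n) x * (1 / c))"
          using mult_left_mono[OF t2, of e] e by linarith
        finally show ?thesis by (simp add: e_def t_def power_one_over)
      qed
      then have "summable (\<lambda>n. norm (D n x))"
        by (intro summable_comparison_test'[OF summable_add[OF summable_geometric[of "1/2 :: real"] summable_mult2[OF sp, of "1 / c"]], of 0])
          auto
      then have "summable (\<lambda>n. D n x)" by (rule summable_norm_cancel)
      then have "convergent (\<lambda>n. \<Sum>k<n. D k x)" by (simp add: summable_iff_convergent)
      moreover have "(\<Sum>k<n. D k x) = X n x - X 0 x" for n
        by (induction n) (auto simp: D_def)
      ultimately have "convergent (\<lambda>n. X n x - X 0 x)" by simp
      then have "convergent (\<lambda>n. (X n x - X 0 x) + X 0 x)" by (intro convergent_add convergent_const)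
      then show ?case using elim by simp
    qed
    define l where "l x = lim (\<lambda>n. X n x)" for x
    have lm: "l \<in> borel_measurable M" unfolding l_def[abs_def] using Xm by (rule borel_measurable_lim_metric)
    \<comment> \<open>The geometric sum with its exact remainder; the subtracted term lets the
      induction on \<open>j\<close> close.\<close>
    have nX: "nm (X n - X (n + j)) \<le> 2 * (1/2) ^ n - 2 * (1/2) ^ (n + j)" for n j
    proof (induction j)
      case 0
      show ?case unfolding add_0_right diff_self nm_zero by (rule order_refl)
    next
      case (Suc j)
      have "nm (X n - X (n + Suc j)) \<le> nm (X n - X (n + j)) + nm (X (n + j) - X (n + Suc j))"
        by (rule nm_triangle_diff[OF X X X])
      moreover have "nm (X (n + j) - X (n + Suc j)) \<le> (1/2) ^ (n + j)"
        using inc[of "n + j"] nm_minus_commute[OF X X, of "n + j" "Suc (n + j)"] by simp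
      moreover have "2 * (1/2) ^ (n + Suc j) = (1/2 :: real) ^ (n + j)" by simp
      ultimately show ?case using Suc.IH by linarith
    qed
    have nX': "nm (X n - X (n + j)) \<le> 2 * (1/2) ^ n" for n j
      using nX[of n j] zero_le_power[of "1/2 :: real" "n + j"] by linarith
    have fatou: "(\<integral>\<^sup>+x. ennreal (p (X n - l) x) \<partial>M) \<le> ennreal ((2 * (1/2) ^ n)\<^sup>2)" for n
    proof -
      have "(\<integral>\<^sup>+x. ennreal (p (X n - l) x) \<partial>M) = (\<integral>\<^sup>+x. liminf (\<lambda>j. ennreal (p (X n - X (n + j)) x)) \<partial>M)"
      proof (rule nn_integral_cong_AE)
        show "AE x in M. ennreal (p (X n - l) x) = liminf (\<lambda>j. ennreal (p (X n - X (n + j)) x))"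
          using conv
        proof eventually_elim
          case (elim x)
          have "(\<lambda>j. X j x) \<longlonglongrightarrow> l x" unfolding l_def using elim by (simp add: convergent_LIMSEQ_iff)
          then have "(\<lambda>j. X (j + n) x) \<longlonglongrightarrow> l x" by (rule LIMSEQ_ignore_initial_segment)
          then have "(\<lambda>j. X (n + j) x) \<longlonglongrightarrow> l x" by (simp add: add.commute)
          then have "(\<lambda>j. p (X n - X (n + j)) x) \<longlonglongrightarrow> p (X n - l) x"
            unfolding p_def sesq_sum fun_diff_def by (intro tendsto_intros)
          then have "(\<lambda>j. ennreal (p (X n - X (n + j)) x)) \<longlonglongrightarrow> ennreal (p (X n - l) x)"
            by (rule tendsto_ennrealI)
          then show ?case by (simp add: lim_imp_Liminf)
        qed
      qed
      also have "\<dots> \<le> liminf (\<lambda>j. \<integral>\<^sup>+x. ennreal (p (X n - X (n + j)) x) \<partial>M)"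
      proof (rule nn_integral_liminf)
        show "(\<lambda>x. ennreal (p (X n - X (n + j)) x)) \<in> borel_measurable M" for j
          using p_meas[OF L2W_measurable[OF H_diff[OF X X]]] by measurable
      qed
      also have "\<dots> \<le> liminf (\<lambda>j :: nat. ennreal ((2 * (1/2) ^ n)\<^sup>2))"
      proof (rule Liminf_mono, rule always_eventually, rule allI)
        fix j
        have "(nm (X n - X (n + j)))\<^sup>2 \<le> (2 * (1/2) ^ n)\<^sup>2"
          by (rule power_mono[OF nX' nm_nonneg[OF H_diff[OF X X]]])
        then show "(\<integral>\<^sup>+x. ennreal (p (X n - X (n + j)) x) \<partial>M) \<le> ennreal ((2 * (1/2) ^ n)\<^sup>2)"
          unfolding p_nn[OF H_diff[OF X X]] by (rule ennreal_leI)
      qed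
      also have "\<dots> = ennreal ((2 * (1/2) ^ n)\<^sup>2)" by (simp add: Liminf_const)
      finally show ?thesis .
    qed
    have dL: "X n - l \<in> L2" for n
    proof (rule L2W_I)
      show "X n - l \<in> borel_measurable M" unfolding fun_diff_def using Xm lm by measurable
      show "(\<integral>\<^sup>+x. ennreal (Re (sesq ((X n - l) x) (W x) ((X n - l) x))) \<partial>M) < \<infinity>"
        using fatou[of n] unfolding p_def by (rule le_less_trans) simp
    qed
    have "l = X 0 - (X 0 - l)" by simp
    then have lL: "l \<in> L2" using H_diff[OF X dL] by metis
    have up: "nm (X n - l) \<le> 2 * (1/2) ^ n" for n
    proof (rule power2_le_imp_le)
      have "ennreal ((nm (X n - l))\<^sup>2) \<le> ennreal ((2 * (1/2) ^ n)\<^sup>2)"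
        using fatou[of n] unfolding p_nn[OF dL] .
      then show "(nm (X n - l))\<^sup>2 \<le> (2 * (1/2) ^ n)\<^sup>2" by (simp add: ennreal_le_iff)
    qed simp
    have "(\<lambda>n. 2 * (1/2 :: real) ^ n) \<longlonglongrightarrow> 2 * 0"
      by (intro tendsto_mult tendsto_const LIMSEQ_realpow_zero) auto
    then have lim: "(\<lambda>n. 2 * (1/2 :: real) ^ n) \<longlonglongrightarrow> 0" by (simp only: mult_zero_right)
    have "(\<lambda>n. nm (X n - l)) \<longlonglongrightarrow> 0"
    proof (rule real_tendsto_sandwich[OF _ _ tendsto_const lim])
      show "\<forall>\<^sub>F n in sequentially. 0 \<le> nm (X n - l)"
        by (rule always_eventually, rule allI, rule nm_nonneg[OF dL])
      show "\<forall>\<^sub>F n in sequentially. nm (X n - l) \<le> 2 * (1/2) ^ n"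
        by (rule always_eventually, rule allI, rule up)
    qed
    then show ?thesis using lL by blast
  qed
  then show ?thesis using pre_hilbert_L2W by (simp add: semi_hilbert_def semi_hilbert_axioms_def)
qed

end

section \<open>Quasi-derivatives and first-order systems\<close>

text \<open>Completeness of Lebesgue measure: the part of a preimage inside the exceptional null set
  is measurable.\<close>

lemma borel_measurable_lebesgue_on_AE:
  assumes f: "f \<in> borel_measurable (lebesgue_on {a..b::real})" and e: "AE x in lebesgue_on {a..b}. f x = g x"
  shows "g \<in> borel_measurable (lebesgue_on {a..b})"
proof (rule measurableI)
  obtain N where N: "negligible N" "\<And>x. x \<in> {a..b} - N \<Longrightarrow> f x = g x"
    using e unfolding AE_lebesgue_on_iff_negligible by blast
  fix B :: "'a set" assume B: "B \<in> sets borel"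
  have "f -` B \<inter> {a..b} \<in> sets lebesgue"
    using measurable_sets[OF f B] by (simp add: sets_restrict_space_iff)
  moreover have "N \<in> sets lebesgue" using N(1) negligible_iff_null_sets by blast
  moreover have "g -` B \<inter> {a..b} \<inter> N \<in> sets lebesgue"
    using negligible_subset[OF N(1), of "g -` B \<inter> {a..b} \<inter> N"] negligible_iff_null_sets by blast
  ultimately have "(f -` B \<inter> {a..b} - N) \<union> (g -` B \<inter> {a..b} \<inter> N) \<in> sets lebesgue" by blast
  also have "(f -` B \<inter> {a..b} - N) \<union> (g -` B \<inter> {a..b} \<inter> N) = g -` B \<inter> {a..b}" using N(2) by auto
  finally show "g -` B \<inter> space (lebesgue_on {a..b}) \<in> sets (lebesgue_on {a..b})"
    by (simp add: sets_restrict_space_iff)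
qed simp

lemma ae_eq_refl: "ae_eq a b f f"
  by (simp add: ae_eq_def)

lemma ae_eq_sym: "ae_eq a b f g \<Longrightarrow> ae_eq a b g f"
  unfolding ae_eq_def by (auto elim: eventually_mono)

lemma ae_eq_trans: "ae_eq a b f g \<Longrightarrow> ae_eq a b g h \<Longrightarrow> ae_eq a b f h"
  unfolding ae_eq_def by (auto elim: eventually_elim2)

text \<open>If they differed at a point, they would differ on an interval of positive length. This
  makes the point values of a class independent of the choice in \<open>AC_rep\<close>.\<close>

lemma continuous_ae_eq_imp_eq:
  fixes f g :: "real \<Rightarrow> 'v::real_normed_vector"
  assumes ab: "a < b" and f: "continuous_on {a..b} f" and g: "continuous_on {a..b} g"
    and e: "ae_eq a b f g" and x: "x \<in> {a..b}"
  shows "f x = g x"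
proof (rule ccontr)
  assume ne: "f x \<noteq> g x"
  obtain N where N: "negligible N" "\<And>x. x \<in> {a..b} - N \<Longrightarrow> f x = g x"
    using e unfolding ae_eq_def AE_lebesgue_on_iff_negligible by blast
  define h where "h x = norm (f x - g x)" for x
  have "continuous_on {a..b} h" unfolding h_def by (intro continuous_intros f g)
  moreover have "0 < h x" using ne by (simp add: h_def)
  ultimately obtain d where d: "d > 0" "\<And>y. y \<in> {a..b} \<Longrightarrow> dist y x < d \<Longrightarrow> dist (h y) (h x) < h x"
    using x unfolding continuous_on_iff by blast
  define s where "s = max a (x - d / 2)"
  define t where "t = min b (x + d / 2)"
  have st: "s < t" "{s<..<t} \<subseteq> {a..b}" using ab x d(1) by (auto simp: s_def t_def)
  have "{s<..<t} \<subseteq> N"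
  proof
    fix y assume y: "y \<in> {s<..<t}"
    then have "dist y x < d" using d(1) by (auto simp: s_def t_def dist_real_def)
    then have "dist (h y) (h x) < h x" using d(2) y st(2) by blast
    then have "h y \<noteq> 0" by (auto simp: dist_real_def)
    then have "f y \<noteq> g y" by (auto simp: h_def)
    then show "y \<in> N" using N(2) y st(2) by blast
  qed
  then have "negligible {s<..<t}" by (rule negligible_subset[OF N(1)])
  then show False using st(1) open_not_negligible[of "{s<..<t}"] by auto
qed

text \<open>Lets any known primitive in the class stand in for the representative chosen by
  \<open>SOME\<close>, since continuous representatives agree on the interval.\<close>

lemma AC_rep_primitive:
  fixes Y :: "real \<Rightarrow> 'v::euclidean_space"
  assumes ab: "a < b" and prim: "primitive_on a b Y h" and e: "ae_eq a b q Y"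
  shows "in_AC a b q" "x \<in> {a..b} \<Longrightarrow> AC_rep a b q x = Y x" "ae_eq a b (AC_deriv a b q) h"
proof -
  have Yac: "abs_cont_on a b Y" using primitive_imp_abs_cont_on[OF prim] ab by simp
  then show in_AC: "in_AC a b q" using e unfolding in_AC_def by blast
  define r where "r = AC_rep a b q"
  have r: "abs_cont_on a b r" "ae_eq a b q r"
    using someI_ex[OF in_AC[unfolded in_AC_def]] unfolding r_def AC_rep_def by auto
  have eq: "r x = Y x" if "x \<in> {a..b}" for x
    by (rule continuous_ae_eq_imp_eq[OF ab abs_cont_on_imp_continuous_on[OF r(1)] abs_cont_on_imp_continuous_on[OF Yac]
      ae_eq_trans[OF ae_eq_sym[OF r(2)] e] that])
  then show "x \<in> {a..b} \<Longrightarrow> AC_rep a b q x = Y x" by (simp add: r_def)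
  have "primitive_on a b r h"
  proof (rule primitive_onI)
    show "h absolutely_integrable_on {a..b}" by (rule primitive_onD(1)[OF prim])
    fix x assume x: "x \<in> {a..b}"
    have "a \<in> {a..b}" using ab by simp
    then show "r x = r a + integral {a..x} h" using eq x primitive_onD(2)[OF prim x] by metis
  qed
  from primitive_on_has_vector_derivative[OF this]
  show "ae_eq a b (AC_deriv a b q) h"
    unfolding ae_eq_def AC_deriv_def r_def[symmetric]
  proof eventually_elim
    case (elim x)
    have "at x within {a..b} \<noteq> bot" using elim by (simp add: at_within_Icc_at)
    then show ?case using elim vector_derivative_within by blast
  qed
qed

lemma in_AC_obtain:
  fixes q :: "real \<Rightarrow> 'v::euclidean_space"
  assumes ab: "a < b" and q: "in_AC a b q"
  shows "ae_eq a b q (AC_rep a b q)" "primitive_on a b (AC_rep a b q) (AC_deriv a b q)"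
proof -
  have r: "abs_cont_on a b (AC_rep a b q)" "ae_eq a b q (AC_rep a b q)"
    using someI_ex[OF q[unfolded in_AC_def]] unfolding AC_rep_def by auto
  then show "ae_eq a b q (AC_rep a b q)" by simp
  obtain h where h: "primitive_on a b (AC_rep a b q) h" using abs_cont_on_primitive[OF r(1) ab] by blast
  show "primitive_on a b (AC_rep a b q) (AC_deriv a b q)"
    by (rule primitive_on_AE_eq[OF h AC_rep_primitive(3)[OF ab h r(2), unfolded ae_eq_def]])
qed

lemma matrix_inv_mult_vec:
  fixes A :: "complex^'m::finite^'m"
  assumes "invertible A"
  shows "matrix_inv A *v (A *v x) = x" "A *v (matrix_inv A *v x) = x"
  using someI_ex[OF assms[unfolded invertible_def]] by (simp_all add: matrix_inv_def matrix_vector_mul_assoc)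

lemma positive_definite_invertible:
  fixes A :: "complex^'m::finite^'m"
  assumes "positive_definite A"
  shows "invertible A"
proof -
  have "v = 0" if "A *v v = 0" for v
  proof (rule ccontr)
    assume "v \<noteq> 0"
    then have "0 < sesq v A v" using assms by (simp add: positive_definite_def)
    then show False using that by (simp add: sesq_def)
  qed
  then show ?thesis using invertible_left_inverse matrix_left_invertible_ker by blast
qed

lemma bilinear_sesq: "bilinear (\<lambda>v w :: complex^'m::finite. sesq v A w)"
  unfolding bilinear_def
  by (auto intro!: linearI simp: sesq_add_left sesq_add_right)
    (auto simp: sesq_sum scaleR_sum_right)

lemma bounded_linear_smult: "bounded_linear (\<lambda>v :: complex^'m::finite. c *s v)"
proof -
  have "linear (\<lambda>v :: complex^'m. c *s v)"
    by (rule linearI) (auto simp: vec_eq_iff algebra_simps)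
  then show ?thesis by (simp add: linear_conv_bounded_linear)
qed

section \<open>The differential equation as a first-order system\<close>

locale quasi_diff =
  fixes a b :: real and N :: nat
    and W :: "real \<Rightarrow> complex ^ 'm::finite ^ 'm" and Z :: "nat \<Rightarrow> nat \<Rightarrow> real \<Rightarrow> complex ^ 'm ^ 'm"
  assumes standing: "standing_hypothesis a b N W Z"
begin

lemma ab: "a < b" and N: "1 \<le> N"
  and W_integrable: "integrable (lebesgue_on {a..b}) W"
  and W_pos: "AE x in lebesgue_on {a..b}. positive_definite (W x)"
  and Z_integrable: "j \<in> {1..2*N} \<Longrightarrow> k \<in> {1..2*N} \<Longrightarrow> integrable (lebesgue_on {a..b}) (Z j k)"
  and Z_invertible: "1 \<le> j \<Longrightarrow> j \<le> 2*N - 1 \<Longrightarrow> AE x in lebesgue_on {a..b}. invertible (Z j (j+1) x)"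
  and Z_zero: "2 \<le> j + 1 \<Longrightarrow> j + 1 < k \<Longrightarrow> k \<le> 2*N \<Longrightarrow> ae_eq a b (Z j k) (\<lambda>x. 0)"
  and Z_sym: "j \<in> {1..2*N} \<Longrightarrow> k \<in> {1..2*N} \<Longrightarrow> ae_eq a b (Z j k)
          (\<lambda>x. bmat_mult (2*N) (J_mat (2*N))
                 (bmat_mult (2*N) (bmat_hermitian_transpose (\<lambda>j k. Z j k x)) (J_mat (2*N))) j k)"
  using standing unfolding standing_hypothesis_def by blast+

lemma Z_abs: "j \<in> {1..2*N} \<Longrightarrow> k \<in> {1..2*N} \<Longrightarrow> Z j k absolutely_integrable_on {a..b}"
  using Z_integrable integrable_lebesgue_on_iff by blast

sublocale weighted_L2 a b W
  by unfold_locales (rule W_integrable, rule W_pos)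

sublocale semi_hilbert "\<lambda>c (f :: real \<Rightarrow> complex^'m) x. c *s f x" "L2W a b W" "inner_W a b W"
  by (rule semi_hilbert_L2W)

lemma L2W_ae_eq:
  assumes "f \<in> L2W a b W" "ae_eq a b f f'"
  shows "f' \<in> L2W a b W"
proof -
  have m: "f' \<in> borel_measurable (lebesgue_on {a..b})"
    using borel_measurable_lebesgue_on_AE[of f a b f'] assms unfolding ae_eq_def L2W_def by blast
  have "integrable (lebesgue_on {a..b}) (\<lambda>x. sesq (f' x) (W x) (f' x)) \<longleftrightarrow> integrable (lebesgue_on {a..b}) (\<lambda>x. sesq (f x) (W x) (f x))"
  proof (rule integrable_cong_AE)
    show "AE x in lebesgue_on {a..b}. sesq (f' x) (W x) (f' x) = sesq (f x) (W x) (f x)"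
      using assms(2) unfolding ae_eq_def by eventually_elim simp
  qed (use m assms(1) W_integrable in \<open>auto intro!: borel_measurable_sesq simp: L2W_def\<close>)
  then show ?thesis using m assms(1) by (simp add: L2W_def)
qed

text \<open>The integrand of the squared seminorm is nonnegative a.e., and positive definiteness of
  the weight makes it vanish only where the functions agree.\<close>

lemma eqv_iff_ae_eq:
  assumes "f \<in> L2W a b W" "g \<in> L2W a b W"
  shows "eqv f g \<longleftrightarrow> ae_eq a b f g"
proof -
  have d: "f - g \<in> L2W a b W" by (rule H_diff[OF assms])
  define p where "p x = Re (sesq ((f - g) x) (W x) ((f - g) x))" for x
  have i: "integrable (lebesgue_on {a..b}) (\<lambda>x. sesq ((f - g) x) (W x) ((f - g) x))" using d by (simp add: L2W_def)
  have pi: "integrable (lebesgue_on {a..b}) p" using i unfolding p_def by auto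
  have p0: "AE x in lebesgue_on {a..b}. 0 \<le> p x"
    using W_pos unfolding p_def by eventually_elim (rule positive_definite_self(2))
  have "eqv f g \<longleftrightarrow> Re (inner_W a b W (f - g) (f - g)) = 0" by (simp add: eqv_def nm_def)
  also have "Re (inner_W a b W (f - g) (f - g)) = integral\<^sup>L (lebesgue_on {a..b}) p"
    using i unfolding inner_W_def p_def by simp
  also have "\<dots> = 0 \<longleftrightarrow> (AE x in lebesgue_on {a..b}. p x = 0)"
    by (rule integral_nonneg_eq_0_iff_AE[OF pi p0])
  also have "\<dots> \<longleftrightarrow> ae_eq a b f g"
  proof
    assume "AE x in lebesgue_on {a..b}. p x = 0"
    then show "ae_eq a b f g" unfolding ae_eq_def using W_pos
    proof eventually_elim
      case (elim x)
      show ?case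
      proof (rule ccontr)
        assume "f x \<noteq> g x"
        then have "(f - g) x \<noteq> 0" by simp
        then have "0 < sesq ((f - g) x) (W x) ((f - g) x)" using elim(2) unfolding positive_definite_def by blast
        then show False using elim(1) by (simp add: p_def less_complex_def)
      qed
    qed
  next
    assume "ae_eq a b f g"
    then show "AE x in lebesgue_on {a..b}. p x = 0"
      unfolding ae_eq_def p_def by eventually_elim (simp add: sesq_sum)
  qed
  finally show ?thesis .
qed

lemma continuous_in_L2W:
  assumes Y: "continuous_on {a..b} Y"
  shows "Y \<in> L2W a b W"
proof -
  have m: "Y \<in> borel_measurable (lebesgue_on {a..b})"
    by (rule continuous_imp_measurable_on_sets_lebesgue[OF Y]) auto
  have "(\<lambda>x. sesq (Y x) (mat 1) (W x *v Y x)) absolutely_integrable_on {a..b}"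
  proof (rule absolutely_integrable_bounded_measurable_product[where h = "\<lambda>v w. sesq v (mat 1) w"])
    show "bilinear (\<lambda>v w :: complex^'m. sesq v (mat 1) w)"
      by (rule bilinear_sesq)
    show "bounded (Y ` {a..b})" using Y by (intro compact_imp_bounded compact_continuous_image) auto
    show "(\<lambda>x. W x *v Y x) absolutely_integrable_on {a..b}"
      using W_integrable integrable_lebesgue_on_iff Y by (intro absolutely_integrable_continuous_matrix_mult) auto
  qed (use m in auto)
  moreover have "sesq v (mat 1) (A *v u) = sesq v A u" for v u :: "complex^'m" and A by (simp add: sesq_def)
  ultimately show ?thesis using m by (simp add: L2W_def integrable_lebesgue_on_iff[symmetric])
qed

text \<open>Each entry is the integrand of an inner product of \<open>g\<close> with a constant
  vector, and constants belong to the space because the weight is integrable. So the inhomogeneity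
  of the system is integrable.\<close>

lemma W_mult_absolutely_integrable:
  assumes g: "g \<in> L2W a b W"
  shows "(\<lambda>x. W x *v g x) absolutely_integrable_on {a..b}"
proof (rule absolutely_integrable_componentwise)
  fix e :: "complex^'m" assume "e \<in> Basis"
  then obtain i u where e: "e = axis i u" by (auto simp: Basis_vec_def)
  have "(\<lambda>x. axis i (1::complex)) \<in> L2W a b W" by (intro continuous_in_L2W continuous_intros)
  from integrable_sesq[OF g this]
  have "(\<lambda>x. sesq (axis i 1) (W x) (g x)) absolutely_integrable_on {a..b}" by (simp add: integrable_lebesgue_on_iff)
  moreover have "sesq (axis i 1) A v = (A *v v) $ i" for A :: "complex^'m^'m" and v
    unfolding sesq_def axis_def by (simp add: if_distrib[of cnj] if_distrib[of "\<lambda>z. z * _"] cong: if_cong)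
  ultimately have "(\<lambda>x. (W x *v g x) $ i) absolutely_integrable_on {a..b}" by simp
  then have "((\<lambda>z. z \<bullet> u) \<circ> (\<lambda>x. (W x *v g x) $ i)) absolutely_integrable_on {a..b}"
    by (rule absolutely_integrable_linear) (rule bounded_linear_inner_left)
  then show "(\<lambda>x. (W x *v g x) \<bullet> e) absolutely_integrable_on {a..b}" by (simp add: e inner_axis o_def)
qed

text \<open>The inhomogeneity of the system: the equation with right side \<open>g\<close> says that
  the quasi-derivative of order \<open>2*N\<close> is \<open>(-1)^N W g\<close>, and this enters
  only the last row.\<close>

definition force :: "(real \<Rightarrow> complex^'m) \<Rightarrow> nat \<Rightarrow> real \<Rightarrow> complex^'m" where
  "force g j x = (if j = 2*N then (-1) ^ N *s (W x *v g x) else 0)"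

text \<open>\<open>Y j\<close> stands for the quasi-derivative of order \<open>j - 1\<close>; the
  index is shifted to match the rows of \<open>Z\<close>.\<close>

definition sol :: "(nat \<Rightarrow> real \<Rightarrow> complex^'m) \<Rightarrow> (real \<Rightarrow> complex^'m) \<Rightarrow> bool" where
  "sol Y g \<longleftrightarrow> (\<forall>j\<in>{1..2*N}. primitive_on a b (Y j) (lin_rhs (2*N) Z (force g) Y j))"

lemma solD: "sol Y g \<Longrightarrow> j \<in> {1..2*N} \<Longrightarrow> primitive_on a b (Y j) (lin_rhs (2*N) Z (force g) Y j)"
  by (simp add: sol_def)

lemma sol_continuous: "sol Y g \<Longrightarrow> j \<in> {1..2*N} \<Longrightarrow> continuous_on {a..b} (Y j)"
  using primitive_imp_abs_cont_on[OF solD] abs_cont_on_imp_continuous_on ab by (metis less_imp_le)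

lemma smult_absolutely_integrable:
  fixes f :: "real \<Rightarrow> complex^'m"
  assumes "f absolutely_integrable_on S"
  shows "(\<lambda>x. c *s f x) absolutely_integrable_on S"
  using absolutely_integrable_linear[OF assms bounded_linear_smult] by (simp add: o_def)

lemma force_absolutely_integrable:
  assumes "g \<in> L2W a b W"
  shows "force g j absolutely_integrable_on {a..b}"
  using smult_absolutely_integrable[OF W_mult_absolutely_integrable[OF assms], of "(-1) ^ N"]
  unfolding force_def [abs_def] by (cases "j = 2*N") simp_all

lemma sol_exists:
  assumes "g \<in> L2W a b W" "x0 = a \<or> x0 = b"
  shows "\<exists>Y. sol Y g \<and> (\<forall>j\<in>{1..2*N}. Y j x0 = c j)"
proof -
  have "\<exists>Y. \<forall>j\<in>{1..2*N}. primitive_on a b (Y j) (lin_rhs (2*N) Z (force g) Y j) \<and> Y j x0 = c j"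
    by (rule linear_ode_exists[OF _ _ ab assms(2)])
      (use Z_abs force_absolutely_integrable[OF assms(1)] in blast)+
  then show ?thesis unfolding sol_def by blast
qed

lemma Z_row_AE:
  assumes "j \<in> {1..2*N}"
  shows "AE x in lebesgue_on {a..b}. \<forall>k\<in>{1..2*N}. j + 1 < k \<longrightarrow> Z j k x = 0"
proof (rule AE_finite_allI)
  fix k assume "k \<in> {1..2*N}"
  then show "AE x in lebesgue_on {a..b}. j + 1 < k \<longrightarrow> Z j k x = 0"
    using Z_zero[of j k] assms by (cases "j + 1 < k") (auto simp: ae_eq_def)
qed simp

text \<open>Rows of \<open>Z\<close> end at the superdiagonal. In the last row the superdiagonal
  entry is the conventional identity, which is not a column of \<open>Z\<close>, hence the separate
  case.\<close>

lemma row_sum: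
  assumes j: "j \<in> {1..2*N}" and z: "\<forall>k\<in>{1..2*N}. j + 1 < k \<longrightarrow> Z j k x = 0"
  shows "(\<Sum>k=1..2*N. Z j k x *v y k) = (\<Sum>k=1..j. Z j k x *v y k) + (if j = 2*N then 0 else Z j (j+1) x *v y (j+1))"
proof -
  have "(\<Sum>k=1..2*N. Z j k x *v y k) = (\<Sum>k\<in>{1..2*N} \<inter> {..j+1}. Z j k x *v y k)"
    by (rule sum.mono_neutral_right) (use z in auto)
  also have "\<dots> = (\<Sum>k=1..j. Z j k x *v y k) + (if j = 2*N then 0 else Z j (j+1) x *v y (j+1))"
  proof (cases "j = 2*N")
    case True
    then have "{1..2*N} \<inter> {..j+1} = {1..j}" by auto
    then show ?thesis using True by simp
  next
    case False
    then have "{1..2*N} \<inter> {..j+1} = {1..Suc j}" using j by auto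
    then show ?thesis using False by simp
  qed
  finally show ?thesis .
qed


abbreviation qd :: "(real \<Rightarrow> complex^'m) \<Rightarrow> nat \<Rightarrow> real \<Rightarrow> complex^'m" where
  "qd f j \<equiv> quasi_deriv a b N Z f j"

abbreviation Hmax where "Hmax \<equiv> H_max a b N W Z"
abbreviation Hmin where "Hmin \<equiv> H_min a b N W Z"

lemma quasi_dom_iff:
  "f \<in> quasi_dom a b N Z n \<longleftrightarrow> f \<in> borel_measurable (lebesgue_on {a..b}) \<and> (\<forall>j<n. in_AC a b (qd f j))"
  by (induction n) (auto simp: less_Suc_eq)

lemma Z_super_invertible:
  assumes "j \<in> {1..2*N}"
  shows "AE x in lebesgue_on {a..b}. invertible (Z_super N Z j x)"
proof (cases "j = 2*N")
  case True
  have "invertible (mat 1 :: complex^'m^'m)" unfolding invertible_def by (rule exI[of _ "mat 1"]) simp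
  then show ?thesis using True by (simp add: Z_super_def)
next
  case False
  then have "1 \<le> j" "j \<le> 2*N - 1" using assms by auto
  then show ?thesis using Z_invertible False by (simp add: Z_super_def)
qed

lemma qd_pos: "1 \<le> j \<Longrightarrow> qd f j x = matrix_inv (Z_super N Z j x) *v
    (AC_deriv a b (qd f (j - 1)) x - (\<Sum>k=1..j. Z j k x *v qd f (k - 1) x))"
  by (cases j) simp_all

text \<open>Multiplying the definition of the quasi-derivatives by \<open>Z_super\<close> turns the
  recursion into the rows of the system; the last row is the equation itself.\<close>

lemma H_max_imp_sol:
  assumes fg: "(f, g) \<in> Hmax"
  defines "Y \<equiv> \<lambda>j. quasi_deriv_at a b N Z f (j - 1)"
  shows "f \<in> L2W a b W" "g \<in> L2W a b W" "sol Y g" "ae_eq a b f (Y 1)"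
proof -
  have f: "f \<in> L2W a b W" "f \<in> quasi_dom a b N Z (2*N)" "quasi_diff_expr a b N W Z f \<in> L2W a b W"
    and g: "ae_eq a b g (quasi_diff_expr a b N W Z f)"
    using fg by (auto simp: H_max_def graph_of_def dom_max_def)
  show "f \<in> L2W a b W" by (rule f(1))
  show "g \<in> L2W a b W" by (rule L2W_ae_eq[OF f(3) ae_eq_sym[OF g]])
  have AC: "in_AC a b (qd f (j - 1))" if "j \<in> {1..2*N}" for j
    using f(2) that unfolding quasi_dom_iff by auto
  have qY: "ae_eq a b (qd f (j - 1)) (Y j)" and pr: "primitive_on a b (Y j) (AC_deriv a b (qd f (j - 1)))"
    if "j \<in> {1..2*N}" for j
    using in_AC_obtain[OF ab AC[OF that]] by (simp_all add: Y_def quasi_deriv_at_def)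
  show "ae_eq a b f (Y 1)" using qY[of 1] N by simp
  have qall: "AE x in lebesgue_on {a..b}. \<forall>k\<in>{1..2*N}. qd f (k - 1) x = Y k x"
    by (rule AE_finite_allI) (use qY in \<open>auto simp: ae_eq_def\<close>)
  show "sol Y g" unfolding sol_def
  proof
    fix j assume j: "j \<in> {1..2*N}"
    show "primitive_on a b (Y j) (lin_rhs (2*N) Z (force g) Y j)"
    proof (rule primitive_on_AE_eq[OF pr[OF j]])
      show "AE x in lebesgue_on {a..b}. lin_rhs (2*N) Z (force g) Y j x = AC_deriv a b (qd f (j - 1)) x"
        using qall Z_row_AE[OF j] Z_super_invertible[OF j] W_pos g[unfolded ae_eq_def]
      proof eventually_elim
        case (elim x)
        let ?D = "AC_deriv a b (qd f (j - 1)) x"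
        let ?S = "Z_super N Z j x"
        have "qd f j x = matrix_inv ?S *v (?D - (\<Sum>k=1..j. Z j k x *v qd f (k - 1) x))"
          using j by (intro qd_pos) auto
        then have "?S *v qd f j x = ?D - (\<Sum>k=1..j. Z j k x *v qd f (k - 1) x)"
          using matrix_inv_mult_vec(2)[OF elim(3)] by simp
        moreover have "(\<Sum>k=1..j. Z j k x *v qd f (k - 1) x) = (\<Sum>k=1..j. Z j k x *v Y k x)"
          using elim(1) j by (intro sum.cong) auto
        ultimately have D: "?D = (\<Sum>k=1..j. Z j k x *v Y k x) + ?S *v qd f j x" by simp
        show ?case
        proof (cases "j = 2*N")
          case True
          have "g x = (-1) ^ N *s (matrix_inv (W x) *v qd f (2*N) x)"
            using elim(5) by (simp add: quasi_diff_expr_def)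
          then have "W x *v g x = (-1) ^ N *s (W x *v (matrix_inv (W x) *v qd f (2*N) x))"
            by (simp only: vector_scalar_commute)
          then have "W x *v g x = (-1) ^ N *s qd f (2*N) x"
            using matrix_inv_mult_vec(2)[OF positive_definite_invertible[OF elim(4)]] by simp
          then have "(-1) ^ N *s (W x *v g x) = qd f (2*N) x"
            by (simp add: vector_smult_assoc power_add[symmetric] mult_2[symmetric])
          then show ?thesis using True D row_sum[OF j elim(2), of "\<lambda>k. Y k x"]
            by (simp add: lin_rhs_def force_def Z_super_def)
        next
          case False
          then have "qd f j x = Y (j + 1) x" using bspec[OF elim(1), of "j + 1"] j by simp
          then show ?thesis using False D row_sum[OF j elim(2), of "\<lambda>k. Y k x"]
            by (simp add: lin_rhs_def force_def Z_super_def)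
        qed
      qed
    qed
  qed
qed

text \<open>The converse direction: once the lower quasi-derivatives are identified, inverting the
  superdiagonal entry of row \<open>j\<close> yields the next one.\<close>

lemma sol_quasi_deriv_step:
  assumes Y: "sol Y g" and j: "j \<in> {1..2*N}" and q: "\<And>k. k \<in> {1..j} \<Longrightarrow> ae_eq a b (qd f (k - 1)) (Y k)"
  shows "ae_eq a b (qd f j) (\<lambda>x. if j = 2*N then (-1) ^ N *s (W x *v g x) else Y (j + 1) x)"
proof -
  have qall: "AE x in lebesgue_on {a..b}. \<forall>k\<in>{1..j}. qd f (k - 1) x = Y k x"
    by (rule AE_finite_allI) (use q in \<open>auto simp: ae_eq_def\<close>)
  have "ae_eq a b (AC_deriv a b (qd f (j - 1))) (lin_rhs (2*N) Z (force g) Y j)"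
    by (rule AC_rep_primitive(3)[OF ab solD[OF Y j] q]) (use j in auto)
  then show ?thesis
    unfolding ae_eq_def using qall Z_row_AE[OF j] Z_super_invertible[OF j]
  proof eventually_elim
    case (elim x)
    have "(\<Sum>k=1..j. Z j k x *v qd f (k - 1) x) = (\<Sum>k=1..j. Z j k x *v Y k x)"
      using elim(2) by (intro sum.cong) auto
    then have "AC_deriv a b (qd f (j - 1)) x - (\<Sum>k=1..j. Z j k x *v qd f (k - 1) x)
        = Z_super N Z j x *v (if j = 2*N then (-1) ^ N *s (W x *v g x) else Y (j + 1) x)"
      using elim(1) row_sum[OF j elim(3), of "\<lambda>k. Y k x"] by (auto simp: lin_rhs_def force_def Z_super_def)
    then show ?case using qd_pos[of j f x] j matrix_inv_mult_vec(1)[OF elim(4)] by simp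
  qed
qed

lemma sol_quasi_deriv:
  assumes Y: "sol Y g" and f: "ae_eq a b f (Y 1)" and j: "j \<in> {1..2*N}"
  shows "ae_eq a b (qd f (j - 1)) (Y j)"
  using j
proof (induction j rule: less_induct)
  case (less j)
  show ?case
  proof (cases "j = 1")
    case True
    then show ?thesis using f by simp
  next
    case False
    then have j': "j - 1 \<in> {1..2*N}" "j - 1 \<noteq> 2*N" using less.prems by auto
    have "ae_eq a b (qd f (k - 1)) (Y k)" if "k \<in> {1..j - 1}" for k
      using that less.prems by (intro less.IH) auto
    from sol_quasi_deriv_step[OF Y j'(1) this] show ?thesis using j' less.prems by simp
  qed
qed

text \<open>Solutions of the system are continuous, hence square integrable. Solving it with
  prescribed data thus produces elements of the maximal operator with known boundary values.\<close>

lemma sol_imp_H_max: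
  assumes g: "g \<in> L2W a b W" and Y: "sol Y g" and f: "ae_eq a b f (Y 1)"
  shows "(f, g) \<in> Hmax"
    and "j \<in> {1..2*N} \<Longrightarrow> x \<in> {a..b} \<Longrightarrow> quasi_deriv_at a b N Z f (j - 1) x = Y j x"
proof -
  have Y1: "Y 1 \<in> L2W a b W" using N by (intro continuous_in_L2W sol_continuous[OF Y]) auto
  have fL: "f \<in> L2W a b W" by (rule L2W_ae_eq[OF Y1 ae_eq_sym[OF f]])
  note rep = AC_rep_primitive[OF ab solD[OF Y] sol_quasi_deriv[OF Y f]]
  show "j \<in> {1..2*N} \<Longrightarrow> x \<in> {a..b} \<Longrightarrow> quasi_deriv_at a b N Z f (j - 1) x = Y j x"
    unfolding quasi_deriv_at_def by (rule rep(2))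
  have "in_AC a b (qd f j)" if "j < 2*N" for j
  proof -
    have j: "j + 1 \<in> {1..2*N}" using that by simp
    show ?thesis using rep(1)[OF j j] by simp
  qed
  then have dom: "f \<in> quasi_dom a b N Z (2*N)" using fL unfolding quasi_dom_iff by (simp add: L2W_def)
  have "2*N \<in> {1..2*N}" using N by simp
  from sol_quasi_deriv_step[OF Y this sol_quasi_deriv[OF Y f]]
  have "ae_eq a b (qd f (2*N)) (\<lambda>x. (-1) ^ N *s (W x *v g x))" by simp
  then have tau: "ae_eq a b g (quasi_diff_expr a b N W Z f)"
    unfolding ae_eq_def using W_pos
  proof eventually_elim
    case (elim x)
    show ?case unfolding quasi_diff_expr_def elim(1) vector_scalar_commute
      using matrix_inv_mult_vec(1)[OF positive_definite_invertible[OF elim(2)]]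
      by (simp add: vector_smult_assoc power_add[symmetric] mult_2[symmetric])
  qed
  have "quasi_diff_expr a b N W Z f \<in> L2W a b W" by (rule L2W_ae_eq[OF g tau])
  then show "(f, g) \<in> Hmax" using fL dom tau by (simp add: H_max_def graph_of_def dom_max_def)
qed

section \<open>Green's formula\<close>

definition cdot :: "complex^'m \<Rightarrow> complex^'m \<Rightarrow> complex" where "cdot v w = sesq v (mat 1) w"

lemma cdot_sum: "cdot v w = (\<Sum>i\<in>UNIV. cnj (v $ i) * w $ i)"
  by (simp add: cdot_def sesq_def)

lemma bounded_bilinear_cdot: "bounded_bilinear cdot"
  using bilinear_sesq[of "mat 1"] by (simp add: cdot_def[abs_def] bilinear_conv_bounded_bilinear)

lemma cdot_sum_right: "cdot v (\<Sum>k\<in>K. w k) = (\<Sum>k\<in>K. cdot v (w k))"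
  by (rule bounded_bilinear.sum_right[OF bounded_bilinear_cdot])

lemma cdot_sum_left: "cdot (\<Sum>k\<in>K. w k) v = (\<Sum>k\<in>K. cdot (w k) v)"
  by (rule bounded_bilinear.sum_left[OF bounded_bilinear_cdot])

lemma cdot_smult_right: "cdot v (c *s w) = c * cdot v w"
  by (simp add: cdot_def sesq_sc_right)

lemma cdot_smult_left: "cdot (c *s v) w = cnj c * cdot v w"
  by (simp add: cdot_def sesq_sc_left)

lemma cdot_adjoint: "cdot (A *v v) y = cdot v (hermitian_transpose A *v y)"
proof -
  have "cdot (A *v v) y = (\<Sum>i\<in>UNIV. \<Sum>j\<in>UNIV. cnj (A $ i $ j) * cnj (v $ j) * y $ i)"
    by (simp add: cdot_sum matrix_vector_mult_def sum_distrib_right)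
  also have "\<dots> = (\<Sum>j\<in>UNIV. \<Sum>i\<in>UNIV. cnj (A $ i $ j) * cnj (v $ j) * y $ i)" by (rule sum.swap)
  also have "\<dots> = cdot v (hermitian_transpose A *v y)"
    by (simp add: cdot_sum matrix_vector_mult_def hermitian_transpose_def sum_distrib_left mult_ac)
  finally show ?thesis .
qed

lemma mat_mult_vec: "(mat c :: complex^'m^'m) *v y = c *s y"
  by (simp add: vec_eq_iff matrix_vector_mult_def mat_def if_distrib[of "\<lambda>z. z * _"] cong: if_cong)

text \<open>\<open>J\<close> has a single nonzero entry in each row and column, so both matrix
  products collapse to one term. The identity is phrased on vectors, where the signs become
  scalars.\<close>

lemma Z_symmetry:
  assumes j: "j \<in> {1..2*N}" and k: "k \<in> {1..2*N}"
  shows "AE x in lebesgue_on {a..b}. \<forall>y. Z j k x *v y =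
    ((-1) ^ j * (-1) ^ (2*N+1-k)) *s (hermitian_transpose (Z (2*N+1-k) (2*N+1-j) x) *v y)"
  using Z_sym[OF j k] unfolding ae_eq_def
proof eventually_elim
  case (elim x)
  define n where "n = 2*N"
  have inner: "bmat_mult n (bmat_hermitian_transpose (\<lambda>j k. Z j k x)) (J_mat n) l k
      = hermitian_transpose (Z (n+1-k) l x) ** mat ((-1) ^ (n+1-k))" for l
  proof -
    have "bmat_mult n (bmat_hermitian_transpose (\<lambda>j k. Z j k x)) (J_mat n) l k
        = (\<Sum>m=1..n. if m = n+1-k then hermitian_transpose (Z m l x) ** mat ((-1) ^ m) else 0)"
      unfolding bmat_mult_def using k
      by (intro sum.cong) (auto simp: J_mat_def bmat_hermitian_transpose_def n_def)
    also have "\<dots> = hermitian_transpose (Z (n+1-k) l x) ** mat ((-1) ^ (n+1-k))"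
      using k by (subst sum.delta) (auto simp: n_def)
    finally show ?thesis .
  qed
  have "Z j k x = (\<Sum>l=1..n. J_mat n j l ** bmat_mult n (bmat_hermitian_transpose (\<lambda>j k. Z j k x)) (J_mat n) l k)"
    using elim unfolding n_def[symmetric] bmat_mult_def[of n "J_mat n" "bmat_mult n (bmat_hermitian_transpose (\<lambda>j k. Z j k x)) (J_mat n)"] .
  also have "\<dots> = (\<Sum>l=1..n. if l = n+1-j then mat ((-1) ^ j) ** (hermitian_transpose (Z (n+1-k) l x) ** mat ((-1) ^ (n+1-k))) else 0)"
    unfolding inner using j by (intro sum.cong) (auto simp: J_mat_def n_def)
  also have "\<dots> = mat ((-1) ^ j) ** (hermitian_transpose (Z (n+1-k) (n+1-j) x) ** mat ((-1) ^ (n+1-k)))"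
    using j by (subst sum.delta) (auto simp: n_def)
  finally show ?case
    by (simp add: matrix_vector_mul_assoc[symmetric] mat_mult_vec vector_scalar_commute vector_smult_assoc n_def)
qed

text \<open>The boundary form \<open>V\<^sup>* J Y\<close>, with \<open>J\<close> written out along
  its antidiagonal.\<close>

definition bracket :: "(nat \<Rightarrow> real \<Rightarrow> complex^'m) \<Rightarrow> (nat \<Rightarrow> real \<Rightarrow> complex^'m) \<Rightarrow> real \<Rightarrow> complex" where
  "bracket V Y x = (\<Sum>j=1..2*N. (-1) ^ j * cdot (V j x) (Y (2*N+1-j) x))"

text \<open>In block notation this is \<open>V\<^sup>* J Z Y + (Z V)\<^sup>* J Y = 0\<close>, which follows from
  \<open>Z = J Z\<^sup>* J\<close> because \<open>J\<^sup>2 = -I\<close>.\<close>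

lemma symmetric_cancellation:
  assumes "\<forall>j\<in>{1..2*N}. \<forall>k\<in>{1..2*N}. \<forall>y. Z j k x *v y =
    ((-1) ^ j * (-1) ^ (2*N+1-k)) *s (hermitian_transpose (Z (2*N+1-k) (2*N+1-j) x) *v y)"
  shows "(\<Sum>j=1..2*N. (-1) ^ j * cdot (v j) (\<Sum>k=1..2*N. Z (2*N+1-j) k x *v y k)) +
    (\<Sum>j=1..2*N. (-1) ^ j * cdot (\<Sum>k=1..2*N. Z j k x *v v k) (y (2*N+1-j))) = 0"
proof -
  define n where "n = 2*N"
  define H where "H l j = hermitian_transpose (Z l j x)" for l j
  \<comment> \<open>The exponents add up to the odd number \<open>2*N + 1\<close>.\<close>
  have sgn: "(-1) ^ j * (-1) ^ (n+1-j) = (-1 :: complex)" if "j \<in> {1..n}" for j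
    using that unfolding power_add[symmetric] n_def by simp
  have "(\<Sum>j=1..n. (-1) ^ j * cdot (v j) (\<Sum>k=1..n. Z (n+1-j) k x *v y k))
      = (\<Sum>j=1..n. \<Sum>k=1..n. - ((-1) ^ (n+1-k) * cdot (v j) (H (n+1-k) j *v y k)))"
  proof (rule sum.cong[OF refl])
    fix j assume j: "j \<in> {1..n}"
    have "(-1) ^ j * cdot (v j) (Z (n+1-j) k x *v y k) = - ((-1) ^ (n+1-k) * cdot (v j) (H (n+1-k) j *v y k))"
      if k: "k \<in> {1..n}" for k
    proof -
      have "n+1-j \<in> {1..n}" "n+1-(n+1-j) = j" using j by auto
      then have "Z (n+1-j) k x *v y k = ((-1) ^ (n+1-j) * (-1) ^ (n+1-k)) *s (H (n+1-k) j *v y k)"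
        using assms k unfolding n_def H_def by metis
      then have "(-1) ^ j * cdot (v j) (Z (n+1-j) k x *v y k)
          = ((-1) ^ j * (-1) ^ (n+1-j)) * ((-1) ^ (n+1-k) * cdot (v j) (H (n+1-k) j *v y k))"
        by (simp add: cdot_smult_right mult_ac)
      then show ?thesis unfolding sgn[OF j] by simp
    qed
    then show "(-1) ^ j * cdot (v j) (\<Sum>k=1..n. Z (n+1-j) k x *v y k)
      = (\<Sum>k=1..n. - ((-1) ^ (n+1-k) * cdot (v j) (H (n+1-k) j *v y k)))"
      by (simp add: cdot_sum_right sum_distrib_left)
  qed
  \<comment> \<open>Reindexing by \<open>l = n + 1 - k\<close> makes the adjoint blocks match those
    of the other sum.\<close>
  also have "\<dots> = (\<Sum>j=1..n. \<Sum>l=1..n. - ((-1) ^ l * cdot (v j) (H l j *v y (n+1-l))))"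
  proof (rule sum.cong[OF refl])
    fix j
    show "(\<Sum>k=1..n. - ((-1) ^ (n+1-k) * cdot (v j) (H (n+1-k) j *v y k)))
      = (\<Sum>l=1..n. - ((-1) ^ l * cdot (v j) (H l j *v y (n+1-l))))"
      by (subst sum.atLeastAtMost_rev) (rule sum.cong, auto)
  qed
  also have "\<dots> = (\<Sum>l=1..n. \<Sum>j=1..n. - ((-1) ^ l * cdot (v j) (H l j *v y (n+1-l))))"
    by (rule sum.swap)
  also have "\<dots> = - (\<Sum>j=1..n. (-1) ^ j * cdot (\<Sum>k=1..n. Z j k x *v v k) (y (n+1-j)))"
    by (simp add: cdot_sum_left cdot_adjoint H_def sum_distrib_left sum_negf)
  finally show ?thesis by (simp add: n_def)
qed

text \<open>Differentiate the bracket: the \<open>Z\<close> terms cancel by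
  \<open>symmetric_cancellation\<close>, and the two forcing terms that remain are the integrands of
  the inner products.\<close>

lemma Lagrange:
  assumes g: "g \<in> L2W a b W" and h: "h \<in> L2W a b W" and Y: "sol Y g" and V: "sol V h"
  shows "inner_W a b W (Y 1) h - inner_W a b W g (V 1) = (-1) ^ N * (bracket V Y b - bracket V Y a)"
proof -
  let ?RY = "lin_rhs (2*N) Z (force g) Y" and ?RV = "lin_rhs (2*N) Z (force h) V"
  have N2: "1 \<in> {1..2*N}" "2*N \<in> {1..2*N}" using N by auto
  have "primitive_on a b (\<lambda>x. (-1) ^ j * cdot (V j x) (Y (2*N+1-j) x))
      (\<lambda>x. (-1) ^ j * (cdot (V j x) (?RY (2*N+1-j) x) + cdot (?RV j x) (Y (2*N+1-j) x)))" if "j \<in> {1..2*N}" for j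
    by (rule primitive_on_linear[OF bounded_linear_mult_right
        primitive_on_bilinear[OF bounded_bilinear_cdot solD[OF V] solD[OF Y] ab]]) (use that in auto)
  from primitive_on_sum[OF _ this, of "{1..2*N}"]
  have prim: "primitive_on a b (bracket V Y)
    (\<lambda>x. \<Sum>j=1..2*N. (-1) ^ j * (cdot (V j x) (?RY (2*N+1-j) x) + cdot (?RV j x) (Y (2*N+1-j) x)))"
    by (simp add: bracket_def[abs_def])
  have Zall: "AE x in lebesgue_on {a..b}. \<forall>j\<in>{1..2*N}. \<forall>k\<in>{1..2*N}. \<forall>y. Z j k x *v y =
    ((-1) ^ j * (-1) ^ (2*N+1-k)) *s (hermitian_transpose (Z (2*N+1-k) (2*N+1-j) x) *v y)"
    by (intro AE_finite_allI Z_symmetry) auto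
  define i where "i x = (-1) ^ N * (sesq (h x) (W x) (Y 1 x) - sesq (V 1 x) (W x) (g x))" for x
  have "AE x in lebesgue_on {a..b}. i x =
    (\<Sum>j=1..2*N. (-1) ^ j * (cdot (V j x) (?RY (2*N+1-j) x) + cdot (?RV j x) (Y (2*N+1-j) x)))"
    using Zall W_pos
  proof eventually_elim
    case (elim x)
    let ?SY = "\<lambda>j. \<Sum>k=1..2*N. Z j k x *v Y k x" and ?SV = "\<lambda>j. \<Sum>k=1..2*N. Z j k x *v V k x"
    have add: "cdot v (p + q) = cdot v p + cdot v q" "cdot (p + q) v = cdot p v + cdot q v" for v p q
      by (simp_all add: cdot_def sesq_add_left sesq_add_right)
    have zero: "cdot v 0 = 0" "cdot 0 v = 0" for v by (simp_all add: cdot_sum)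
    have "(\<Sum>j=1..2*N. (-1) ^ j * (cdot (V j x) (?RY (2*N+1-j) x) + cdot (?RV j x) (Y (2*N+1-j) x)))
      = ((\<Sum>j=1..2*N. (-1) ^ j * cdot (V j x) (?SY (2*N+1-j))) + (\<Sum>j=1..2*N. (-1) ^ j * cdot (?SV j) (Y (2*N+1-j) x)))
       + ((\<Sum>j=1..2*N. (-1) ^ j * cdot (V j x) (force g (2*N+1-j) x)) + (\<Sum>j=1..2*N. (-1) ^ j * cdot (force h j x) (Y (2*N+1-j) x)))"
      by (simp add: lin_rhs_def add distrib_left sum.distrib)
    also have "(\<Sum>j=1..2*N. (-1) ^ j * cdot (V j x) (?SY (2*N+1-j))) + (\<Sum>j=1..2*N. (-1) ^ j * cdot (?SV j) (Y (2*N+1-j) x)) = 0"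
      by (rule symmetric_cancellation[OF elim(1)])
    \<comment> \<open>\<open>force g\<close> lives in row \<open>2*N\<close>, which is met here only
      for \<open>j = 1\<close>; the minus sign comes from there. In the mirrored sum below,
      \<open>force h\<close> is met for the even index \<open>j = 2*N\<close>.\<close>
    also have "(\<Sum>j=1..2*N. (-1) ^ j * cdot (V j x) (force g (2*N+1-j) x))
        = (\<Sum>j=1..2*N. if j = 1 then - ((-1) ^ N * cdot (V 1 x) (W x *v g x)) else 0)"
      by (intro sum.cong) (auto simp: force_def zero cdot_smult_right)
    also have "\<dots> = - ((-1) ^ N * cdot (V 1 x) (W x *v g x))"
      using N2 by (subst sum.delta) auto
    also have "(\<Sum>j=1..2*N. (-1) ^ j * cdot (force h j x) (Y (2*N+1-j) x))
        = (\<Sum>j=1..2*N. if j = 2*N then (-1) ^ N * cdot (W x *v h x) (Y 1 x) else 0)"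
      by (intro sum.cong) (auto simp: force_def zero cdot_smult_left)
    also have "\<dots> = (-1) ^ N * cdot (W x *v h x) (Y 1 x)"
      using N2 by (subst sum.delta) auto
    also have "cdot (V 1 x) (W x *v g x) = sesq (V 1 x) (W x) (g x)" by (simp add: cdot_sum sesq_def)
    also have "cdot (W x *v h x) (Y 1 x) = sesq (h x) (W x) (Y 1 x)"
    proof -
      have "cdot (W x *v h x) (Y 1 x) = cnj (sesq (Y 1 x) (W x) (h x))"
        by (simp add: cdot_sum sesq_def mult_ac)
      then show ?thesis using positive_definite_hermitian[OF elim(2), of "h x" "Y 1 x"] by simp
    qed
    finally show ?case by (simp add: i_def algebra_simps)
  qed
  from primitive_on_AE_eq[OF prim this] have P: "primitive_on a b (bracket V Y) i" .
  have Y1: "Y 1 \<in> L2W a b W" and V1: "V 1 \<in> L2W a b W"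
    using continuous_in_L2W[OF sol_continuous[OF Y N2(1)]] continuous_in_L2W[OF sol_continuous[OF V N2(1)]] .
  note int1 = integrable_sesq[OF Y1 h] and int2 = integrable_sesq[OF g V1]
  have "bracket V Y b - bracket V Y a = integral {a..b} i"
    using primitive_on_increment(3)[OF P, of a b] ab by simp
  also have "\<dots> = integral\<^sup>L (lebesgue_on {a..b}) i"
    using int1 int2 unfolding i_def [abs_def] by (intro lebesgue_integral_eq_integral[symmetric]) auto
  also have "\<dots> = (-1) ^ N * (inner_W a b W (Y 1) h - inner_W a b W g (V 1))"
    unfolding i_def[abs_def] inner_W_def using int1 int2 by simp
  finally have e: "bracket V Y b - bracket V Y a = (-1) ^ N * (inner_W a b W (Y 1) h - inner_W a b W g (V 1))" .
  show ?thesis unfolding e by (simp add: mult.assoc[symmetric] power_add[symmetric] mult_2[symmetric])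
qed

end

section \<open>The maximal and the minimal operator\<close>

context quasi_diff
begin

lemma matrix_vector_lincomb:
  "finite I \<Longrightarrow> A *v (\<Sum>i\<in>I. c i *s v i) = (\<Sum>i\<in>I. c i *s (A *v v i :: complex^'m))"
  by (induction I rule: finite_induct) (simp_all add: matrix_vector_right_distrib vector_scalar_commute)

lemma smult_sum: "c *s (\<Sum>i\<in>I. v i) = (\<Sum>i\<in>I. c *s (v i :: complex^'m))"
  by (induction I rule: infinite_finite_induct) (simp_all add: vector_add_ldistrib)

lemma lin_rhs_lincomb:
  assumes "finite I"
  shows "lin_rhs (2*N) Z (force (\<lambda>x. \<Sum>i\<in>I. c i *s g i x)) (\<lambda>j x. \<Sum>i\<in>I. c i *s Y i j x) j t
    = (\<Sum>i\<in>I. c i *s lin_rhs (2*N) Z (force (g i)) (Y i) j t)"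
proof -
  have "(\<Sum>k=1..2*N. \<Sum>i\<in>I. c i *s (Z j k t *v Y i k t)) = (\<Sum>i\<in>I. \<Sum>k=1..2*N. c i *s (Z j k t *v Y i k t))"
    by (rule sum.swap)
  moreover have "force (\<lambda>x. \<Sum>i\<in>I. c i *s g i x) j t = (\<Sum>i\<in>I. c i *s force (g i) j t)"
    using assms by (simp add: force_def matrix_vector_lincomb smult_sum vector_smult_assoc mult.commute)
  ultimately show ?thesis
    using assms by (simp add: lin_rhs_def matrix_vector_lincomb smult_sum vector_add_ldistrib sum.distrib)
qed

lemma sol_lincomb:
  assumes "finite I" "\<And>i. i \<in> I \<Longrightarrow> sol (Y i) (g i)"
  shows "sol (\<lambda>j x. \<Sum>i\<in>I. c i *s Y i j x) (\<lambda>x. \<Sum>i\<in>I. c i *s g i x)"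
  unfolding sol_def
proof
  fix j assume j: "j \<in> {1..2*N}"
  have "primitive_on a b (\<lambda>x. \<Sum>i\<in>I. c i *s Y i j x) (\<lambda>x. \<Sum>i\<in>I. c i *s lin_rhs (2*N) Z (force (g i)) (Y i) j x)"
    by (rule primitive_on_sum[OF assms(1) primitive_on_linear[OF bounded_linear_smult solD[OF assms(2) j]]])
  then show "primitive_on a b (\<lambda>x. \<Sum>i\<in>I. c i *s Y i j x)
      (lin_rhs (2*N) Z (force (\<lambda>x. \<Sum>i\<in>I. c i *s g i x)) (\<lambda>j x. \<Sum>i\<in>I. c i *s Y i j x) j)"
    unfolding lin_rhs_lincomb[OF assms(1), abs_def] .
qed

lemma sol_add:
  assumes "sol Y g" "sol V h"
  shows "sol (\<lambda>j x. Y j x + V j x) (g + h)"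
  using sol_lincomb[of "UNIV :: bool set" "\<lambda>i. if i then Y else V" "\<lambda>i. if i then g else h" "\<lambda>_. 1"] assms
  by (simp add: UNIV_bool plus_fun_def add.commute)

lemma sol_smult:
  assumes "sol Y g"
  shows "sol (\<lambda>j x. c *s Y j x) (\<lambda>x. c *s g x)"
  using sol_lincomb[of "UNIV :: unit set" "\<lambda>_. Y" "\<lambda>_. g" "\<lambda>_. c"] assms by (simp add: UNIV_unit)

abbreviation bv :: "(real \<Rightarrow> complex^'m) \<Rightarrow> nat \<Rightarrow> real \<Rightarrow> complex^'m" where
  "bv f j \<equiv> quasi_deriv_at a b N Z f (j - 1)"

lemma Hmax_sol: "(f, g) \<in> Hmax \<Longrightarrow> sol (bv f) g"
  by (rule H_max_imp_sol(3))

lemma endpoints: "a \<in> {a..b}" "b \<in> {a..b}"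
  using ab by auto

lemma lin_graph_Hmax: "lin_graph Hmax"
proof -
  have "(f + f', g + g') \<in> Hmax" if "(f, g) \<in> Hmax" "(f', g') \<in> Hmax" for f g f' g'
  proof (rule sol_imp_H_max(1)[OF _ sol_add[OF Hmax_sol[OF that(1)] Hmax_sol[OF that(2)]]])
    show "g + g' \<in> L2W a b W" by (intro D_add H_max_imp_sol(2)[OF that(1)] H_max_imp_sol(2)[OF that(2)])
    show "ae_eq a b (f + f') (\<lambda>x. bv f 1 x + bv f' 1 x)"
      using H_max_imp_sol(4)[OF that(1)] H_max_imp_sol(4)[OF that(2)]
      unfolding ae_eq_def by eventually_elim simp
  qed
  moreover have "(\<lambda>x. c *s f x, \<lambda>x. c *s g x) \<in> Hmax" if "(f, g) \<in> Hmax" for f g c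
  proof (rule sol_imp_H_max(1)[OF _ sol_smult[OF Hmax_sol[OF that]]])
    show "(\<lambda>x. c *s g x) \<in> L2W a b W" by (intro D_sc H_max_imp_sol(2)[OF that])
    show "ae_eq a b (\<lambda>x. c *s f x) (\<lambda>x. c *s bv f 1 x)"
      using H_max_imp_sol(4)[OF that] unfolding ae_eq_def by eventually_elim simp
  qed
  moreover have "(0, 0) \<in> Hmax"
  proof (rule sol_imp_H_max(1)[of 0 "\<lambda>j x. 0"])
    show "sol (\<lambda>j x. 0) 0" using sol_lincomb[of "{} :: nat set" undefined undefined] by (simp add: zero_fun_def)
    show "ae_eq a b 0 (\<lambda>x. 0 :: complex^'m)" by (simp add: ae_eq_def)
  qed (rule D_zero)
  moreover have "Hmax \<subseteq> L2W a b W \<times> L2W a b W" using H_max_imp_sol(1,2) by auto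
  ultimately show ?thesis unfolding lin_graph_def by blast
qed

lemma bv_lincomb:
  assumes "finite I" "\<And>i. i \<in> I \<Longrightarrow> (\<psi> i, 0) \<in> Hmax" and f: "ae_eq a b f (\<lambda>x. \<Sum>i\<in>I. c i *s \<psi> i x)"
  shows "(f, 0) \<in> Hmax" "j \<in> {1..2*N} \<Longrightarrow> x \<in> {a..b} \<Longrightarrow> bv f j x = (\<Sum>i\<in>I. c i *s bv (\<psi> i) j x)"
proof -
  have "sol (\<lambda>j x. \<Sum>i\<in>I. c i *s bv (\<psi> i) j x) (\<lambda>x. \<Sum>i\<in>I. c i *s (0 :: real \<Rightarrow> complex^'m) x)"
    by (rule sol_lincomb[OF assms(1) Hmax_sol[OF assms(2)]])
  moreover have "(\<lambda>x. \<Sum>i\<in>I. c i *s (0 :: real \<Rightarrow> complex^'m) x) = 0" by (simp add: zero_fun_def)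
  ultimately have s: "sol (\<lambda>j x. \<Sum>i\<in>I. c i *s bv (\<psi> i) j x) 0" by simp
  have "AE x in lebesgue_on {a..b}. \<forall>i\<in>I. \<psi> i x = bv (\<psi> i) 1 x"
    by (rule AE_finite_allI[OF assms(1)]) (use H_max_imp_sol(4)[OF assms(2)] in \<open>simp add: ae_eq_def\<close>)
  then have e: "ae_eq a b f (\<lambda>x. \<Sum>i\<in>I. c i *s bv (\<psi> i) 1 x)"
    using f unfolding ae_eq_def by eventually_elim simp
  show "(f, 0) \<in> Hmax" by (rule sol_imp_H_max(1)[OF D_zero s e])
  show "j \<in> {1..2*N} \<Longrightarrow> x \<in> {a..b} \<Longrightarrow> bv f j x = (\<Sum>i\<in>I. c i *s bv (\<psi> i) j x)"
    by (rule sol_imp_H_max(2)[OF D_zero s e])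
qed

lemma bv_diff:
  assumes "(f, g) \<in> Hmax" "(f', g') \<in> Hmax" "j \<in> {1..2*N}" "x \<in> {a..b}"
  shows "bv (f - f') j x = bv f j x - bv f' j x"
proof -
  have s: "sol (\<lambda>j x. bv f j x + (-1) *s bv f' j x) (g + (\<lambda>x. (-1) *s g' x))"
    by (rule sol_add[OF Hmax_sol[OF assms(1)] sol_smult[OF Hmax_sol[OF assms(2)]]])
  have "bv (f - f') j x = bv f j x + (-1) *s bv f' j x"
  proof (rule sol_imp_H_max(2)[OF _ s _ assms(3,4)])
    show "g + (\<lambda>x. (-1) *s g' x) \<in> L2W a b W"
      by (intro D_add D_sc H_max_imp_sol(2)[OF assms(1)] H_max_imp_sol(2)[OF assms(2)])
    show "ae_eq a b (f - f') (\<lambda>x. bv f 1 x + (-1) *s bv f' 1 x)"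
      using H_max_imp_sol(4)[OF assms(1)] H_max_imp_sol(4)[OF assms(2)]
      unfolding ae_eq_def by eventually_elim (simp add: vec_eq_iff)
  qed
  then show ?thesis by (simp add: vec_eq_iff)
qed

lemma Hmin_iff: "(f, g) \<in> Hmin \<longleftrightarrow> (f, g) \<in> Hmax \<and> (\<forall>j\<in>{1..2*N}. bv f j a = 0 \<and> bv f j b = 0)"
  by (auto simp: H_min_def H_max_def graph_of_def dom_min_def)

lemma Hmax_ae_closed:
  assumes "(f, g) \<in> Hmax" "ae_eq a b f f'" "ae_eq a b g g'"
  shows "(f', g') \<in> Hmax"
proof -
  note s = H_max_imp_sol[OF assms(1)]
  have g': "g' \<in> L2W a b W" by (rule L2W_ae_eq[OF s(2) assms(3)])
  have S: "sol (bv f) g'" unfolding sol_def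
  proof
    fix j assume j: "j \<in> {1..2*N}"
    show "primitive_on a b (bv f j) (lin_rhs (2*N) Z (force g') (bv f) j)"
    proof (rule primitive_on_AE_eq[OF solD[OF s(3) j]])
      show "AE x in lebesgue_on {a..b}. lin_rhs (2*N) Z (force g') (bv f) j x = lin_rhs (2*N) Z (force g) (bv f) j x"
        using assms(3) unfolding ae_eq_def by eventually_elim (simp add: lin_rhs_def force_def)
    qed
  qed
  show ?thesis by (rule sol_imp_H_max(1)[OF g' S ae_eq_trans[OF ae_eq_sym[OF assms(2)] s(4)]])
qed

lemma Hmax_single_valued:
  assumes "(f, g) \<in> Hmax" "(f, g') \<in> Hmax"
  shows "ae_eq a b g g'"
  using assms ae_eq_sym ae_eq_trans by (fastforce simp: H_max_def graph_of_def)

text \<open>The Lagrange identity holds for the continuous representatives, which the inner product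
  does not distinguish from the given functions.\<close>

lemma Green:
  assumes "(f, g) \<in> Hmax" "(u, v) \<in> Hmax"
  shows "inner_W a b W f v - inner_W a b W g u = (-1) ^ N * (bracket (bv u) (bv f) b - bracket (bv u) (bv f) a)"
proof -
  note F = H_max_imp_sol[OF assms(1)] and U = H_max_imp_sol[OF assms(2)]
  have N1: "1 \<in> {1..2*N}" using N by auto
  have L: "bv f 1 \<in> L2W a b W" "bv u 1 \<in> L2W a b W"
    by (rule continuous_in_L2W[OF sol_continuous[OF F(3) N1]], rule continuous_in_L2W[OF sol_continuous[OF U(3) N1]])
  have "inner_W a b W f v = inner_W a b W (bv f 1) v"
    by (rule ip_eqv_left[OF F(1) L(1) U(2)]) (simp only: eqv_iff_ae_eq[OF F(1) L(1)] F(4))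
  moreover have "inner_W a b W g u = inner_W a b W g (bv u 1)"
    by (rule ip_eqv_right[OF U(1) L(2) F(2)]) (simp only: eqv_iff_ae_eq[OF U(1) L(2)] U(4))
  ultimately show ?thesis using Lagrange[OF F(2) U(2) F(3) U(3)] by simp
qed

lemma Hmin_symmetric:
  assumes fg: "(f, g) \<in> Hmin" and uv: "(u, v) \<in> Hmax"
  shows "inner_W a b W g u = inner_W a b W f v"
proof -
  have z: "\<forall>j\<in>{1..2*N}. bv f j a = 0 \<and> bv f j b = 0" and fm: "(f, g) \<in> Hmax" using fg by (auto simp: Hmin_iff)
  have "bracket (bv u) (bv f) x = 0" if "x = a \<or> x = b" for x
    unfolding bracket_def
  proof (rule sum.neutral, rule ballI)
    fix j assume "j \<in> {1..2*N}"
    then have "2*N+1-j \<in> {1..2*N}" by auto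
    then have "bv f (2*N+1-j) x = 0" using z that by blast
    then show "(-1) ^ j * cdot (bv u j x) (bv f (2*N+1-j) x) = 0" by (simp add: cdot_sum)
  qed
  then show ?thesis using Green[OF fm uv] by simp
qed

text \<open>Solve the initial value problem with zero data at \<open>b\<close>, and test Green's formula with the
  homogeneous solutions, whose data at \<open>a\<close> are arbitrary.\<close>

lemma range_Hmin:
  assumes h: "h \<in> L2W a b W" and perp: "\<And>n. (n, 0) \<in> Hmax \<Longrightarrow> inner_W a b W h n = 0"
  shows "\<exists>f. (f, h) \<in> Hmin"
proof -
  obtain Y where Y: "sol Y h" "\<forall>j\<in>{1..2*N}. Y j b = 0" using sol_exists[OF h, of b "\<lambda>_. 0"] by blast
  \<comment> \<open>These data turn the bracket at \<open>a\<close> into the sum of the squared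
    moduli of all entries of \<open>Y\<close> at \<open>a\<close>; its vanishing therefore kills all
    of them.\<close>
  obtain V where V: "sol V 0" "\<forall>j\<in>{1..2*N}. V j a = (-1) ^ j *s Y (2*N+1-j) a"
    using sol_exists[OF D_zero, of a "\<lambda>j. (-1) ^ j *s Y (2*N+1-j) a"] by blast
  have N1: "1 \<in> {1..2*N}" using N by auto
  note Ym = sol_imp_H_max[OF h Y(1) ae_eq_refl] and Vm = sol_imp_H_max[OF D_zero V(1) ae_eq_refl]
  have Y1: "Y 1 \<in> L2W a b W" by (rule continuous_in_L2W[OF sol_continuous[OF Y(1) N1]])
  have "bracket V Y b = 0" unfolding bracket_def
  proof (rule sum.neutral, rule ballI)
    fix j assume "j \<in> {1..2*N}"
    then have "2*N+1-j \<in> {1..2*N}" by auto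
    then show "(-1) ^ j * cdot (V j b) (Y (2*N+1-j) b) = 0" using Y(2) by (simp add: cdot_sum)
  qed
  then have "bracket V Y a = 0"
    using Lagrange[OF h D_zero Y(1) V(1)] perp[OF Vm(1)] ip_zero_right[OF Y1] by simp
  moreover have "bracket V Y a = of_real (\<Sum>j=1..2*N. \<Sum>i\<in>UNIV. (cmod (Y (2*N+1-j) a $ i))\<^sup>2)"
    unfolding bracket_def of_real_sum
  proof (rule sum.cong[OF refl])
    fix j assume j: "j \<in> {1..2*N}"
    have "(-1) ^ j * cdot (V j a) (Y (2*N+1-j) a) = ((-1) ^ j * (-1) ^ j) * cdot (Y (2*N+1-j) a) (Y (2*N+1-j) a)"
      using V(2) j by (simp add: cdot_smult_left)
    also have "\<dots> = cdot (Y (2*N+1-j) a) (Y (2*N+1-j) a)" by (simp add: power_add[symmetric] mult_2[symmetric])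
    also have "\<dots> = (\<Sum>i\<in>UNIV. of_real ((cmod (Y (2*N+1-j) a $ i))\<^sup>2))"
      unfolding cdot_sum by (rule sum.cong[OF refl]) (simp only: complex_norm_square mult.commute)
    finally show "(-1) ^ j * cdot (V j a) (Y (2*N+1-j) a) = (\<Sum>i\<in>UNIV. of_real ((cmod (Y (2*N+1-j) a $ i))\<^sup>2))" .
  qed
  ultimately have "(\<Sum>j=1..2*N. \<Sum>i\<in>UNIV. (cmod (Y (2*N+1-j) a $ i))\<^sup>2) = 0"
    using of_real_eq_0_iff by metis
  then have "\<forall>j\<in>{1..2*N}. (\<Sum>i\<in>UNIV. (cmod (Y (2*N+1-j) a $ i))\<^sup>2) = 0"
    by (subst (asm) sum_nonneg_eq_0_iff) (auto intro!: sum_nonneg)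
  then have "\<forall>j\<in>{1..2*N}. \<forall>i. (cmod (Y (2*N+1-j) a $ i))\<^sup>2 = 0"
    by (simp add: sum_nonneg_eq_0_iff)
  then have z: "Y (2*N+1-j) a = 0" if "j \<in> {1..2*N}" for j using that by (simp add: vec_eq_iff)
  have "Y j a = 0" if "j \<in> {1..2*N}" for j
  proof -
    have "2*N+1-j \<in> {1..2*N}" "2*N+1-(2*N+1-j) = j" using that by auto
    then show ?thesis using z by metis
  qed
  then have "(Y 1, h) \<in> Hmin" using Ym Y(2) endpoints by (auto simp: Hmin_iff)
  then show ?thesis by blast
qed

lemma lin_graph_Hmin: "lin_graph Hmin"
proof -
  note L = lin_graphD[OF lin_graph_Hmax]
  have z: "\<forall>j\<in>{1..2*N}. \<forall>x\<in>{a..b}. bv 0 j x = 0"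
    using bv_diff[OF L(3) L(3)] by simp
  have add: "(f + f', g + g') \<in> Hmin" if 1: "(f, g) \<in> Hmin" "(f', g') \<in> Hmin" for f g f' g'
  proof -
    have m: "(f, g) \<in> Hmax" "(f', g') \<in> Hmax" using 1 by (auto simp: Hmin_iff)
    have n: "(0 - f', 0 - g') \<in> Hmax" by (rule lin_graph_diff[OF lin_graph_Hmax L(3) m(2)])
    have "bv (f + f') j x = bv f j x + bv f' j x" if "j \<in> {1..2*N}" "x \<in> {a..b}" for j x
      using bv_diff[OF m(1) n that] bv_diff[OF L(3) m(2) that] z that by simp
    then show ?thesis using 1 L(4)[OF m] endpoints by (simp add: Hmin_iff)
  qed
  have sc: "(\<lambda>x. c *s f x, \<lambda>x. c *s g x) \<in> Hmin" if 1: "(f, g) \<in> Hmin" for f g c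
  proof -
    have m: "(f, g) \<in> Hmax" using 1 by (auto simp: Hmin_iff)
    have e: "ae_eq a b (\<lambda>x. c *s f x) (\<lambda>x. c *s bv f 1 x)"
      using H_max_imp_sol(4)[OF m] unfolding ae_eq_def by eventually_elim simp
    have "bv (\<lambda>x. c *s f x) j x = c *s bv f j x" if "j \<in> {1..2*N}" "x \<in> {a..b}" for j x
      by (rule sol_imp_H_max(2)[OF D_sc[OF H_max_imp_sol(2)[OF m]] sol_smult[OF Hmax_sol[OF m]] e that])
    then show ?thesis using 1 L(5)[OF m] endpoints by (simp add: Hmin_iff)
  qed
  have "(0, 0) \<in> Hmin" using L(3) z endpoints by (simp add: Hmin_iff)
  moreover have "Hmin \<subseteq> L2W a b W \<times> L2W a b W" using L(1,2) by (auto simp: Hmin_iff)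
  ultimately show ?thesis unfolding lin_graph_def using add sc by blast
qed

end

section \<open>The Krein--von Neumann extension\<close>

context quasi_diff
begin

text \<open>The basis generates the kernel only up to a.e. equality. The projection is onto the span
  of the basis functions themselves, and orthogonality passes to the rest of the kernel through
  \<open>eqv\<close>.\<close>

lemma kernel_projection:
  assumes basis: "ae_basis a b I \<psi> (kernel_op Hmax)" and u: "u \<in> L2W a b W"
  shows "\<exists>n. (n, 0) \<in> Hmax \<and> (\<forall>m. (m, 0) \<in> Hmax \<longrightarrow> inner_W a b W (u - n) m = 0)"
proof -
  define V where "V = {n. (n, 0) \<in> Hmax}"
  note L = lin_graphD[OF lin_graph_Hmax]
  have ker: "kernel_op Hmax = V" by (simp add: kernel_op_def V_def zero_fun_def)
  have fin: "finite I" and \<psi>V: "\<psi> ` I \<subseteq> V"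
    and gen: "\<And>f. f \<in> V \<Longrightarrow> \<exists>c. ae_eq a b f (\<lambda>x. \<Sum>i\<in>I. c i *s \<psi> i x)"
    using basis unfolding ae_basis_def ker by blast+
  have VH: "V \<subseteq> L2W a b W" using L(1) by (auto simp: V_def)
  have sc0: "(\<lambda>x. c *s (0 :: real \<Rightarrow> complex^'m) x) = 0" for c by (simp add: zero_fun_def)
  have "(\<lambda>x. c *s n x, 0) \<in> Hmax" if "(n, 0) \<in> Hmax" for c n
    using L(5)[OF that, of c] unfolding sc0 .
  then have V_sub: "subspace V"
    unfolding subspace_def V_def using L(3) L(4)[of _ 0 _ 0] by simp
  obtain n where n: "n \<in> span (\<psi> ` I)" "\<And>m. m \<in> span (\<psi> ` I) \<Longrightarrow> inner_W a b W (u - n) m = 0"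
    using finite_span_projection[of "\<psi> ` I"] fin \<psi>V VH u by (meson finite_imageI order_trans)
  have span_V: "span (\<psi> ` I) \<subseteq> V" by (rule span_minimal[OF \<psi>V V_sub])
  have nV: "n \<in> V" using n(1) span_V by blast
  have "inner_W a b W (u - n) m = 0" if m: "m \<in> V" for m
  proof -
    obtain c where c: "ae_eq a b m (\<lambda>x. \<Sum>i\<in>I. c i *s \<psi> i x)" using gen[OF m] by blast
    define m' where "m' = (\<Sum>i\<in>I. (\<lambda>x. c i *s \<psi> i x))"
    have app: "m' = (\<lambda>x. \<Sum>i\<in>I. c i *s \<psi> i x)"
      unfolding m'_def using fin by (induction I) (auto simp: zero_fun_def plus_fun_def)
    have m': "m' \<in> span (\<psi> ` I)" unfolding m'_def by (intro span_sum span_scale span_base) auto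
    have mH: "m \<in> L2W a b W" "m' \<in> L2W a b W" "u - n \<in> L2W a b W"
      using m m' span_V VH nV H_diff[OF u] by blast+
    have "eqv m m'" using c eqv_iff_ae_eq[OF mH(1,2)] by (simp only: app)
    then show ?thesis using ip_eqv_right[OF mH] n(2)[OF m'] by simp
  qed
  then show ?thesis using nV unfolding V_def by blast
qed

text \<open>For (u, v) in the adjoint of \<open>S\<close>, solve \<open>T w = v\<close> and let
  \<open>d\<close> be the part of \<open>u - w\<close> orthogonal to the kernel. Then
  \<open>d = S f\<close> for some \<open>f\<close>, and both <d, u> and <d, w> equal <f, v>. Hence
  \<open>d\<close> is null, and \<open>u\<close> differs from \<open>w\<close> by a kernel
  element.\<close>

lemma adj_Hmin:
  assumes basis: "ae_basis a b I \<psi> (kernel_op Hmax)"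
  shows "adj Hmin = Hmax"
proof
  show "Hmax \<subseteq> adj Hmin"
    using H_max_imp_sol(1,2) Hmin_symmetric unfolding adj_def by auto
  show "adj Hmin \<subseteq> Hmax"
  proof (rule subrelI)
    fix u v assume "(u, v) \<in> adj Hmin"
    then have u: "u \<in> L2W a b W" and v: "v \<in> L2W a b W"
      and adj: "\<And>f g. (f, g) \<in> Hmin \<Longrightarrow> inner_W a b W g u = inner_W a b W f v"
      unfolding adj_def by auto
    obtain Y where Y: "sol Y v" using sol_exists[OF v, of a "\<lambda>_. 0"] by blast
    define w where "w = Y 1"
    have wv: "(w, v) \<in> Hmax" unfolding w_def by (rule sol_imp_H_max(1)[OF v Y ae_eq_refl])
    have w: "w \<in> L2W a b W" by (rule H_max_imp_sol(1)[OF wv])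
    obtain n where n: "(n, 0) \<in> Hmax" "\<And>m. (m, 0) \<in> Hmax \<Longrightarrow> inner_W a b W ((u - w) - n) m = 0"
      using kernel_projection[OF basis H_diff[OF u w]] by blast
    have nH: "n \<in> L2W a b W" by (rule H_max_imp_sol(1)[OF n(1)])
    define d where "d = (u - w) - n"
    have d: "d \<in> L2W a b W" unfolding d_def by (intro H_diff u w nH)
    obtain f where f: "(f, d) \<in> Hmin" using range_Hmin[OF d] n(2) unfolding d_def by blast
    have fH: "f \<in> L2W a b W" using lin_graphD(1)[OF lin_graph_Hmin f] .
    have "inner_W a b W d d = inner_W a b W d u - inner_W a b W d w - inner_W a b W d n"
      unfolding d_def using u w nH by (simp add: ip_diff_right H_diff)
    also have "\<dots> = 0" using adj[OF f] Hmin_symmetric[OF f wv] n(2)[OF n(1)] by (simp add: d_def)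
    finally have "nm d = 0" by (simp add: nm_def)
    then have "eqv (w + n) u" using nm_uminus[OF d] by (simp add: eqv_def d_def algebra_simps)
    then have e: "ae_eq a b (w + n) u" using eqv_iff_ae_eq[OF D_add[OF w nH] u] by simp
    have "(w + n, v + 0) \<in> Hmax" by (rule lin_graphD(4)[OF lin_graph_Hmax wv n(1)])
    then show "(u, v) \<in> Hmax" using Hmax_ae_closed[OF _ e ae_eq_refl] by simp
  qed
qed

text \<open>The restriction of \<open>T\<close> to \<open>dom S + ker T\<close>: the component
  \<open>f0\<close> carries the whole value \<open>g\<close>, since the kernel component contributes
  0.\<close>

definition krein :: "((real \<Rightarrow> complex^'m) \<times> (real \<Rightarrow> complex^'m)) set" where
  "krein = {(f, g). (f, g) \<in> Hmax \<and> (\<exists>f0. (f0, g) \<in> Hmin \<and> (f - f0, 0) \<in> Hmax)}"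

lemma kreinE:
  assumes "(f, g) \<in> krein"
  shows "(f, g) \<in> Hmax" "\<exists>f0. (f0, g) \<in> Hmin \<and> (f - f0, 0) \<in> Hmax"
  using assms by (auto simp: krein_def)

lemma Hmin_subset_krein: "Hmin \<subseteq> krein"
  using lin_graphD(3)[OF lin_graph_Hmax] by (auto simp: krein_def Hmin_iff)

lemma kernel_subset_krein: "(n, 0) \<in> Hmax \<Longrightarrow> (n, 0) \<in> krein"
  using lin_graphD(3)[OF lin_graph_Hmin] by (auto simp: krein_def intro!: exI[of _ 0])

lemma lin_graph_krein: "lin_graph krein"
proof -
  note L = lin_graphD[OF lin_graph_Hmax] and M = lin_graphD[OF lin_graph_Hmin]
  have "(f + f', g + g') \<in> krein" if 1: "(f, g) \<in> krein" "(f', g') \<in> krein" for f g f' g'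
  proof -
    obtain p where p: "(p, g) \<in> Hmin" "(f - p, 0) \<in> Hmax" using kreinE[OF 1(1)] by blast
    obtain p' where p': "(p', g') \<in> Hmin" "(f' - p', 0) \<in> Hmax" using kreinE[OF 1(2)] by blast
    have "((f - p) + (f' - p'), 0 + 0) \<in> Hmax" by (rule L(4)[OF p(2) p'(2)])
    moreover have "(f - p) + (f' - p') = (f + f') - (p + p')" by simp
    ultimately have "((f + f') - (p + p'), 0) \<in> Hmax" by simp
    then show ?thesis using M(4)[OF p(1) p'(1)] L(4)[OF kreinE(1)[OF 1(1)] kreinE(1)[OF 1(2)]]
      unfolding krein_def by blast
  qed
  moreover have "(\<lambda>x. c *s f x, \<lambda>x. c *s g x) \<in> krein" if 1: "(f, g) \<in> krein" for f g c
  proof -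
    obtain p where p: "(p, g) \<in> Hmin" "(f - p, 0) \<in> Hmax" using kreinE[OF 1] by blast
    have "(\<lambda>x. c *s (f - p) x, \<lambda>x. c *s (0 :: real \<Rightarrow> complex^'m) x) \<in> Hmax" by (rule L(5)[OF p(2)])
    moreover have "(\<lambda>x. c *s (f - p) x) = (\<lambda>x. c *s f x) - (\<lambda>x. c *s p x)"
      by (simp add: fun_eq_iff vec_eq_iff algebra_simps)
    moreover have "(\<lambda>x. c *s (0 :: real \<Rightarrow> complex^'m) x) = 0" by (simp add: zero_fun_def)
    ultimately have "((\<lambda>x. c *s f x) - (\<lambda>x. c *s p x), 0) \<in> Hmax" by simp
    then show ?thesis using M(5)[OF p(1)] L(5)[OF kreinE(1)[OF 1]] unfolding krein_def by blast
  qed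
  moreover have "(0, 0) \<in> krein" by (rule kernel_subset_krein[OF L(3)])
  moreover have "krein \<subseteq> L2W a b W \<times> L2W a b W" using L(1,2)[OF kreinE(1)] by auto
  ultimately show ?thesis unfolding lin_graph_def by blast
qed

text \<open>Values of \<open>S\<close> are orthogonal to \<open>ker T\<close>, so pairing with such
  a value sees only the component in \<open>dom S\<close>.\<close>

lemma krein_form:
  assumes fg: "(f, g) \<in> krein" and uv: "(u, v) \<in> Hmin" "(f - u, 0) \<in> Hmax" and hk: "(h, k) \<in> Hmin"
  shows "inner_W a b W k f = inner_W a b W k u"
proof -
  have fH: "f \<in> L2W a b W" using lin_graphD(1)[OF lin_graph_krein fg] .
  have uH: "u \<in> L2W a b W" using lin_graphD(1)[OF lin_graph_Hmin uv(1)] .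
  have kH: "h \<in> L2W a b W" "k \<in> L2W a b W" using lin_graphD(1,2)[OF lin_graph_Hmin hk] .
  have "inner_W a b W k (f - u) = inner_W a b W h 0" by (rule Hmin_symmetric[OF hk uv(2)])
  then show ?thesis using ip_diff_right[OF fH uH kH(2)] ip_zero_right[OF kH(1)] by simp
qed

text \<open>Symmetry: by \<open>krein_form\<close> both sides reduce to the components in
  \<open>dom S\<close>. Conversely, if (u, v) is in the adjoint, testing with kernel elements shows
  that \<open>v\<close> is orthogonal to \<open>ker T\<close>; so \<open>v = S w\<close> for some
  \<open>w\<close>, and \<open>u - w\<close> lies in the kernel.\<close>

lemma krein_adj:
  assumes basis: "ae_basis a b I \<psi> (kernel_op Hmax)"
  shows "krein = adj krein"
proof
  show "krein \<subseteq> adj krein"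
  proof (rule subrelI)
    fix u v assume uv: "(u, v) \<in> krein"
    obtain u0 where u0: "(u0, v) \<in> Hmin" "(u - u0, 0) \<in> Hmax" using kreinE[OF uv] by blast
    have H: "u \<in> L2W a b W" "v \<in> L2W a b W" using lin_graphD(1,2)[OF lin_graph_krein uv] .
    have "inner_W a b W g u = inner_W a b W f v" if fg: "(f, g) \<in> krein" for f g
    proof -
      obtain f0 where f0: "(f0, g) \<in> Hmin" "(f - f0, 0) \<in> Hmax" using kreinE[OF fg] by blast
      have fH: "f \<in> L2W a b W" "f0 \<in> L2W a b W"
        using lin_graphD(1)[OF lin_graph_krein fg] lin_graphD(1)[OF lin_graph_Hmin f0(1)] .
      have "inner_W a b W g u = inner_W a b W g u0" by (rule krein_form[OF uv u0 f0(1)])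
      also have "\<dots> = inner_W a b W f0 v" using Hmin_symmetric[OF f0(1)] u0(1) by (auto simp: Hmin_iff)
      also have "\<dots> = inner_W a b W f v"
        using krein_form[OF fg f0 u0(1)] q_cnj[OF H(2) fH(1)] q_cnj[OF H(2) fH(2)] by simp
      finally show ?thesis .
    qed
    then show "(u, v) \<in> adj krein" using H unfolding adj_def by blast
  qed
  show "adj krein \<subseteq> krein"
  proof (rule subrelI)
    fix u v assume "(u, v) \<in> adj krein"
    then have H: "u \<in> L2W a b W" "v \<in> L2W a b W"
      and adj: "\<And>f g. (f, g) \<in> krein \<Longrightarrow> inner_W a b W g u = inner_W a b W f v"
      unfolding adj_def by auto
    have "(u, v) \<in> adj Hmin" using H adj Hmin_subset_krein unfolding adj_def by blast
    then have uv: "(u, v) \<in> Hmax" using adj_Hmin[OF basis] by simp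
    have "inner_W a b W v n = 0" if n: "(n, 0) \<in> Hmax" for n
    proof -
      have nH: "n \<in> L2W a b W" by (rule H_max_imp_sol(1)[OF n])
      have "inner_W a b W n v = 0" using adj[OF kernel_subset_krein[OF n]] ip_zero_left[OF H(1)] by simp
      then show ?thesis using q_cnj[OF nH H(2)] by simp
    qed
    then obtain w where w: "(w, v) \<in> Hmin" using range_Hmin[OF H(2)] by blast
    then have "(w, v) \<in> Hmax" by (simp add: Hmin_iff)
    from lin_graph_diff[OF lin_graph_Hmax uv this] have "(u - w, 0) \<in> Hmax" by (simp only: diff_self)
    then show "(u, v) \<in> krein" using uv w unfolding krein_def by blast
  qed
qed

section \<open>Transfer to the defined operator notions, resolvents and minimality\<close>

lemma adjoint_op_eq_adj: "adjoint_op a b W T = adj T"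
  by (simp add: adjoint_op_def adj_def)

lemma linear_operator_imp_lin_graph:
  assumes "linear_operator a b W T"
  shows "lin_graph T"
  unfolding lin_graph_def zero_fun_def plus_fun_def
proof (intro conjI allI impI)
  note D = assms[unfolded linear_operator_def]
  show "T \<subseteq> L2W a b W \<times> L2W a b W" by (rule conjunct1[OF D])
  show "((\<lambda>x. 0), (\<lambda>x. 0)) \<in> T" by (rule conjunct1[OF conjunct2[OF D]])
  show "((\<lambda>x. f x + f' x), (\<lambda>x. g x + g' x)) \<in> T" if "(f, g) \<in> T" "(f', g') \<in> T" for f g f' g'
    using conjunct1[OF conjunct2[OF conjunct2[OF D]]] that by simp
  show "((\<lambda>x. c *s f x), (\<lambda>x. c *s g x)) \<in> T" if "(f, g) \<in> T" for c f g
    using conjunct1[OF conjunct2[OF conjunct2[OF conjunct2[OF D]]]] that by simp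
qed

lemma self_adjointD:
  assumes "self_adjoint a b W T"
  shows "lin_graph T" "T = adj T"
  using assms linear_operator_imp_lin_graph unfolding self_adjoint_def adjoint_op_eq_adj by blast+

lemma nonnegative_op_iff: "nonnegative_op a b W T \<longleftrightarrow> nonneg T"
  by (simp add: nonnegative_op_def nonneg_def)

lemma krein_self_adjoint:
  assumes basis: "ae_basis a b I \<psi> (kernel_op Hmax)"
  shows "self_adjoint a b W krein"
proof -
  note K = lin_graphD[OF lin_graph_krein]
  have closed: "(f', g') \<in> krein" if fg: "(f, g) \<in> krein" and e: "ae_eq a b f f'" "ae_eq a b g g'" for f g f' g'
  proof -
    have H: "f \<in> L2W a b W" "g \<in> L2W a b W" using K(1,2)[OF fg] .
    have H': "f' \<in> L2W a b W" "g' \<in> L2W a b W" using L2W_ae_eq[OF H(1) e(1)] L2W_ae_eq[OF H(2) e(2)] .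
    have "eqv f f'" "eqv g g'" using eqv_iff_ae_eq[OF H(1) H'(1)] eqv_iff_ae_eq[OF H(2) H'(2)] e by simp_all
    then have "inner_W a b W s f' = inner_W a b W r g'" if rs: "(r, s) \<in> krein" for r s
      using adjD[OF krein_adj[OF basis] rs fg] ip_eqv_right[OF H(1) H'(1) K(2)[OF rs]]
        ip_eqv_right[OF H(2) H'(2) K(1)[OF rs]] by simp
    then have "(f', g') \<in> adj krein" using H' unfolding adj_def by blast
    then show ?thesis using krein_adj[OF basis] by simp
  qed
  have lo: "linear_operator a b W krein"
    unfolding linear_operator_def
  proof (intro conjI allI impI)
    show "krein \<subseteq> L2W a b W \<times> L2W a b W" using K(1,2) by auto
    show "((\<lambda>x. 0), (\<lambda>x. 0)) \<in> krein" using K(3) by (simp add: zero_fun_def)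
    show "((\<lambda>x. f x + f' x), (\<lambda>x. g x + g' x)) \<in> krein" if "(f, g) \<in> krein \<and> (f', g') \<in> krein" for f g f' g'
      using K(4)[of f g f' g'] that by (simp add: plus_fun_def)
    show "((\<lambda>x. c *s f x), (\<lambda>x. c *s g x)) \<in> krein" if "(f, g) \<in> krein" for c f g
      using K(5)[OF that] .
    show "(f', g') \<in> krein" if "(f, g) \<in> krein \<and> ae_eq a b f f' \<and> ae_eq a b g g'" for f g f' g'
      using closed that by blast
    show "ae_eq a b g g'" if "(f, g) \<in> krein \<and> (f, g') \<in> krein" for f g g'
      using Hmax_single_valued kreinE(1) that by blast
  qed
  have "densely_defined a b W krein"
    unfolding densely_defined_def
  proof (intro ballI allI impI)
    fix u and \<epsilon> :: real assume u: "u \<in> L2W a b W" and \<epsilon>: "\<epsilon> > 0"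
    have "\<exists>m\<in>Domain krein. nm (u - m) < \<epsilon>"
    proof (rule dense_if_perp_trivial[OF _ _ _ _ _ u \<epsilon>])
      show "Domain krein \<subseteq> L2W a b W" using K(1) by auto
      show "0 \<in> Domain krein" using K(3) by auto
      show "p + r \<in> Domain krein" if "p \<in> Domain krein" "r \<in> Domain krein" for p r
        using that K(4) by blast
      show "(\<lambda>x. c *s p x) \<in> Domain krein" if "p \<in> Domain krein" for c p
        using that K(5) by blast
      show "nm h = 0" if h: "h \<in> L2W a b W" and perp: "\<And>m. m \<in> Domain krein \<Longrightarrow> inner_W a b W m h = 0" for h
      proof -
        \<comment> \<open>Orthogonality to \<open>dom S\<close> puts \<open>(0, h)\<close> into the
          adjoint of \<open>S\<close>, which is the single-valued maximal operator; so
          \<open>h = 0\<close> a.e.\<close>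
        have "inner_W a b W g 0 = inner_W a b W f h" if fg: "(f, g) \<in> Hmin" for f g
          using perp[of f] ip_zero_right[OF lin_graphD(2)[OF lin_graph_Hmin fg]] fg Hmin_subset_krein by auto
        then have "(0, h) \<in> adj Hmin" using h D_zero unfolding adj_def by blast
        then have "(0, h) \<in> Hmax" using adj_Hmin[OF basis] by simp
        from Hmax_single_valued[OF this lin_graphD(3)[OF lin_graph_Hmax]] have "eqv h 0"
          using eqv_iff_ae_eq[OF h D_zero] by simp
        then show ?thesis by (simp add: eqv_def)
      qed
    qed
    then show "\<exists>f\<in>Domain krein. sqrt (Re (inner_W a b W (\<lambda>x. u x - f x) (\<lambda>x. u x - f x))) < \<epsilon>"
      unfolding nm_def fun_diff_def .
  qed
  then show ?thesis unfolding self_adjoint_def adjoint_op_eq_adj using lo krein_adj[OF basis] by blast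
qed

text \<open>Surjectivity of \<open>T + c\<close> provides the witness for the choice made in
  \<open>resolvent_at\<close>.\<close>

lemma resolvent_at:
  assumes T: "self_adjoint a b W T" "nonnegative_op a b W T" and u: "u \<in> L2W a b W" and c: "c > 0"
  shows "\<exists>w. (resolvent_at a b T c u, w) \<in> T \<and> eqv (w + (\<lambda>x. of_real c *s resolvent_at a b T c u x)) u"
proof -
  have T': "nonneg T" using T(2) by (simp only: nonnegative_op_iff)
  note lg = self_adjointD(1)[OF T(1)] and adjT = self_adjointD(2)[OF T(1)]
  have e: "eqv (w + (\<lambda>x. of_real c *s v x)) u \<longleftrightarrow> ae_eq a b (\<lambda>x. w x + of_real c *s v x) u" if vw: "(v, w) \<in> T" for v w
  proof -
    have H: "v \<in> L2W a b W" "w \<in> L2W a b W" using lin_graphD(1,2)[OF lg vw] .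
    show ?thesis using eqv_iff_ae_eq[OF D_add[OF H(2) D_sc[OF H(1)]] u] by (simp add: plus_fun_def)
  qed
  obtain f g where "(f, g) \<in> T" "eqv (g + (\<lambda>x. of_real c *s f x)) u"
    using shift_surjective[OF lg T' adjT c u] by blast
  then have "\<exists>v w. (v, w) \<in> T \<and> ae_eq a b (\<lambda>x. w x + of_real c *s v x) u" using e by blast
  from someI_ex[OF this] have "\<exists>w. (resolvent_at a b T c u, w) \<in> T \<and>
      ae_eq a b (\<lambda>x. w x + of_real c *s resolvent_at a b T c u x) u"
    unfolding resolvent_at_def .
  then show ?thesis using e by blast
qed

text \<open>The form of the extension at \<open>f\<close> equals the form of \<open>S\<close> at the
  component \<open>f0\<close>.\<close>

lemma nonneg_krein:
  assumes pos: "nonneg Hmin"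
  shows "nonneg krein"
  unfolding nonneg_def
proof (intro allI impI)
  fix f g assume fg: "(f, g) \<in> krein"
  obtain f0 where f0: "(f0, g) \<in> Hmin" "(f - f0, 0) \<in> Hmax" using kreinE[OF fg] by blast
  have H: "f \<in> L2W a b W" "g \<in> L2W a b W" "f0 \<in> L2W a b W"
    using lin_graphD(1,2)[OF lin_graph_krein fg] lin_graphD(1)[OF lin_graph_Hmin f0(1)] .
  have "inner_W a b W f g = inner_W a b W f0 g"
    using krein_form[OF fg f0 f0(1)] q_cnj[OF H(2,1)] q_cnj[OF H(2,3)] by simp
  then show "0 \<le> inner_W a b W f g" using nonnegD[OF pos f0(1)] by simp
qed

text \<open>\<open>THE\<close> asks for uniqueness as well: two least extensions are below each
  other, so their resolvents have equal quadratic forms, and equality at shift 1 is enough for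
  \<open>nonneg_self_adjoint_eqI\<close>.\<close>

lemma Krein_von_Neumann_extension_eq:
  assumes basis: "ae_basis a b I \<psi> (kernel_op Hmax)" and pos: "nonneg Hmin"
  shows "Krein_von_Neumann_extension a b W Hmin = krein"
  unfolding Krein_von_Neumann_extension_def
proof (rule the_equality)
  have K: "nonneg_sa_extension a b W Hmin krein"
    using Hmin_subset_krein krein_self_adjoint[OF basis] nonneg_krein[OF pos]
    by (simp add: nonneg_sa_extension_def nonnegative_op_iff)
  have least: "op_le a b W krein T" if T: "nonneg_sa_extension a b W Hmin T" for T
    unfolding op_le_def
  proof (intro ballI allI impI)
    fix u and c :: real assume u: "u \<in> L2W a b W" and c: "c > 0"
    have sa: "self_adjoint a b W T" "nonnegative_op a b W T" "Hmin \<subseteq> T" using T by (auto simp: nonneg_sa_extension_def)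
    note T' = self_adjointD(1)[OF sa(1)] sa(2)[unfolded nonnegative_op_iff] self_adjointD(2)[OF sa(1)]
    define v where "v = resolvent_at a b krein c u"
    define w where "w = resolvent_at a b T c u"
    obtain g where g: "(v, g) \<in> krein" "eqv (g + (\<lambda>x. of_real c *s v x)) u"
      using resolvent_at[OF _ _ u c, of krein] K unfolding v_def nonneg_sa_extension_def by blast
    obtain h where h: "(w, h) \<in> T" "eqv (h + (\<lambda>x. of_real c *s w x)) u"
      using resolvent_at[OF sa(1,2) u c] unfolding w_def by blast
    obtain v0 where v0: "(v0, g) \<in> Hmin" "(v - v0, 0) \<in> Hmax" using kreinE[OF g(1)] by blast
    have "inner_W a b W u w \<le> inner_W a b W u v"
    proof (rule resolvent_form_le[OF T' c _ _ _ h(1) u g(2) h(2)])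
      show "(v0, g) \<in> T" using v0(1) sa(3) by blast
      show "v \<in> L2W a b W" using lin_graphD(1)[OF lin_graph_krein g(1)] .
      show "inner_W a b W g v = inner_W a b W g v0" by (rule krein_form[OF g(1) v0 v0(1)])
    qed
    then show "inner_W a b W u (resolvent_at a b T c u) \<le> inner_W a b W u (resolvent_at a b krein c u)"
      by (simp add: v_def w_def)
  qed
  show "nonneg_sa_extension a b W Hmin krein \<and>
      (\<forall>T'. nonneg_sa_extension a b W Hmin T' \<longrightarrow> op_le a b W krein T')"
    using K least by blast
  fix T assume T: "nonneg_sa_extension a b W Hmin T \<and>
      (\<forall>T'. nonneg_sa_extension a b W Hmin T' \<longrightarrow> op_le a b W T T')"
  then have TK: "op_le a b W T krein" "op_le a b W krein T" using K least by blast+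
  have sa: "self_adjoint a b W T" "nonnegative_op a b W T" "self_adjoint a b W krein" "nonnegative_op a b W krein"
    using T K by (auto simp: nonneg_sa_extension_def)
  note T' = self_adjointD(1)[OF sa(1)] sa(2)[unfolded nonnegative_op_iff] self_adjointD(2)[OF sa(1)]
    sa(4)[unfolded nonnegative_op_iff]
  have one: "(\<lambda>x. of_real 1 *s v x) = v" for v :: "real \<Rightarrow> complex^'m" by simp
  show "T = krein"
  proof (rule nonneg_self_adjoint_eqI[OF T'(1-3) lin_graph_krein T'(4) krein_adj[OF basis]])
    fix u assume u: "u \<in> L2W a b W"
    show "\<exists>w. (resolvent_at a b T 1 u, w) \<in> T \<and> eqv (w + resolvent_at a b T 1 u) u"
      using resolvent_at[OF sa(1,2) u zero_less_one] unfolding one .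
    show "\<exists>w. (resolvent_at a b krein 1 u, w) \<in> krein \<and> eqv (w + resolvent_at a b krein 1 u) u"
      using resolvent_at[OF sa(3,4) u zero_less_one] unfolding one .
    show "inner_W a b W u (resolvent_at a b T 1 u) = inner_W a b W u (resolvent_at a b krein 1 u)"
      using TK u unfolding op_le_def by (meson antisym zero_less_one)
  qed
qed

lemma nonneg_Hmin_if_strictly_positive:
  assumes "strictly_positive_op a b W Hmin"
  shows "nonneg Hmin"
  unfolding nonneg_def
proof (intro allI impI)
  fix u v assume uv: "(u, v) \<in> Hmin"
  obtain \<epsilon> :: real where \<epsilon>: "\<epsilon> > 0" "of_real \<epsilon> * inner_W a b W u u \<le> inner_W a b W u v"
    using assms uv unfolding strictly_positive_op_def by blast
  have u: "u \<in> L2W a b W" using lin_graphD(1)[OF lin_graph_Hmin uv] .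
  have e: "of_real \<epsilon> * inner_W a b W u u = of_real (\<epsilon> * Re (inner_W a b W u u))"
    using q_self[OF u] by (metis of_real_mult)
  have "0 \<le> \<epsilon> * Re (inner_W a b W u u)" using \<epsilon>(1) q_nonneg[OF u] by simp
  then have "0 \<le> of_real \<epsilon> * inner_W a b W u u" unfolding e by (simp add: less_eq_complex_def)
  then show "0 \<le> inner_W a b W u v" using \<epsilon>(2) by (rule order_trans)
qed

text \<open>The \<open>\<Gamma>\<close> data of \<open>y\<close> serve as coefficients of a kernel
  element \<open>n\<close> with the same data. Then \<open>y\<close> is in the domain iff all
  boundary data of \<open>y - n\<close> vanish. Its \<open>\<Gamma>\<close> data vanish by
  construction, so what remains are the higher quasi-derivatives, index \<open>N + l\<close>, at
  both endpoints.\<close>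

lemma Domain_krein:
  fixes \<phi> :: "nat \<Rightarrow> 'm \<Rightarrow> real \<Rightarrow> complex^'m"
  assumes basis: "ae_basis a b ({1..2*N} \<times> UNIV) (\<lambda>(j, k). \<phi> j k) (kernel_op Hmax)"
    and Gamma: "\<And>j k l. j \<in> {1..2*N} \<Longrightarrow> l \<in> {1..2*N} \<Longrightarrow>
           Gamma_map a b N Z (\<phi> j k) l = (if j = l then axis k 1 else 0)"
  shows "y \<in> Domain krein \<longleftrightarrow> y \<in> dom_max a b N W Z \<and>
    (\<forall>l\<in>{1..N}. \<forall>x\<in>{a, b}. bv y (N + l) x =
      (\<Sum>j=1..2*N. phi_mat a b N Z \<phi> j (l + N - 1) x *v Gamma_map a b N Z y j))"
proof -
  let ?I = "{1..2*N} \<times> (UNIV :: 'm set)"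
  let ?G = "Gamma_map a b N Z"
  define \<psi> where "\<psi> p = \<phi> (fst p) (snd p)" for p
  have \<psi>: "(\<psi> p, 0) \<in> Hmax" if "p \<in> ?I" for p
    using basis that unfolding ae_basis_def kernel_op_def by (auto simp: \<psi>_def zero_fun_def split: prod.splits)
  have fin: "finite ?I" by simp
  have phi: "phi_mat a b N Z \<phi> j l x *v v = (\<Sum>k\<in>UNIV. (v $ k) *s quasi_deriv_at a b N Z (\<phi> j k) l x)" for j l x v
    by (simp add: phi_mat_def vec_eq_iff matrix_vector_mult_def mult.commute)
  have comb: "(\<Sum>p\<in>?I. (G (fst p) $ snd p) *s bv (\<psi> p) (N + l) x) = (\<Sum>j=1..2*N. phi_mat a b N Z \<phi> j (l + N - 1) x *v G j)"
    for G :: "nat \<Rightarrow> complex^'m" and l x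
    unfolding phi sum.cartesian_product by (rule sum.cong) (auto simp: \<psi>_def add.commute)
  have split: "?G f l = (if l \<le> N then bv f l a else bv f (l - N) b)" for f l
    by (simp add: Gamma_map_def)
  \<comment> \<open>\<open>\<Gamma>\<close> maps the basis to the unit vectors, so it recovers the
    coefficients of a kernel element from its boundary values.\<close>
  have G_comb: "?G n l = (\<chi> k. c (l, k))"
    if n: "\<And>j x. j \<in> {1..2*N} \<Longrightarrow> x \<in> {a..b} \<Longrightarrow> bv n j x = (\<Sum>p\<in>?I. c p *s bv (\<psi> p) j x)"
      and l: "l \<in> {1..2*N}" for n c l
  proof -
    have "?G n l = (\<Sum>p\<in>?I. c p *s ?G (\<psi> p) l)"
    proof (cases "l \<le> N")
      case True then show ?thesis unfolding split using n[of l a] l endpoints by simp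
    next
      case False
      then have "l - N \<in> {1..2*N}" using l by auto
      then show ?thesis unfolding split using n[of "l - N" b] False endpoints by simp
    qed
    also have "\<dots> = (\<Sum>j=1..2*N. \<Sum>k\<in>UNIV. c (j, k) *s ?G (\<phi> j k) l)"
      by (subst sum.cartesian_product) (simp add: \<psi>_def case_prod_beta)
    also have "\<dots> = (\<Sum>j=1..2*N. if j = l then (\<Sum>k\<in>UNIV. c (l, k) *s axis k 1) else 0)"
      using Gamma l by (intro sum.cong) (auto simp: vec_eq_iff)
    also have "\<dots> = (\<Sum>k\<in>UNIV. c (l, k) *s axis k 1)" using l by (subst sum.delta) auto
    also have "\<dots> = (\<chi> k. c (l, k))"
      by (simp add: vec_eq_iff axis_def if_distrib[of "\<lambda>z. _ * z"] cong: if_cong)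
    finally show ?thesis .
  qed
  show ?thesis
  proof
    assume "y \<in> Domain krein"
    then obtain g y0 where y: "(y, g) \<in> Hmax" "(y0, g) \<in> Hmin" "(y - y0, 0) \<in> Hmax" unfolding krein_def by blast
    have ym: "y \<in> dom_max a b N W Z" using y(1) by (auto simp: H_max_def graph_of_def)
    have y0m: "(y0, g) \<in> Hmax" "\<And>j x. j \<in> {1..2*N} \<Longrightarrow> x \<in> {a, b} \<Longrightarrow> bv y0 j x = 0"
      using y(2) by (auto simp: Hmin_iff)
    define n where "n = y - y0"
    have yn: "bv y j x = bv n j x" if "j \<in> {1..2*N}" "x \<in> {a, b}" for j x
      using bv_diff[OF y(1) y0m(1) that(1)] y0m(2)[OF that] that endpoints by (auto simp: n_def)
    have "n \<in> kernel_op Hmax" using y(3) by (simp add: n_def kernel_op_def zero_fun_def)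
    then obtain c where c: "ae_eq a b n (\<lambda>x. \<Sum>p\<in>?I. c p *s \<psi> p x)"
      using basis unfolding ae_basis_def \<psi>_def case_prod_beta by blast
    note nc = bv_lincomb(2)[OF fin \<psi> c]
    have Gy: "?G y l = ?G n l" if "l \<in> {1..2*N}" for l
    proof (cases "l \<le> N")
      case True
      then show ?thesis unfolding split using yn[of l a] that by simp
    next
      case False
      then have "l - N \<in> {1..2*N}" using that by auto
      then show ?thesis unfolding split using yn[of "l - N" b] False by simp
    qed
    have Gc: "?G y l $ k = c (l, k)" if "l \<in> {1..2*N}" for l k
      using Gy[OF that] G_comb[OF nc that] by simp
    show "y \<in> dom_max a b N W Z \<and> (\<forall>l\<in>{1..N}. \<forall>x\<in>{a, b}. bv y (N + l) x =
      (\<Sum>j=1..2*N. phi_mat a b N Z \<phi> j (l + N - 1) x *v ?G y j))"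
    proof (intro conjI ballI ym)
      fix l x assume l: "l \<in> {1..N}" and x: "x \<in> {a, b}"
      have Nl: "N + l \<in> {1..2*N}" using l by auto
      have xab: "x \<in> {a..b}" using x endpoints by auto
      have "bv y (N + l) x = (\<Sum>p\<in>?I. c p *s bv (\<psi> p) (N + l) x)" using yn[OF Nl x] nc[OF _ Nl xab] by simp
      also have "\<dots> = (\<Sum>p\<in>?I. (?G y (fst p) $ snd p) *s bv (\<psi> p) (N + l) x)"
        using Gc by (intro sum.cong) auto
      finally show "bv y (N + l) x = (\<Sum>j=1..2*N. phi_mat a b N Z \<phi> j (l + N - 1) x *v ?G y j)"
        unfolding comb .
    qed
  next
    assume A: "y \<in> dom_max a b N W Z \<and> (\<forall>l\<in>{1..N}. \<forall>x\<in>{a, b}. bv y (N + l) x =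
      (\<Sum>j=1..2*N. phi_mat a b N Z \<phi> j (l + N - 1) x *v ?G y j))"
    define g where "g = quasi_diff_expr a b N W Z y"
    have yg: "(y, g) \<in> Hmax" using A ae_eq_refl by (simp add: H_max_def graph_of_def g_def)
    define c where "c p = ?G y (fst p) $ snd p" for p
    define n where "n = (\<lambda>x. \<Sum>p\<in>?I. c p *s \<psi> p x)"
    have "ae_eq a b n (\<lambda>x. \<Sum>p\<in>?I. c p *s \<psi> p x)" unfolding n_def by (rule ae_eq_refl)
    note n0 = bv_lincomb(1)[OF fin \<psi> this] and nc = bv_lincomb(2)[OF fin \<psi> this]
    have Gn: "?G n l = ?G y l" if "l \<in> {1..2*N}" for l
      using G_comb[OF nc that] by (simp add: vec_eq_iff c_def)
    have "bv n j x = bv y j x" if j: "j \<in> {1..2*N}" and x: "x \<in> {a, b}" for j x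
    \<comment> \<open>Indices up to \<open>N\<close> are covered by \<open>\<Gamma>\<close>: entry
      \<open>j\<close> is the value at \<open>a\<close> and entry \<open>N + j\<close> the value at
      \<open>b\<close>. The larger indices are covered by the assumed formula.\<close>
    proof (cases "j \<le> N")
      case True
      then have "N + j \<in> {1..2*N}" "\<not> N + j \<le> N" using j by auto
      then show ?thesis using Gn[OF j] Gn[of "N + j"] True x by (auto simp: split)
    next
      case False
      then have l: "j - N \<in> {1..N}" "N + (j - N) = j" using j by auto
      have xab: "x \<in> {a..b}" using x endpoints by auto
      have "bv y j x = (\<Sum>j'=1..2*N. phi_mat a b N Z \<phi> j' (j - N + N - 1) x *v ?G y j')"
        using conjunct2[OF A, rule_format, OF l(1) x] l(2) by simp
      also have "\<dots> = (\<Sum>p\<in>?I. c p *s bv (\<psi> p) (N + (j - N)) x)" unfolding comb[symmetric] c_def ..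
      also have "\<dots> = bv n j x" using nc[OF _ j xab] l(2) by simp
      finally show ?thesis by simp
    qed
    then have "bv (y - n) j x = 0" if "j \<in> {1..2*N}" "x \<in> {a, b}" for j x
      using bv_diff[OF yg n0 that(1)] that endpoints by auto
    moreover have "(y - n, g - 0) \<in> Hmax" by (rule lin_graph_diff[OF lin_graph_Hmax yg n0])
    ultimately have "(y - n, g) \<in> Hmin" by (simp add: Hmin_iff)
    moreover have "y - (y - n) = n" by simp
    ultimately have "(y, g) \<in> krein" using yg n0 unfolding krein_def by auto
    then show "y \<in> Domain krein" by blast
  qed
qed

text \<open>The first \<open>N\<close> block rows express the condition at \<open>a\<close>, the
  last \<open>N\<close> the condition at \<open>b\<close>. The identity block of \<open>A_K\<close>
  carries the higher quasi-derivatives at \<open>a\<close>, that of \<open>B_K\<close> those at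
  \<open>b\<close>.\<close>

lemma boundary_condition_iff:
  fixes \<phi> :: "nat \<Rightarrow> 'm \<Rightarrow> real \<Rightarrow> complex^'m"
  shows "(\<forall>j\<in>{1..2*N}.
         bmat_vec_mult (2*N) (A_K a b N Z \<phi>) (boundary_vec a b N Z y a) j =
         bmat_vec_mult (2*N) (B_K a b N Z \<phi>) (boundary_vec a b N Z y b) j) \<longleftrightarrow>
    (\<forall>l\<in>{1..N}. \<forall>x\<in>{a, b}. bv y (N + l) x =
      (\<Sum>j=1..2*N. phi_mat a b N Z \<phi> j (l + N - 1) x *v Gamma_map a b N Z y j))"
proof -
  let ?P = "phi_mat a b N Z \<phi>" and ?G = "Gamma_map a b N Z y"
  have sum2: "(\<Sum>k=1..2*N. f k) = (\<Sum>k=1..N. f k) + (\<Sum>k=1..N. f (N + k))" for f :: "nat \<Rightarrow> complex^'m"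
  proof -
    have "(\<Sum>k=1..2*N. f k) = (\<Sum>k=1..N. f k) + (\<Sum>k=N+1..2*N. f k)"
      using sum.ub_add_nat[of 1 N f N] by (simp add: mult_2)
    also have "(\<Sum>k=N+1..2*N. f k) = (\<Sum>k=1..N. f (N + k))"
      using sum.shift_bounds_cl_nat_ivl[of f 1 N N] by (simp add: mult_2 add.commute)
    finally show ?thesis .
  qed
  have one: "(\<Sum>k=1..N. bmat_one l k *v w k) = w l" if "l \<in> {1..N}" for l and w :: "nat \<Rightarrow> complex^'m"
  proof -
    have "(\<Sum>k=1..N. bmat_one l k *v w k) = (\<Sum>k=1..N. if k = l then w l else 0)"
      by (rule sum.cong) (auto simp: bmat_one_def)
    then show ?thesis using that by simp
  qed
  have neg: "(\<Sum>k=1..N. - M k *v w k) = - (\<Sum>k=1..N. M k *v w k)" for M :: "nat \<Rightarrow> complex^'m^'m" and w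
  proof -
    have "- A *v v = - (A *v v)" for A :: "complex^'m^'m" and v
      by (simp add: vec_eq_iff matrix_vector_mult_def sum_negf)
    then show ?thesis by (simp add: sum_negf)
  qed
  \<comment> \<open>The quasi-derivative of order \<open>N + l - 1\<close> of the kernel element
    with the \<open>\<Gamma>\<close> data of \<open>y\<close>, split into the contributions of the
    data at \<open>a\<close> and at \<open>b\<close>.\<close>
  define S where "S l x = (\<Sum>k=1..N. ?P k (l + N - 1) x *v bv y k a) + (\<Sum>k=1..N. ?P (k + N) (l + N - 1) x *v bv y k b)" for l x
  have SG: "(\<Sum>j=1..2*N. ?P j (l + N - 1) x *v ?G j) = S l x" for l x
    unfolding sum2 S_def by (intro arg_cong2[where f = "(+)"] sum.cong) (auto simp: Gamma_map_def add.commute)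
  have row1: "bmat_vec_mult (2*N) (A_K a b N Z \<phi>) (boundary_vec a b N Z y a) l =
         bmat_vec_mult (2*N) (B_K a b N Z \<phi>) (boundary_vec a b N Z y b) l \<longleftrightarrow> bv y (N + l) a = S l a"
    if l: "l \<in> {1..N}" for l
  proof -
    have "bmat_vec_mult (2*N) (A_K a b N Z \<phi>) (boundary_vec a b N Z y a) l
        = (\<Sum>k=1..N. - ?P k (l + N - 1) a *v bv y k a) + (\<Sum>k=1..N. bmat_one l k *v bv y (N + k) a)"
      unfolding bmat_vec_mult_def sum2 using l
      by (intro arg_cong2[where f = "(+)"] sum.cong)
        (auto simp: A_K_def bmat_four_def bmat_uminus_def Phi_mat_def boundary_vec_def)
    also have "\<dots> = bv y (N + l) a - (\<Sum>k=1..N. ?P k (l + N - 1) a *v bv y k a)"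
      unfolding neg one[OF l] by simp
    finally have A: "bmat_vec_mult (2*N) (A_K a b N Z \<phi>) (boundary_vec a b N Z y a) l
        = bv y (N + l) a - (\<Sum>k=1..N. ?P k (l + N - 1) a *v bv y k a)" .
    have "bmat_vec_mult (2*N) (B_K a b N Z \<phi>) (boundary_vec a b N Z y b) l
        = (\<Sum>k=1..N. ?P (k + N) (l + N - 1) a *v bv y k b) + (\<Sum>k=1..N. 0)"
      unfolding bmat_vec_mult_def sum2 using l
      by (intro arg_cong2[where f = "(+)"] sum.cong)
        (auto simp: B_K_def bmat_four_def bmat_zero_def Phi_mat_def boundary_vec_def)
    then show ?thesis unfolding A S_def by (auto simp: algebra_simps)
  qed
  have row2: "bmat_vec_mult (2*N) (A_K a b N Z \<phi>) (boundary_vec a b N Z y a) (N + l) =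
         bmat_vec_mult (2*N) (B_K a b N Z \<phi>) (boundary_vec a b N Z y b) (N + l) \<longleftrightarrow> bv y (N + l) b = S l b"
    if l: "l \<in> {1..N}" for l
  proof -
    have A: "bmat_vec_mult (2*N) (A_K a b N Z \<phi>) (boundary_vec a b N Z y a) (N + l)
        = (\<Sum>k=1..N. ?P k (l + N - 1) b *v bv y k a) + (\<Sum>k=1..N. 0)"
      unfolding bmat_vec_mult_def sum2 using l
      by (intro arg_cong2[where f = "(+)"] sum.cong)
        (auto simp: A_K_def bmat_four_def bmat_zero_def Phi_mat_def boundary_vec_def)
    have "bmat_vec_mult (2*N) (B_K a b N Z \<phi>) (boundary_vec a b N Z y b) (N + l)
        = (\<Sum>k=1..N. - ?P (k + N) (l + N - 1) b *v bv y k b) + (\<Sum>k=1..N. bmat_one l k *v bv y (N + k) b)"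
      unfolding bmat_vec_mult_def sum2 using l
      by (intro arg_cong2[where f = "(+)"] sum.cong)
        (auto simp: B_K_def bmat_four_def bmat_uminus_def Phi_mat_def boundary_vec_def)
    also have "\<dots> = bv y (N + l) b - (\<Sum>k=1..N. ?P (k + N) (l + N - 1) b *v bv y k b)"
      unfolding neg one[OF l] by simp
    finally show ?thesis unfolding A S_def by (auto simp: algebra_simps)
  qed
  have split: "(\<forall>j\<in>{1..2*N}. Q j) \<longleftrightarrow> (\<forall>l\<in>{1..N}. Q l \<and> Q (N + l))" for Q
  proof (intro iffI ballI)
    fix j assume Q: "\<forall>l\<in>{1..N}. Q l \<and> Q (N + l)" and j: "j \<in> {1..2*N}"
    show "Q j"
    proof (cases "j \<le> N")
      case False
      then have "j - N \<in> {1..N}" "N + (j - N) = j" using j by auto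
      then show ?thesis using Q by metis
    qed (use Q j in auto)
  qed auto
  show ?thesis unfolding split SG using row1 row2 by auto
qed

end

theorem theorem3p3:
  fixes a b :: real and N :: nat
    and W :: "real \<Rightarrow> complex ^ 'm::finite ^ 'm"
    and Z :: "nat \<Rightarrow> nat \<Rightarrow> real \<Rightarrow> complex ^ 'm ^ 'm"
    and \<phi> :: "nat \<Rightarrow> 'm \<Rightarrow> real \<Rightarrow> complex ^ 'm"
  assumes "standing_hypothesis a b N W Z"
    and "AE x in lebesgue_on {a..b}. positive_definite (Z N (N+1) x)"
    and "strictly_positive_op a b W (H_min a b N W Z)"
    and "ae_basis a b ({1..2*N} \<times> UNIV) (\<lambda>(j, k). \<phi> j k) (kernel_op (H_max a b N W Z))"
    and "\<And>j k l. j \<in> {1..2*N} \<Longrightarrow> l \<in> {1..2*N} \<Longrightarrow>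
           Gamma_map a b N Z (\<phi> j k) l = (if j = l then axis k 1 else 0)"
  shows "Domain (Krein_von_Neumann_extension a b W (H_min a b N W Z)) =
    {y \<in> dom_max a b N W Z.
       \<forall>j\<in>{1..2*N}.
         bmat_vec_mult (2*N) (A_K a b N Z \<phi>) (boundary_vec a b N Z y a) j =
         bmat_vec_mult (2*N) (B_K a b N Z \<phi>) (boundary_vec a b N Z y b) j}"
proof -
  interpret quasi_diff a b N W Z by unfold_locales (rule assms(1))
  have "Krein_von_Neumann_extension a b W (H_min a b N W Z) = krein"
    by (rule Krein_von_Neumann_extension_eq[OF assms(4) nonneg_Hmin_if_strictly_positive[OF assms(3)]])
  then show ?thesis
    using Domain_krein[OF assms(4,5)] boundary_condition_iff by auto
qed

end
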